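(* Let $A$ be a sectorial operator on a Banach space $X$ and let $\phi\in(\phi_A,\pi)$. Let $\psi\neq0$ be any holomorphic function on $S_\phi$ such that $\psi\in\mathcal{E}(S_\phi)$ and $(\cdot)^{-1}\psi\in\mathcal{E}(S_\phi)$. Then, for any Banach function space $\Phi$ over $\mathbb{R}_+$ with $\min(1,\tfrac1{(\cdot)})\in\Phi$ and such that the Calderón operator $P+Q$ is bounded on $\Phi$, $$(X,D_A)_\Phi=\bigl\{x\in X:\ [(0,\infty)\ni t\mapsto |t^{-1}\psi(tA)x|_X]\in\Phi\bigr\}$$ and $$|x|_{(X,D_A)_\Phi}\simeq |x|_X+\bigl\|(\cdot)^{-1}|\psi(\cdot A)x|_X\bigr\|_\Phi\qquad(x\in(X,D_A)_\Phi).$$ If, in addition, $A$ is invertible, then $$|x|_{(X,D_A)_\Phi}\simeq \bigl\|(\cdot)^{-1}|\psi(\cdot A)x|_X\bigr\|_\Phi\qquad(x\in(X,D_A)_\Phi).$$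
   Context: Banach function space: $\mathcal{M}$ is the set of complex measurable functions on $\mathbb{R}_+=[0,\infty)$ (topology of convergence in Lebesgue measure). A Banach function space over $\mathbb{R}_+$ is a Banach space $\Phi$ that is a Banach lattice and an order ideal of $\mathcal{M}$: it is a sublattice of $\mathcal{M}$, and $|f|\le|g|$, $g\in\Phi$, $f\in\mathcal{M}$ implies $f\in\Phi$, $\|f\|_\Phi\le\|g\|_\Phi$. $Pf(t)=\frac1t\int_0^tf(s)\,ds$ is the Hardy operator, with maximal domain $L^1_{loc}(\mathbb{R}_+)$, and $Qf(t)=\int_t^\infty f(s)\,\frac{ds}{s}$ is its formal adjoint, defined for all $f$ with $f\chi_{(\tau,\infty)}\in L^1(t^{-1}dt)$ for every $\tau>0$. $P+Q$ bounded on $\Phi$ means that $\Phi$ is contained in the domains of $P$ and $Q$ and $P+Q:\Phi\to\Phi$ is bounded. Interpolation space: $D_A$ is the domain of $A$ with the graph norm. For $x\in X+D_A=X$, $K(t,x)=\inf\{|a|_X+t|b|_{D_A}:a\in X,\,b\in D_A,\,a+b=x\}$, and $(X,D_A)_\Phi=\{x\in X:[t\mapsto t^{-1}K(t,x)]\in\Phi\}$ with norm $\|(\cdot)^{-1}K(\cdot,x)\|_\Phi$. Sectorial operators: for $\phi\in(0,\pi)$, $S_\phi=\{z\in\mathbb{C}:z\ne0,|\arg z|<\phi\}$. A linear, not necessarily densely defined operator $A$ on $X$ is sectorial of angle $\phi\in(0,\pi)$ if $\sigma(A)\subseteq\overline{S_\phi}$ and $\sup_{\lambda\in\mathbb{C}\setminus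 S_{\phi'}}|\lambda R(\lambda,A)|_{\mathcal{L}(X)}<\infty$ for every $\phi'\in(\phi,\pi)$, where $R(\lambda,A)=(\lambda-A)^{-1}$; $A$ is sectorial if it is sectorial of some angle in $(0,\pi)$, and $\phi_A$ is the infimum of all $\phi>0$ such that $A$ is sectorial of angle $\phi$. $A$ need not be injective. Functional calculus: $H^\infty(S_\phi)$ is the algebra of bounded holomorphic functions on $S_\phi$; $H^\infty_0(S_\phi)=\{f\in H^\infty(S_\phi):\exists C,s>0,\ |f(z)|\le C\min(|z|^s,|z|^{-s})\ (z\in S_\phi)\}$; $\mathcal{E}(S_\phi)=H_0^\infty(S_\phi)\oplus\langle(1+z)^{-1}\rangle\oplus\langle1\rangle$. For $f\in H^\infty_0(S_\phi)$, $f(A)=\frac1{2\pi i}\int_{\partial S_{\phi'}}f(z)R(z,A)\,dz$ for any $\phi'\in(\phi_A,\phi)$ (positively oriented boundary), and for $f=f_0+\frac{\lambda}{1+\cdot}+\mu\in\mathcal{E}(S_\phi)$ with $f_0\in H^\infty_0(S_\phi)$, $\lambda,\mu\in\mathbb{C}$, $f(A)=f_0(A)+\lambda(I+A)^{-1}+\mu$. For $t>0$, $\psi(tA)$ is this calculus applied to the sectorial operator $tA$. $\simeq$ means equivalence up to positive multiplicative constants independent of $x$. *)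

theory Defs
  imports "HOL-Analysis.Analysis"
begin

class complex_banach = banach +
  fixes scaleC :: "complex \<Rightarrow> 'a \<Rightarrow> 'a"  (infixr \<open>*\<^sub>C\<close> 75)
  assumes scaleC_add_right: "a *\<^sub>C (x + y) = a *\<^sub>C x + a *\<^sub>C y"
    and scaleC_add_left: "(a + b) *\<^sub>C x = a *\<^sub>C x + b *\<^sub>C x"
    and scaleC_scaleC: "a *\<^sub>C b *\<^sub>C x = (a * b) *\<^sub>C x"
    and scaleC_of_real: "complex_of_real r *\<^sub>C x = r *\<^sub>R x"
    and norm_scaleC: "norm (a *\<^sub>C x) = cmod a * norm x"

instantiation complex :: complex_banach
begin

definition "scaleC = ((*) :: complex \<Rightarrow> complex \<Rightarrow> complex)"

instance
  by standard (auto simp: scaleC_complex_def algebra_simps norm_mult scaleR_conv_of_real)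

end

text \<open>An operator is given by its domain \<open>D\<close> and a function \<open>A\<close>; the values of \<open>A\<close> outside
  \<open>D\<close> play no role.\<close>

definition linear_operator :: "'a::complex_banach set \<Rightarrow> ('a \<Rightarrow> 'a) \<Rightarrow> bool" where
  "linear_operator D A \<longleftrightarrow>
     0 \<in> D \<and>
     (\<forall>x\<in>D. \<forall>y\<in>D. x + y \<in> D \<and> A (x + y) = A x + A y) \<and>
     (\<forall>c. \<forall>x\<in>D. c *\<^sub>C x \<in> D \<and> A (c *\<^sub>C x) = c *\<^sub>C A x)"

definition resolvent :: "'a::complex_banach set \<Rightarrow> ('a \<Rightarrow> 'a) \<Rightarrow> complex \<Rightarrow> 'a \<Rightarrow> 'a" where
  "resolvent D A z = inv_into D (\<lambda>x. z *\<^sub>C x - A x)"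

definition resolvent_set :: "'a::complex_banach set \<Rightarrow> ('a \<Rightarrow> 'a) \<Rightarrow> complex set" where
  "resolvent_set D A =
     {z. bij_betw (\<lambda>x. z *\<^sub>C x - A x) D UNIV \<and> bounded_linear (resolvent D A z)}"

definition spectrum :: "'a::complex_banach set \<Rightarrow> ('a \<Rightarrow> 'a) \<Rightarrow> complex set" where
  "spectrum D A = - resolvent_set D A"

definition graph_norm :: "('a::complex_banach \<Rightarrow> 'a) \<Rightarrow> 'a \<Rightarrow> real" where
  "graph_norm A x = norm x + norm (A x)"

definition sector :: "real \<Rightarrow> complex set" where
  "sector \<phi> = {z. z \<noteq> 0 \<and> \<bar>Arg z\<bar> < \<phi>}"

text \<open>The supremum ranges over the complement of a sector, which contains 0. That point contributes
  0, whether or not it lies in the spectrum; all other points of the complement lie in the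
  resolvent set.\<close>

definition sectorial_of_angle :: "'a::complex_banach set \<Rightarrow> ('a \<Rightarrow> 'a) \<Rightarrow> real \<Rightarrow> bool" where
  "sectorial_of_angle D A \<phi> \<longleftrightarrow>
     0 < \<phi> \<and> \<phi> < pi \<and> linear_operator D A \<and>
     spectrum D A \<subseteq> closure (sector \<phi>) \<and>
     (\<forall>\<phi>'. \<phi> < \<phi>' \<and> \<phi>' < pi \<longrightarrow>
        bdd_above ((\<lambda>z. onorm (\<lambda>x. z *\<^sub>C resolvent D A z x)) ` (- sector \<phi>')))"

definition sectorial :: "'a::complex_banach set \<Rightarrow> ('a \<Rightarrow> 'a) \<Rightarrow> bool" where
  "sectorial D A \<longleftrightarrow> (\<exists>\<phi>. sectorial_of_angle D A \<phi>)"

definition sectoriality_angle :: "'a::complex_banach set \<Rightarrow> ('a \<Rightarrow> 'a) \<Rightarrow> real" where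
  "sectoriality_angle D A = Inf {\<phi>. sectorial_of_angle D A \<phi>}"

text \<open>Functions on a sector are total functions on the complex plane, whose values outside the
  sector are irrelevant.\<close>

definition Hinf :: "real \<Rightarrow> (complex \<Rightarrow> complex) set" where
  "Hinf \<phi> = {f. f holomorphic_on sector \<phi> \<and> bounded (f ` sector \<phi>)}"

definition Hinf0 :: "real \<Rightarrow> (complex \<Rightarrow> complex) set" where
  "Hinf0 \<phi> = {f \<in> Hinf \<phi>. \<exists>C s. 0 < C \<and> 0 < s \<and>
     (\<forall>z\<in>sector \<phi>. cmod (f z) \<le> C * min (cmod z powr s) (cmod z powr (- s)))}"

definition Eclass :: "real \<Rightarrow> (complex \<Rightarrow> complex) set" where
  "Eclass \<phi> = {f. \<exists>f\<^sub>0 \<in> Hinf0 \<phi>. \<exists>l m. \<forall>z\<in>sector \<phi>. f z = f\<^sub>0 z + l / (1 + z) + m}"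

text \<open>The positively oriented boundary of the sector of angle \<open>\<nu>\<close> runs from infinity to 0 along
  the ray of argument \<open>\<nu>\<close> and then from 0 to infinity along the ray of argument \<open>-\<nu>\<close>. The contour
  integral is a Henstock-Kurzweil integral, since the Bochner integral of the library requires a
  separable range space. In \<open>calculus0\<close> the value is, by Cauchy's theorem, the same for every \<open>\<nu>\<close>
  strictly between the sectoriality angle and \<open>\<phi>\<close>.\<close>

definition sector_integral :: "real \<Rightarrow> (complex \<Rightarrow> 'a::complex_banach) \<Rightarrow> 'a" where
  "sector_integral \<nu> F =
     integral {0..} (\<lambda>r. cis (- \<nu>) *\<^sub>C F (of_real r * cis (- \<nu>))) -
     integral {0..} (\<lambda>r. cis \<nu> *\<^sub>C F (of_real r * cis \<nu>))"

definition calculus0 ::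
  "'a::complex_banach set \<Rightarrow> ('a \<Rightarrow> 'a) \<Rightarrow> real \<Rightarrow> (complex \<Rightarrow> complex) \<Rightarrow> 'a \<Rightarrow> 'a" where
  "calculus0 D A \<phi> f x =
     (let \<nu> = (SOME \<nu>. sectoriality_angle D A < \<nu> \<and> \<nu> < \<phi>)
      in (1 / (2 * of_real pi * \<i>)) *\<^sub>C sector_integral \<nu> (\<lambda>z. f z *\<^sub>C resolvent D A z x))"

text \<open>The coefficients \<open>l\<close>, \<open>m\<close> in the decomposition of \<open>f \<in> Eclass \<phi>\<close> are unique: \<open>m\<close> is the limit
  of \<open>f\<close> at infinity and \<open>l + m\<close> the limit of \<open>f\<close> at 0.\<close>

definition calculus ::
  "'a::complex_banach set \<Rightarrow> ('a \<Rightarrow> 'a) \<Rightarrow> real \<Rightarrow> (complex \<Rightarrow> complex) \<Rightarrow> 'a \<Rightarrow> 'a" where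
  "calculus D A \<phi> f x =
     (let (l, m) = (THE (l, m). (\<lambda>z. f z - l / (1 + z) - m) \<in> Hinf0 \<phi>)
      in calculus0 D A \<phi> (\<lambda>z. f z - l / (1 + z) - m) x
         + l *\<^sub>C inv_into D (\<lambda>y. y + A y) x + m *\<^sub>C x)"

text \<open>A Banach function space is given by the set \<open>\<Phi>\<close> of all representatives of its elements and
  by its norm \<open>N\<close> as a function of representatives. Membership and norm are determined by the
  values almost everywhere on \<open>[0,\<infinity>)\<close>, by the ideal property. That property also
  makes \<open>\<Phi>\<close> a sublattice and \<open>N\<close> a lattice norm.\<close>

locale banach_function_space =
  fixes \<Phi> :: "(real \<Rightarrow> complex) set" and N :: "(real \<Rightarrow> complex) \<Rightarrow> real"
  assumes measurable: "f \<in> \<Phi> \<Longrightarrow> f \<in> borel_measurable (lebesgue_on {0..})"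
    and zero: "(\<lambda>t. 0) \<in> \<Phi>"
    and add: "f \<in> \<Phi> \<Longrightarrow> g \<in> \<Phi> \<Longrightarrow> (\<lambda>t. f t + g t) \<in> \<Phi>"
    and scale: "f \<in> \<Phi> \<Longrightarrow> (\<lambda>t. c * f t) \<in> \<Phi>"
    and norm_eq_0: "f \<in> \<Phi> \<Longrightarrow> N f = 0 \<longleftrightarrow> (AE t in lebesgue_on {0..}. f t = 0)"
    and norm_scale: "f \<in> \<Phi> \<Longrightarrow> N (\<lambda>t. c * f t) = cmod c * N f"
    and norm_triangle: "f \<in> \<Phi> \<Longrightarrow> g \<in> \<Phi> \<Longrightarrow> N (\<lambda>t. f t + g t) \<le> N f + N g"
    and complete:
      "(\<And>n. F n \<in> \<Phi>) \<Longrightarrow>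
       (\<And>e. e > 0 \<Longrightarrow> \<exists>n0. \<forall>m\<ge>n0. \<forall>n\<ge>n0. N (\<lambda>t. F m t - F n t) < e) \<Longrightarrow>
       \<exists>f\<in>\<Phi>. (\<lambda>n. N (\<lambda>t. F n t - f t)) \<longlonglongrightarrow> 0"
    and ideal:
      "g \<in> \<Phi> \<Longrightarrow> f \<in> borel_measurable (lebesgue_on {0..}) \<Longrightarrow>
       (AE t in lebesgue_on {0..}. cmod (f t) \<le> cmod (g t)) \<Longrightarrow> f \<in> \<Phi> \<and> N f \<le> N g"

definition P_domain :: "(real \<Rightarrow> complex) set" where
  "P_domain = {f \<in> borel_measurable (lebesgue_on {0..}).
     \<forall>\<tau>>0. set_integrable lebesgue {0..\<tau>} f}"

definition P_op :: "(real \<Rightarrow> complex) \<Rightarrow> real \<Rightarrow> complex" where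
  "P_op f t = of_real (1 / t) * (LINT s:{0..t}|lebesgue. f s)"

definition Q_domain :: "(real \<Rightarrow> complex) set" where
  "Q_domain = {f \<in> borel_measurable (lebesgue_on {0..}).
     \<forall>\<tau>>0. set_integrable lebesgue {\<tau><..} (\<lambda>t. f t / of_real t)}"

definition Q_op :: "(real \<Rightarrow> complex) \<Rightarrow> real \<Rightarrow> complex" where
  "Q_op f t = (LINT s:{t<..}|lebesgue. f s / of_real s)"

definition calderon_bounded ::
  "(real \<Rightarrow> complex) set \<Rightarrow> ((real \<Rightarrow> complex) \<Rightarrow> real) \<Rightarrow> bool" where
  "calderon_bounded \<Phi> N \<longleftrightarrow>
     \<Phi> \<subseteq> P_domain \<inter> Q_domain \<and>
     (\<exists>C. \<forall>f\<in>\<Phi>. (\<lambda>t. P_op f t + Q_op f t) \<in> \<Phi> \<and>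
        N (\<lambda>t. P_op f t + Q_op f t) \<le> C * N f)"

definition K_functional ::
  "'a::complex_banach set \<Rightarrow> ('a \<Rightarrow> 'a) \<Rightarrow> real \<Rightarrow> 'a \<Rightarrow> real" where
  "K_functional D A t x = Inf {norm a + t * graph_norm A b | a b. b \<in> D \<and> a + b = x}"

definition interp_space ::
  "'a::complex_banach set \<Rightarrow> ('a \<Rightarrow> 'a) \<Rightarrow> (real \<Rightarrow> complex) set \<Rightarrow> 'a set" where
  "interp_space D A \<Phi> = {x. (\<lambda>t. of_real (K_functional D A t x / t)) \<in> \<Phi>}"

definition interp_norm ::
  "'a::complex_banach set \<Rightarrow> ('a \<Rightarrow> 'a) \<Rightarrow> ((real \<Rightarrow> complex) \<Rightarrow> real) \<Rightarrow> 'a \<Rightarrow> real" where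
  "interp_norm D A N x = N (\<lambda>t. of_real (K_functional D A t x / t))"

definition equivalent_on :: "'a set \<Rightarrow> ('a \<Rightarrow> real) \<Rightarrow> ('a \<Rightarrow> real) \<Rightarrow> bool" where
  "equivalent_on S p q \<longleftrightarrow>
     (\<exists>c C. 0 < c \<and> 0 < C \<and> (\<forall>x\<in>S. c * q x \<le> p x \<and> p x \<le> C * q x))"

definition psi_orbit :: "'a::complex_banach set \<Rightarrow> ('a \<Rightarrow> 'a) \<Rightarrow> real \<Rightarrow>
  (complex \<Rightarrow> complex) \<Rightarrow> 'a \<Rightarrow> real \<Rightarrow> complex" where
  "psi_orbit D A \<phi> \<psi> x t =
     of_real (norm ((1 / t) *\<^sub>R calculus D (\<lambda>y. t *\<^sub>R A y) \<phi> \<psi> x))"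

end

theory Submission
  imports Defs "HOL-Complex_Analysis.Complex_Analysis"
begin

text \<open>Write \<open>U\<^sub>t = (1 + tA)\<^sup>-\<^sup>1\<close>. Since \<open>\<psi>\<close> and \<open>\<psi>/z\<close> lie in the extended class,
  \<open>|\<psi>(tA)(a + b)|\<close> is at most a constant times \<open>|a| + t |A b|\<close>, so \<open>|\<psi>(tA)x|\<close> is dominated by the
  K-functional. For the converse choose \<open>n \<ge> 2\<close> such that \<open>c = \<integral>\<^sub>0\<^sup>\<infinity> (1 + s)\<^sup>-\<^sup>n \<psi>(s) ds/s\<close> is nonzero; such an
  \<open>n\<close> exists because the moments of a nonzero continuous function on \<open>[0,1]\<close> do not all vanish. The
  function \<open>h\<close> with \<open>-z h'(z) = (1 + z)\<^sup>-\<^sup>n \<psi>(z)\<close> tends to \<open>0\<close> at infinity and to \<open>c\<close> at \<open>0\<close>, and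
  \<open>t d/dt h(tA)x = - U\<^sub>t\<^sup>n \<psi>(tA)x\<close>. Integrating this over \<open>(0,t)\<close>, and the corresponding identity
  for \<open>A h(tA)x\<close> over \<open>(t,\<infinity>)\<close>, bounds the two parts of the decomposition
  \<open>c x = (c x - h(tA)x) + h(tA)x\<close> by the Hardy operator and its adjoint applied to
  \<open>|t\<^sup>-\<^sup>1 \<psi>(tA)x|\<close>. The limit \<open>h(tA)x \<rightarrow> c x\<close> as \<open>t \<rightarrow> 0\<close> exists by integrability
  and is identified after applying the injective operator \<open>U\<^sub>1\<close>, which maps into \<open>D\<close>.
  Since only powers of \<open>U\<^sub>t\<close> multiply \<open>\<psi>(tA)\<close>, the resolvent identity and Cauchy's theorem
  replace general multiplicativity of the calculus.\<close>

section \<open>Integrals over rays\<close>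

text \<open>The values lie in an arbitrary Banach space and the integrals are Henstock-Kurzweil
  integrals, so limits are not exchanged with vector-valued integrals by dominated convergence.
  Estimates take its place: contours are truncated to [1/(n+1), n+1] with boundary terms of known
  size, derivatives of f(tA) in t come from a second-order expansion of the resolvent with explicit
  remainder, and a derivative in t is integrated by the mean value inequality against a scalar
  primitive. Since \<open>A\<close> is not assumed densely defined, limits as t tends to 0 are
  computed directly only on the domain. The factor (1+s)^-n serves two ends: it removes a possible
  nonzero limit of \<psi> at infinity, and it makes h decay fast enough for A h(tA) to be bounded.
  The condition n \<ge> 2 enters through z (1+z)^-n = (1+z)^-(n-1) - (1+z)^-n, where both powers on
  the right have to be positive. All estimates are uniform in t because tA obeys the same resolvent
  bound as \<open>A\<close> on the same region; hence the calculus is built in a locale that is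
  reinterpreted for every tA.\<close>

lemma bounded_bilinear_scaleC: "bounded_bilinear (scaleC :: complex \<Rightarrow> 'a::complex_banach \<Rightarrow> 'a)"
proof
  fix a a' :: complex and b b' :: 'a and r :: real
  show "(a + a') *\<^sub>C b = a *\<^sub>C b + a' *\<^sub>C b" by (rule scaleC_add_left)
  show "a *\<^sub>C (b + b') = a *\<^sub>C b + a *\<^sub>C b'" by (rule scaleC_add_right)
  show "(r *\<^sub>R a) *\<^sub>C b = r *\<^sub>R a *\<^sub>C b"
    by (metis scaleC_of_real scaleC_scaleC scaleR_conv_of_real)
  show "a *\<^sub>C (r *\<^sub>R b) = r *\<^sub>R a *\<^sub>C b"
    by (metis mult.commute scaleC_of_real scaleC_scaleC)
  show "\<exists>K. \<forall>a (b::'a). norm (a *\<^sub>C b) \<le> norm a * norm b * K"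
    by (rule exI[of _ 1]) (simp add: norm_scaleC)
qed

interpretation scaleC: bounded_bilinear "scaleC :: complex \<Rightarrow> 'a::complex_banach \<Rightarrow> 'a"
  by (rule bounded_bilinear_scaleC)

lemma scaleC_one [simp]: "1 *\<^sub>C (x::'a::complex_banach) = x"
  using scaleC_of_real[of 1 x] by simp

lemma scaleC_neg_one [simp]: "(-1) *\<^sub>C (x::'a::complex_banach) = - x"
  using scaleC.minus_left[of 1 x] by simp

lemma scaleC_left_eq_iff: "a \<noteq> 0 \<Longrightarrow> a *\<^sub>C x = a *\<^sub>C y \<longleftrightarrow> x = (y::'a::complex_banach)"
  by (metis left_inverse scaleC_one scaleC_scaleC)

text \<open>The size of f(z) R(z,A)x on a ray: the \<open>Hinf0\<close> bound min(r^s, r^-s) divided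
  by r.\<close>

definition ray_weight :: "real \<Rightarrow> real \<Rightarrow> real" where
  "ray_weight s r = min (r powr (s - 1)) (r powr (- s - 1))"

lemma ray_weight_nonneg [simp]: "0 \<le> ray_weight s r"
  by (simp add: ray_weight_def)

lemma ray_weight_eq_lower: "0 < r \<Longrightarrow> r \<le> 1 \<Longrightarrow> 0 < s \<Longrightarrow> ray_weight s r = r powr (s - 1)"
  unfolding ray_weight_def by (rule min_absorb1) (rule powr_mono', auto)

lemma ray_weight_eq_upper: "1 \<le> r \<Longrightarrow> 0 < s \<Longrightarrow> ray_weight s r = r powr (- s - 1)"
  unfolding ray_weight_def by (rule min_absorb2) (rule powr_mono, auto)

lemma ray_weight_mono:
  assumes "0 < s'" "s' \<le> s" "0 < r"
  shows "ray_weight s r \<le> ray_weight s' r"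
proof (cases "r \<le> 1")
  case True
  then show ?thesis
    using assms by (auto simp: ray_weight_eq_lower intro!: powr_mono')
next
  case False
  then show ?thesis
    using assms by (auto simp: ray_weight_eq_upper intro!: powr_mono)
qed

lemma mult_ray_weight_lower: "0 < r \<Longrightarrow> r \<le> 1 \<Longrightarrow> 0 < s \<Longrightarrow> r * ray_weight s r = r powr s"
  by (simp add: ray_weight_eq_lower powr_mult_base)

lemma mult_ray_weight_upper: "1 \<le> r \<Longrightarrow> 0 < s \<Longrightarrow> r * ray_weight s r = r powr (- s)"
  by (simp add: ray_weight_eq_upper powr_mult_base)

text \<open>The reciprocal endpoints of [1/(n+1), n+1] give boundary terms of the same size, so one
  null sequence controls both ends of a truncated contour.\<close>

lemma mult_ray_weight_Suc:
  assumes "0 < s"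
  shows "real (Suc n) * ray_weight s (real (Suc n)) = real (Suc n) powr (- s)"
    and "inverse (real (Suc n)) * ray_weight s (inverse (real (Suc n))) = real (Suc n) powr (- s)"
proof -
  show "real (Suc n) * ray_weight s (real (Suc n)) = real (Suc n) powr (- s)"
    using assms by (intro mult_ray_weight_upper) auto
  have "inverse (real (Suc n)) \<le> 1" "0 < inverse (real (Suc n))" by (simp_all add: inverse_le_1_iff)
  then show "inverse (real (Suc n)) * ray_weight s (inverse (real (Suc n))) = real (Suc n) powr (- s)"
    using mult_ray_weight_lower[OF _ _ assms] by (simp only: powr_minus inverse_powr)
qed

lemma real_Suc_powr_tendsto_0: "0 < s \<Longrightarrow> (\<lambda>n. real (Suc n) powr (- s)) \<longlonglongrightarrow> 0"
  by (intro tendsto_neg_powr filterlim_compose[OF filterlim_real_sequentially filterlim_Suc]) auto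

lemma min_powr_eq_ray_weight:
  "0 < r \<Longrightarrow> min (r powr s) (r powr (- s)) = r * ray_weight s r"
  by (simp add: ray_weight_def min_mult_distrib_left powr_mult_base)

text \<open>For Banach space values, integrability up to the singular endpoint is obtained from the
  fundamental theorem of calculus: G(x), the integral of \<open>F\<close> over [x,b], extends
  continuously to 0 and has derivative -F inside.\<close>

lemma integrable_on_Icc_0_dominated:
  fixes F :: "real \<Rightarrow> 'a::banach"
  assumes cont: "continuous_on {0<..} F" and s: "0 < s" and b: "0 < b"
    and le: "\<And>r. 0 < r \<Longrightarrow> r \<le> b \<Longrightarrow> norm (F r) \<le> C * r powr (s - 1)"
  shows "F integrable_on {0..b}"
proof -
  define G where "G x = integral {x..b} F" for x
  have int: "F integrable_on {x..y}" if "0 < x" for x y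
    by (rule integrable_continuous_interval) (use that in \<open>auto intro: continuous_on_subset[OF cont]\<close>)
  have C: "0 \<le> C"
    using order_trans[OF norm_ge_zero le[OF b order_refl]] b by (simp add: zero_le_mult_iff)
  have est: "norm (G x - G y) \<le> C / s * (y powr s - x powr s)" if "0 < x" "x \<le> y" "y \<le> b" for x y
  proof -
    have "G x = integral {x..y} F + G y"
      unfolding G_def using that int by (simp add: Henstock_Kurzweil_Integration.integral_combine)
    moreover have "norm (integral {x..y} F) \<le> integral {x..y} (\<lambda>r. C * r powr (s - 1))"
      by (rule integral_norm_bound_integral)
        (use that le int[of x y] in \<open>auto intro!: integrable_continuous_real continuous_intros\<close>)
    moreover have "((\<lambda>r. C * r powr (s - 1)) has_integral (C / s * (y powr s - x powr s))) {x..y}"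
      unfolding right_diff_distrib
      by (rule fundamental_theorem_of_calculus)
        (use that s in \<open>auto intro!: derivative_eq_intros simp flip: has_real_derivative_iff_has_vector_derivative\<close>)
    ultimately show ?thesis by (metis add_diff_cancel_right' integral_unique)
  qed
  \<comment> \<open>By \<open>est\<close>, increments of \<open>G\<close> are at most those of C/s
    x^s, which is continuous on the compact interval [0,b].\<close>
  have uc: "uniformly_continuous_on {0<..b} G"
    unfolding uniformly_continuous_on_def
  proof (intro allI impI)
    fix \<epsilon> :: real assume \<epsilon>: "0 < \<epsilon>"
    have "continuous_on {0..b} (\<lambda>x. C / s * x powr s)"
      using s by (intro continuous_on_mult_left continuous_on_powr' continuous_intros) auto
    then have "uniformly_continuous_on {0..b} (\<lambda>x. C / s * x powr s)"
      by (rule compact_uniformly_continuous) simp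
    then obtain d where d: "d > 0" "\<And>x y. x \<in> {0..b} \<Longrightarrow> y \<in> {0..b} \<Longrightarrow> dist y x < d \<Longrightarrow>
        dist (C / s * y powr s) (C / s * x powr s) < \<epsilon>"
      unfolding uniformly_continuous_on_def using \<epsilon> by meson
    have "dist (G y) (G x) < \<epsilon>" if "x \<in> {0<..b}" "y \<in> {0<..b}" "dist y x < d" for x y
    proof -
      have "dist (C / s * y powr s) (C / s * x powr s) < \<epsilon>" using d(2)[of x y] that by auto
      moreover have "norm (G y - G x) \<le> \<bar>C / s * y powr s - C / s * x powr s\<bar>"
        using est[of x y] est[of y x] that
        by (cases "x \<le> y") (auto simp: norm_minus_commute right_diff_distrib)
      ultimately show ?thesis by (simp add: dist_norm)
    qed
    then show "\<exists>d>0. \<forall>x\<in>{0<..b}. \<forall>x'\<in>{0<..b}. dist x' x < d \<longrightarrow> dist (G x') (G x) < \<epsilon>"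
      using d(1) by blast
  qed
  obtain g where g: "uniformly_continuous_on (closure {0<..b}) g" "\<And>x. x \<in> {0<..b} \<Longrightarrow> G x = g x"
    using uniformly_continuous_on_extension_on_closure[OF uc] by metis
  have gc: "continuous_on {0..b} g"
    using uniformly_continuous_imp_continuous[OF g(1)] b by simp
  have "(g has_vector_derivative - F x) (at x)" if x: "x \<in> {0<..<b}" for x
  proof -
    have "((\<lambda>u. integral {u..b} F) has_vector_derivative - F x) (at x within {x/2..b})"
      by (rule integral_has_vector_derivative') (use x in \<open>auto intro: continuous_on_subset[OF cont]\<close>)
    then have "(G has_vector_derivative - F x) (at x)"
      unfolding G_def using x by (subst (asm) at_within_interior) (auto simp: interior_atLeastAtMost_real)
    then show ?thesis
      by (rule has_vector_derivative_transform_within_open[where S="{0<..<b}"]) (use x g in auto)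
  qed
  then have "((\<lambda>x. - F x) has_integral (g b - g 0)) {0..b}"
    using gc b by (intro fundamental_theorem_of_calculus_interior) auto
  then show ?thesis using integrable_neg_iff by blast
qed

text \<open>The bound C/s arises once from (0,1] and once from [1,\<infinity>); the truncation error
  is the same computation on (0,a] and [b,\<infinity>).\<close>

lemma ray_dominated:
  fixes F :: "real \<Rightarrow> 'a::banach"
  assumes cont: "continuous_on {0<..} F" and s: "0 < s"
    and le: "\<And>r. 0 < r \<Longrightarrow> norm (F r) \<le> C * ray_weight s r"
  shows ray_integrable: "F integrable_on {0..}"
    and ray_integral_bound: "norm (integral {0..} F) \<le> 2 * C / s"
    and ray_integral_truncate: "\<And>a b. 0 < a \<Longrightarrow> a \<le> 1 \<Longrightarrow> 1 \<le> b \<Longrightarrow>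
      norm (integral {0..} F - integral {a..b} F) \<le> C / s * (a powr s + b powr (- s))"
proof -
  have C: "0 \<le> C"
    using order_trans[OF norm_ge_zero le[of 1]] by (simp add: ray_weight_def)
  have int: "F integrable_on {x..y}" if "0 < x" for x y
    by (rule integrable_continuous_interval) (use that in \<open>auto intro: continuous_on_subset[OF cont]\<close>)
  have lo: "norm (F r) \<le> C * r powr (s - 1)" and up: "norm (F r) \<le> C * r powr (- s - 1)" if "0 < r" for r
    using order_trans[OF le[OF that, unfolded ray_weight_def] mult_left_mono[OF min.cobounded1 C]]
      order_trans[OF le[OF that, unfolded ray_weight_def] mult_left_mono[OF min.cobounded2 C]] by auto
  have int0: "F integrable_on {0..b}" if "0 < b" for b
    by (rule integrable_on_Icc_0_dominated[OF cont s that]) (use lo in auto)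
  have n0: "norm (integral {0..b} F) \<le> C / s * b powr s" if "0 < b" for b
  proof -
    have h: "((\<lambda>r. C * r powr (s - 1)) has_integral (C / s * b powr s)) {0..b}"
      using has_integral_mult_right[OF has_integral_powr_from_0[of "s - 1" b], of C] s that by simp
    \<comment> \<open>The majorant is assumed for r > 0 only, so the point 0 is dropped before the
      integrals are compared.\<close>
    have "integral {0<..b} F = integral {0..b} F"
      by (rule integral_subset_negligible) (auto intro: negligible_subset[of "{0}"])
    moreover have "integral {0<..b} (\<lambda>r. C * r powr (s - 1)) = integral {0..b} (\<lambda>r. C * r powr (s - 1))"
      by (rule integral_subset_negligible) (auto intro: negligible_subset[of "{0}"])
    moreover have "norm (integral {0<..b} F) \<le> integral {0<..b} (\<lambda>r. C * r powr (s - 1))"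
    proof (rule integral_norm_bound_integral)
      show "F integrable_on {0<..b}"
        by (rule integrable_spike_set[OF int0[OF that]]) (auto intro: negligible_subset[of "{0}"])
      show "(\<lambda>r. C * r powr (s - 1)) integrable_on {0<..b}"
        by (rule integrable_spike_set[OF has_integral_integrable[OF h]]) (auto intro: negligible_subset[of "{0}"])
    qed (use lo in auto)
    ultimately show ?thesis using integral_unique[OF h] by (simp only:)
  qed
  have hinf: "((\<lambda>r. C * r powr (- s - 1)) has_integral (C / s * b powr (- s))) {b..}" if "0 < b" for b
    using has_integral_mult_right[OF has_integral_powr_to_inf[of "- s - 1" b], of C] s that by simp
  have intb: "F integrable_on {b..}" if "0 < b" for b
  proof (rule integrable_on_all_intervals_integrable_bound)
    show "(\<lambda>x. if x \<in> {b..} then F x else 0) integrable_on cbox x y" for x y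
    proof -
      have "{b..} \<inter> {x..y} = {max b x..y}" by auto
      then show ?thesis
        using int[of "max b x" y] that unfolding integrable_restrict_Int cbox_interval by simp
    qed
    show "(\<lambda>r. C * r powr (- s - 1)) integrable_on {b..}" using hinf[OF that] by auto
  qed (use up that in auto)
  have nb: "norm (integral {b..} F) \<le> C / s * b powr (- s)" if "0 < b" for b
  proof -
    have "norm (integral {b..} F) \<le> integral {b..} (\<lambda>r. C * r powr (- s - 1))"
      using hinf[OF that] by (intro integral_norm_bound_integral intb that) (use up that in auto)
    then show ?thesis using integral_unique[OF hinf[OF that]] by (simp only:)
  qed
  have split: "(F has_integral (integral {0..b} F + integral {b..} F)) {0..}" if "0 < b" for b
  proof -
    have "(F has_integral (integral {0..b} F + integral {b..} F)) ({0..b} \<union> {b..})"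
    proof (rule has_integral_Un)
      have "{0..b} \<inter> {b..} = {b}" using that by auto
      then show "negligible ({0..b} \<inter> {b..})" by simp
    qed (use int0 intb that in \<open>auto simp: has_integral_integral[symmetric]\<close>)
    moreover have "{0..b} \<union> {b..} = {0..}" using that by auto
    ultimately show ?thesis by simp
  qed
  show "F integrable_on {0..}" using split[of 1] by auto
  show "norm (integral {0..} F) \<le> 2 * C / s"
    using integral_unique[OF split[of 1]] n0[of 1] nb[of 1] norm_triangle_ineq[of "integral {0..1} F" "integral {1..} F"]
    by simp
  fix a b :: real assume ab: "0 < a" "a \<le> 1" "1 \<le> b"
  have "integral {0..b} F = integral {0..a} F + integral {a..b} F"
    using Henstock_Kurzweil_Integration.integral_combine[of 0 a b F] ab int0[of b] by simp
  then have "integral {0..} F - integral {a..b} F = integral {0..a} F + integral {b..} F"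
    using integral_unique[OF split[of b]] ab by simp
  then show "norm (integral {0..} F - integral {a..b} F) \<le> C / s * (a powr s + b powr (- s))"
    using n0[of a] nb[of b] ab norm_triangle_ineq[of "integral {0..a} F" "integral {b..} F"]
    by (simp add: distrib_left)
qed

lemma ray_integral_limit:
  fixes F :: "real \<Rightarrow> 'a::banach"
  assumes cont: "continuous_on {0<..} F" and s: "0 < s"
    and le: "\<And>r. 0 < r \<Longrightarrow> norm (F r) \<le> C * ray_weight s r"
  shows "(\<lambda>n. integral {inverse (real (Suc n))..real (Suc n)} F) \<longlonglongrightarrow> integral {0..} F"
proof (rule LIM_zero_cancel, rule Lim_null_comparison)
  have a: "(\<lambda>n. real (Suc n) powr (- s)) \<longlonglongrightarrow> 0"
    by (rule real_Suc_powr_tendsto_0[OF s])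
  then have "(\<lambda>n. C / s * (real (Suc n) powr (- s) + real (Suc n) powr (- s))) \<longlonglongrightarrow> C / s * (0 + 0)"
    by (intro tendsto_intros)
  then show "(\<lambda>n. C / s * (inverse (real (Suc n)) powr s + real (Suc n) powr (- s))) \<longlonglongrightarrow> 0"
    by (simp add: powr_minus inverse_powr)
  have "norm (integral {0..} F - integral {inverse (real (Suc n))..real (Suc n)} F)
      \<le> C / s * (inverse (real (Suc n)) powr s + real (Suc n) powr (- s))" for n
    by (rule ray_integral_truncate[OF cont s le]) (auto simp: field_simps)
  then show "\<forall>\<^sub>F n in sequentially. norm (integral {inverse (real (Suc n))..real (Suc n)} F - integral {0..} F)
      \<le> C / s * (inverse (real (Suc n)) powr s + real (Suc n) powr (- s))"
    by (simp only: norm_minus_commute) simp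
qed

section \<open>Sectors\<close>

lemma has_vector_derivative_chain_scaleC:
  fixes F :: "complex \<Rightarrow> 'a::complex_banach"
  assumes "(\<gamma> has_vector_derivative \<gamma>') (at r within T)" "(F has_derivative (\<lambda>h. h *\<^sub>C d)) (at (\<gamma> r))"
  shows "((\<lambda>r. F (\<gamma> r)) has_vector_derivative \<gamma>' *\<^sub>C d) (at r within T)"
  using has_derivative_compose[OF assms(1)[unfolded has_vector_derivative_def] assms(2)]
  by (simp add: has_vector_derivative_def scaleC.scaleR_left)

text \<open>Cauchy's theorem for a wedge. In polar coordinates the \<theta>-derivative of cis
  \<theta> F(r cis \<theta>) equals the r-derivative of \<i> r cis \<theta> F(r cis \<theta>).
  Rotating a truncated ray therefore changes its integral only through the two endpoint values, and
  these tend to 0.\<close>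

lemma ray_integral_rotate:
  fixes F F' :: "complex \<Rightarrow> 'a::complex_banach"
  assumes ab: "\<alpha> \<le> \<beta>" and s: "0 < s"
    and der: "\<And>\<theta> r. \<theta> \<in> {\<alpha>..\<beta>} \<Longrightarrow> 0 < r \<Longrightarrow>
      (F has_derivative (\<lambda>h. h *\<^sub>C F' (of_real r * cis \<theta>))) (at (of_real r * cis \<theta>))"
    and cont: "continuous_on {of_real r * cis \<theta> | r \<theta>. 0 < r \<and> \<theta> \<in> {\<alpha>..\<beta>}} F'"
    and le: "\<And>\<theta> r. \<theta> \<in> {\<alpha>..\<beta>} \<Longrightarrow> 0 < r \<Longrightarrow> norm (F (of_real r * cis \<theta>)) \<le> C * ray_weight s r"
  shows "integral {0..} (\<lambda>r. cis \<alpha> *\<^sub>C F (of_real r * cis \<alpha>)) =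
         integral {0..} (\<lambda>r. cis \<beta> *\<^sub>C F (of_real r * cis \<beta>))"
proof (cases "\<alpha> = \<beta>")
  case False
  with ab have ab: "\<alpha> < \<beta>" by simp
  let ?S = "{complex_of_real r * cis \<theta> | r \<theta>. 0 < r \<and> \<theta> \<in> {\<alpha>..\<beta>}}"
  let ?H = "\<lambda>\<theta> r. cis \<theta> *\<^sub>C F (of_real r * cis \<theta>)"
  let ?a = "\<lambda>n. inverse (real (Suc n))" and ?b = "\<lambda>n. real (Suc n)"
  \<comment> \<open>The common value of the two partial derivatives, in \<theta> (fact
    \<open>d\<theta>\<close>) and in r (fact \<open>dr\<close>).\<close>
  define fx where "fx \<theta> r = (\<i> * cis \<theta>) *\<^sub>C F (of_real r * cis \<theta>)
      + cis \<theta> *\<^sub>C (of_real r * (\<i> * cis \<theta>)) *\<^sub>C F' (of_real r * cis \<theta>)" for \<theta> r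
  have cF: "continuous_on ?S F"
    by (rule continuous_at_imp_continuous_on) (use has_derivative_continuous[OF der] in blast)
  have cis_der: "(cis has_vector_derivative \<i> * cis \<theta>) (at \<theta> within T)" for \<theta> T
    unfolding cis_conv_exp
    by (rule derivative_eq_intros has_vector_derivative_real_field | simp)+
  have cont_fx: "continuous_on ({\<alpha>..\<beta>} \<times> cbox (?a n) (?b n)) (\<lambda>(\<theta>, r). fx \<theta> r)" for n
  proof -
    have "?a n > 0" by simp
    have sub: "(\<lambda>p. complex_of_real (snd p) * cis (fst p)) ` ({\<alpha>..\<beta>} \<times> cbox (?a n) (?b n)) \<subseteq> ?S"
    proof (rule image_subsetI)
      fix p assume p: "p \<in> {\<alpha>..\<beta>} \<times> cbox (?a n) (?b n)"
      then have "?a n \<le> snd p" by auto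
      with \<open>?a n > 0\<close> have "0 < snd p" by (rule less_le_trans)
      then show "complex_of_real (snd p) * cis (fst p) \<in> ?S"
        using p by (intro CollectI exI[of _ "snd p"] exI[of _ "fst p"]) auto
    qed
    have cc: "continuous_on ({\<alpha>..\<beta>} \<times> cbox (?a n) (?b n)) (\<lambda>p. complex_of_real (snd p) * cis (fst p))"
      unfolding cis_conv_exp by (intro continuous_intros)
    have c: "continuous_on ({\<alpha>..\<beta>} \<times> cbox (?a n) (?b n)) (\<lambda>p. cis (fst p))"
      unfolding cis_conv_exp by (intro continuous_intros)
    have r: "continuous_on ({\<alpha>..\<beta>} \<times> cbox (?a n) (?b n)) (\<lambda>p. complex_of_real (snd p))"
      by (intro continuous_intros)
    show ?thesis
      unfolding fx_def case_prod_unfold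
      by (rule continuous_on_add scaleC.continuous_on continuous_on_mult continuous_on_const c r
          continuous_on_compose2[OF cF cc sub] continuous_on_compose2[OF cont cc sub])+
  qed
  have d\<theta>: "((\<lambda>\<theta>. ?H \<theta> r) has_vector_derivative fx \<theta> r) (at \<theta> within {\<alpha>..\<beta>})"
    if "\<theta> \<in> {\<alpha>..\<beta>}" "0 < r" for \<theta> r
  proof -
    have "((\<lambda>\<theta>. complex_of_real r * cis \<theta>) has_vector_derivative of_real r * (\<i> * cis \<theta>)) (at \<theta> within {\<alpha>..\<beta>})"
      using has_vector_derivative_mult_right[OF cis_der] by simp
    then have "((\<lambda>\<theta>. F (of_real r * cis \<theta>)) has_vector_derivative
        (of_real r * (\<i> * cis \<theta>)) *\<^sub>C F' (of_real r * cis \<theta>)) (at \<theta> within {\<alpha>..\<beta>})"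
      by (rule has_vector_derivative_chain_scaleC[where F = F and \<gamma> = "\<lambda>\<theta>. of_real r * cis \<theta>"])
        (rule der[OF that])
    from scaleC.has_vector_derivative[OF cis_der this]
    show ?thesis unfolding fx_def by (simp add: add.commute)
  qed
  have dr: "((\<lambda>r. (\<i> * of_real r * cis \<theta>) *\<^sub>C F (of_real r * cis \<theta>)) has_vector_derivative fx \<theta> r) (at r within T)"
    if "\<theta> \<in> {\<alpha>..\<beta>}" "0 < r" for \<theta> r T
  proof -
    have 1: "((\<lambda>r. complex_of_real r * cis \<theta>) has_vector_derivative cis \<theta>) (at r within T)"
      by (rule derivative_eq_intros | simp add: has_vector_derivative_of_real)+
    then have 2: "((\<lambda>r. F (of_real r * cis \<theta>)) has_vector_derivative
        cis \<theta> *\<^sub>C F' (of_real r * cis \<theta>)) (at r within T)"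
      by (rule has_vector_derivative_chain_scaleC[where F = F and \<gamma> = "\<lambda>r. of_real r * cis \<theta>"])
        (rule der[OF that])
    have 3: "((\<lambda>r. \<i> * of_real r * cis \<theta>) has_vector_derivative \<i> * cis \<theta>) (at r within T)"
      using has_vector_derivative_mult_right[OF 1, of \<i>] by (simp add: mult.assoc)
    from scaleC.has_vector_derivative[OF 3 2] show ?thesis
      unfolding fx_def by (simp add: scaleC_scaleC mult_ac add.commute)
  qed
  \<comment> \<open>The mean value inequality in \<theta>: the derivative of the truncated integral
    is a difference of endpoint values, each at most C (n+1)^-s.\<close>
  have bound: "norm (integral {?a n..?b n} (?H \<beta>) - integral {?a n..?b n} (?H \<alpha>))
      \<le> 2 * C * ?b n powr (- s) * (\<beta> - \<alpha>)" for n
  proof -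
    have pos: "0 < r" if "r \<in> {?a n..?b n}" for r
      using that less_le_trans[of 0 "?a n" r] by auto
    have D: "((\<lambda>\<theta>. integral {?a n..?b n} (?H \<theta>)) has_vector_derivative integral {?a n..?b n} (fx \<theta>))
        (at \<theta> within {\<alpha>..\<beta>})" if "\<theta> \<in> {\<alpha>..\<beta>}" for \<theta>
    proof -
      have "((\<lambda>\<theta>. integral (cbox (?a n) (?b n)) (?H \<theta>)) has_vector_derivative
          integral (cbox (?a n) (?b n)) (fx \<theta>)) (at \<theta> within {\<alpha>..\<beta>})"
    proof (rule leibniz_rule_vector_derivative[OF _ _ cont_fx that])
      fix \<theta> assume t: "\<theta> \<in> {\<alpha>..\<beta>}"
      show "?H \<theta> integrable_on cbox (?a n) (?b n)"
      proof (rule integrable_continuous, intro scaleC.continuous_on continuous_intros continuous_on_compose2[OF cF])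
        show "(\<lambda>r. complex_of_real r * cis \<theta>) ` cbox (?a n) (?b n) \<subseteq> ?S"
        proof (rule image_subsetI)
          fix r assume "r \<in> cbox (?a n) (?b n)"
          then have "0 < r" using pos unfolding cbox_interval by blast
          then show "complex_of_real r * cis \<theta> \<in> ?S" using t by blast
        qed
      qed
    qed (use pos d\<theta> in auto)
      then show ?thesis by (simp only: cbox_interval)
    qed
    have val: "norm (integral {?a n..?b n} (fx \<theta>)) \<le> 2 * C * ?b n powr (- s)" if t: "\<theta> \<in> {\<alpha>..\<beta>}" for \<theta>
    proof -
      let ?G = "\<lambda>r. (\<i> * of_real r * cis \<theta>) *\<^sub>C F (of_real r * cis \<theta>)"
      have "(fx \<theta> has_integral (?G (?b n) - ?G (?a n))) {?a n..?b n}"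
      proof (rule fundamental_theorem_of_calculus)
        have "?a n \<le> 1" by (simp add: inverse_le_1_iff)
        then show "?a n \<le> ?b n" by simp
        show "(?G has_vector_derivative fx \<theta> r) (at r within {?a n..?b n})" if "r \<in> {?a n..?b n}" for r
          using t pos[OF that] by (rule dr)
      qed
      then have "norm (integral {?a n..?b n} (fx \<theta>)) \<le> norm (?G (?b n)) + norm (?G (?a n))"
        using norm_triangle_ineq4 by (simp only: integral_unique)
      moreover have G: "norm (?G r) \<le> C * (r * ray_weight s r)" if "0 < r" for r
        using mult_left_mono[OF le[OF t that], of r] that by (simp add: norm_scaleC norm_mult algebra_simps)
      moreover note mult_ray_weight_Suc[OF s, of n]
      ultimately show ?thesis
        using G[of "?a n"] G[of "?b n"] by (simp del: of_nat_Suc)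
    qed
    have "norm (integral {?a n..?b n} (?H \<beta>) - integral {?a n..?b n} (?H \<alpha>))
        \<le> 2 * C * ?b n powr (- s) * \<beta> - 2 * C * ?b n powr (- s) * \<alpha>"
    proof (rule differentiable_bound_general[OF ab, where f' = "\<lambda>\<theta>. integral {?a n..?b n} (fx \<theta>)"
          and \<phi>' = "\<lambda>_. 2 * C * ?b n powr (- s)"])
      show "continuous_on {\<alpha>..\<beta>} (\<lambda>\<theta>. integral {?a n..?b n} (?H \<theta>))"
        using has_vector_derivative_continuous[OF D] by (auto simp: continuous_on_eq_continuous_within)
      show "((\<lambda>\<theta>. integral {?a n..?b n} (?H \<theta>)) has_vector_derivative integral {?a n..?b n} (fx \<theta>)) (at \<theta>)"
        if "\<alpha> < \<theta>" "\<theta> < \<beta>" for \<theta>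
      proof -
        have "at \<theta> within {\<alpha>..\<beta>} = at \<theta>" using that by (rule at_within_Icc_at)
        moreover have "\<theta> \<in> {\<alpha>..\<beta>}" using that by simp
        ultimately show ?thesis using D[of \<theta>] by (simp only:)
      qed
    qed (use val in \<open>auto intro!: continuous_intros derivative_eq_intros
          simp: has_real_derivative_iff_has_vector_derivative[symmetric] simp del: of_nat_Suc\<close>)
    then show ?thesis by (simp only: right_diff_distrib)
  qed
  have lim: "(\<lambda>n. integral {?a n..?b n} (?H \<theta>)) \<longlonglongrightarrow> integral {0..} (?H \<theta>)" if "\<theta> \<in> {\<alpha>..\<beta>}" for \<theta>
  proof (rule ray_integral_limit[OF _ s])
    show "continuous_on {0<..} (?H \<theta>)"
      by (intro scaleC.continuous_on continuous_intros continuous_on_compose2[OF cF]) (use that in auto)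
    show "norm (?H \<theta> r) \<le> C * ray_weight s r" if "0 < r" for r
      using le[OF \<open>\<theta> \<in> _\<close> that] by (simp add: norm_scaleC)
  qed
  have "(\<lambda>n. integral {?a n..?b n} (?H \<beta>) - integral {?a n..?b n} (?H \<alpha>)) \<longlonglongrightarrow> 0"
  proof (rule Lim_null_comparison)
    have "(\<lambda>n. ?b n powr (- s)) \<longlonglongrightarrow> 0"
      by (rule real_Suc_powr_tendsto_0[OF s])
    then have "(\<lambda>n. 2 * C * ?b n powr (- s) * (\<beta> - \<alpha>)) \<longlonglongrightarrow> 2 * C * 0 * (\<beta> - \<alpha>)"
      by (intro tendsto_intros)
    then show "(\<lambda>n. 2 * C * ?b n powr (- s) * (\<beta> - \<alpha>)) \<longlonglongrightarrow> 0" by simp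
  qed (use bound in auto)
  moreover have "(\<lambda>n. integral {?a n..?b n} (?H \<beta>) - integral {?a n..?b n} (?H \<alpha>))
      \<longlonglongrightarrow> integral {0..} (?H \<beta>) - integral {0..} (?H \<alpha>)"
    using lim[of \<alpha>] lim[of \<beta>] ab by (intro tendsto_intros) auto
  ultimately show ?thesis using LIMSEQ_unique by fastforce
qed simp

text \<open>For 0 \<le> \<mu> \<le> \<pi> these are the nonzero z with |Arg z| > \<mu>. Written with
  real part and modulus, the region is visibly open across the negative axis, where
  \<open>Arg\<close> jumps.\<close>

definition cosector :: "real \<Rightarrow> complex set" where
  "cosector \<mu> = {z. Re z < cmod z * cos \<mu>}"

lemma sector_iff:
  assumes "0 \<le> \<phi>" "\<phi> \<le> pi"
  shows "z \<in> sector \<phi> \<longleftrightarrow> cmod z * cos \<phi> < Re z"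
proof (cases "z = 0")
  case False
  have "Re z = cmod z * cos \<bar>Arg z\<bar>"
    by (metis Re_rcis abs_of_nonneg abs_of_nonpos cos_minus linear rcis_cmod_Arg)
  then have "cmod z * cos \<phi> < Re z \<longleftrightarrow> cos \<phi> < cos \<bar>Arg z\<bar>"
    using False by (metis mult_less_cancel_left_pos zero_less_norm_iff)
  also have "\<dots> \<longleftrightarrow> \<bar>Arg z\<bar> < \<phi>"
    by (rule cos_mono_less_eq) (use assms Arg_bounded[of z] in linarith)+
  finally show ?thesis
    using False by (simp add: sector_def)
qed (simp add: sector_def)

lemma rcis_mem_sector:
  assumes "0 < r" "\<bar>\<theta>\<bar> < \<phi>" "\<phi> \<le> pi"
  shows "complex_of_real r * cis \<theta> \<in> sector \<phi>"
proof -
  have "cos \<phi> < cos \<bar>\<theta>\<bar>" using assms by (intro cos_monotone_0_pi) auto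
  then show ?thesis using assms by (subst sector_iff) (auto simp: norm_mult abs_if split: if_splits)
qed

lemma rcis_mem_cosector:
  assumes "0 < r" "0 \<le> \<mu>" "\<mu> < \<bar>\<theta>\<bar>" "\<bar>\<theta>\<bar> \<le> pi"
  shows "complex_of_real r * cis \<theta> \<in> cosector \<mu>"
proof -
  have "cos \<bar>\<theta>\<bar> < cos \<mu>" using assms by (intro cos_monotone_0_pi) auto
  then show ?thesis using assms by (auto simp: cosector_def norm_mult abs_if split: if_splits)
qed

lemma open_sector: "0 \<le> \<phi> \<Longrightarrow> \<phi> \<le> pi \<Longrightarrow> open (sector \<phi>)"
proof -
  assume "0 \<le> \<phi>" "\<phi> \<le> pi"
  then have "sector \<phi> = {z. cmod z * cos \<phi> < Re z}" by (auto simp: sector_iff)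
  then show ?thesis by (simp add: open_Collect_less continuous_intros)
qed

lemma open_cosector: "open (cosector \<mu>)"
  by (simp add: cosector_def open_Collect_less continuous_intros)

lemma cosector_nonzero: "z \<in> cosector \<mu> \<Longrightarrow> z \<noteq> 0"
  by (auto simp: cosector_def)

lemma of_real_mem_sector: "0 < r \<Longrightarrow> 0 < \<phi> \<Longrightarrow> complex_of_real r \<in> sector \<phi>"
  by (simp add: sector_def)

lemma scaleR_mem_cosector: "0 < t \<Longrightarrow> z \<in> cosector \<mu> \<Longrightarrow> t *\<^sub>R z \<in> cosector \<mu>"
  by (simp add: cosector_def mult.assoc)

lemma scaleR_mem_sector: "0 < t \<Longrightarrow> z \<in> sector \<mu> \<Longrightarrow> t *\<^sub>R z \<in> sector \<mu>"
  by (simp add: sector_def scaleR_conv_of_real Arg_times_of_real)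

text \<open>The centre is 1. A sector of angle above \<pi>/2 is not convex, hence two cases: for cos
  \<phi> \<ge> 0 the function |w| cos \<phi> - Re w is convex, and for cos \<phi> < 0 the triangle
  inequality is used in the opposite direction.\<close>

lemma starlike_sector:
  assumes "0 < \<phi>" "\<phi> < pi"
  shows "starlike (sector \<phi>)"
  unfolding starlike_def
proof (intro bexI[of _ 1] ballI subsetI)
  show "1 \<in> sector \<phi>" using of_real_mem_sector[of 1 \<phi>] assms by simp
next
  fix z w assume z: "z \<in> sector \<phi>" and "w \<in> closed_segment 1 z"
  then obtain t where t: "0 \<le> t" "t \<le> 1" and w: "w = (1 - t) *\<^sub>R 1 + t *\<^sub>R z"
    by (auto simp: closed_segment_def)
  define k where "k = cos \<phi>"
  have z': "cmod z * k < Re z" using z assms by (simp add: sector_iff k_def)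
  have k: "k < 1" "-1 < k" using assms cos_monotone_0_pi[of 0 \<phi>] cos_monotone_0_pi[of \<phi> pi] by (auto simp: k_def)
  have "cmod w * k < Re w"
  proof (cases "k \<ge> 0")
    case True
    have "cmod w \<le> (1 - t) + t * cmod z"
      unfolding w using t norm_triangle_ineq[of "(1 - t) *\<^sub>R 1" "t *\<^sub>R z"] by simp
    then have "cmod w * k \<le> (1 - t) * k + t * (cmod z * k)"
      using True mult_right_mono[of "cmod w" "(1 - t) + t * cmod z" k] by (simp add: algebra_simps)
    also have "\<dots> < (1 - t) + t * Re z"
    proof (cases "t = 0")
      case False
      then have "t * (cmod z * k) < t * Re z" using t z' by simp
      moreover have "(1 - t) * k \<le> (1 - t) * 1" using t k by (intro mult_left_mono) auto
      ultimately show ?thesis by simp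
    qed (use k in simp)
    finally show ?thesis by (simp add: w)
  next
    case False
    show ?thesis
    proof (cases "t = 0")
      case t0: False
      have "t * cmod z \<le> cmod w + (1 - t)"
        using t norm_triangle_ineq4[of w "(1 - t) *\<^sub>R 1"] by (simp add: w)
      then have "(cmod w + (1 - t)) * k \<le> t * cmod z * k"
        using False by (intro mult_right_mono_neg) auto
      moreover have "t * (cmod z * k) < t * Re z" using t t0 z' by simp
      moreover have "(1 - t) * (-1) \<le> (1 - t) * k" using t k by (intro mult_left_mono) auto
      moreover have "Re w = (1 - t) + t * Re z" by (simp add: w)
      ultimately show ?thesis by (simp add: algebra_simps)
    qed (use k w in simp)
  qed
  then show "w \<in> sector \<phi>" using assms by (simp add: sector_iff k_def)
qed

text \<open>The constant is cos (\<phi>/2): with c = cos \<phi> and r = |z|, the lower bound 1 + 2rc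
  + r^2 of |1+z|^2 equals (1+c)/2 (1+r)^2 + (1-c)/2 (1-r)^2.\<close>

lemma norm_one_plus_ge:
  assumes "0 < \<phi>" "\<phi> < pi"
  obtains \<kappa> where "0 < \<kappa>" "\<And>z. z \<in> sector \<phi> \<Longrightarrow> \<kappa> * (1 + cmod z) \<le> cmod (1 + z)"
proof
  let ?c = "(1 + cos \<phi>) / 2"
  have c: "0 < ?c" "cos \<phi> < 1"
    using assms cos_monotone_0_pi[of \<phi> pi] cos_monotone_0_pi[of 0 \<phi>] by auto
  then show "0 < sqrt ?c" by simp
  fix z assume "z \<in> sector \<phi>"
  then have z: "cmod z * cos \<phi> < Re z" using assms by (simp add: sector_iff)
  have "(cmod (1 + z))\<^sup>2 = 1 + 2 * Re z + (cmod z)\<^sup>2"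
    unfolding cmod_power2 by (simp add: power2_eq_square algebra_simps)
  moreover have "0 \<le> (1 - cos \<phi>) * (1 - cmod z)\<^sup>2" using c by simp
  ultimately have "?c * (1 + cmod z)\<^sup>2 \<le> (cmod (1 + z))\<^sup>2"
    using z by (simp add: power2_eq_square field_simps)
  then have "sqrt (?c * (1 + cmod z)\<^sup>2) \<le> cmod (1 + z)"
    by (rule real_le_lsqrt[rotated]) simp
  then show "sqrt ?c * (1 + cmod z) \<le> cmod (1 + z)"
    by (simp only: real_sqrt_mult real_sqrt_abs abs_of_nonneg norm_ge_zero add_nonneg_nonneg zero_le_one)
qed

lemma one_plus_nonzero: "z \<in> sector \<phi> \<Longrightarrow> \<phi> \<le> pi \<Longrightarrow> 1 + z \<noteq> 0"
  using Arg_eq_pi[of "-1"] by (auto simp: sector_def add_eq_0_iff)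

section \<open>Bounded and decaying holomorphic functions on a sector\<close>

lemma Hinf0I:
  assumes "f holomorphic_on sector \<phi>" "0 < s"
    and le: "\<And>z. z \<in> sector \<phi> \<Longrightarrow> cmod (f z) \<le> C * min (cmod z powr s) (cmod z powr (- s))"
  shows "f \<in> Hinf0 \<phi>"
proof -
  have le': "cmod (f z) \<le> max C 1 * min (cmod z powr s) (cmod z powr (- s))" if "z \<in> sector \<phi>" for z
    using le[OF that] by (rule order_trans) (intro mult_right_mono, auto)
  moreover have "cmod (f z) \<le> max C 1" if "z \<in> sector \<phi>" for z
  proof -
    have "z \<noteq> 0" using that by (simp add: sector_def)
    then have "min (cmod z powr s) (cmod z powr (- s)) \<le> 1"
      using \<open>0 < s\<close> by (cases "cmod z \<le> 1") (auto simp: min_le_iff_disj powr_le_one_le powr_le1 powr_minus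
        intro!: disjI2 inverse_le_1_iff[THEN iffD2] ge_one_powr_ge_zero)
    then show ?thesis using le'[OF that] mult_left_le[of "min (cmod z powr s) (cmod z powr (- s))" "max C 1"] by linarith
  qed
  ultimately show ?thesis
    using assms(1,2) unfolding Hinf0_def Hinf_def bounded_iff
    by (intro CollectI conjI exI[of _ "max C 1"] exI[of _ s]) auto
qed

lemma Hinf0E:
  assumes "f \<in> Hinf0 \<phi>"
  obtains C s where "0 < C" "0 < s" "f holomorphic_on sector \<phi>"
    "\<And>z. z \<in> sector \<phi> \<Longrightarrow> cmod (f z) \<le> C * (cmod z * ray_weight s (cmod z))"
proof -
  from assms obtain C s where "0 < C" "0 < s" "f holomorphic_on sector \<phi>"
    and *: "\<And>z. z \<in> sector \<phi> \<Longrightarrow> cmod (f z) \<le> C * min (cmod z powr s) (cmod z powr (- s))"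
    by (auto simp: Hinf0_def Hinf_def)
  moreover have "cmod (f z) \<le> C * (cmod z * ray_weight s (cmod z))" if "z \<in> sector \<phi>" for z
    using *[OF that] that by (simp add: min_powr_eq_ray_weight sector_def)
  ultimately show thesis using that by blast
qed

lemma Hinf0I':
  assumes "f holomorphic_on sector \<phi>" "0 < s"
    and "\<And>z. z \<in> sector \<phi> \<Longrightarrow> cmod (f z) \<le> C * (cmod z * ray_weight s (cmod z))"
  shows "f \<in> Hinf0 \<phi>"
  by (rule Hinf0I[OF assms(1,2)]) (use assms(3) in \<open>auto simp: min_powr_eq_ray_weight sector_def\<close>)

lemma Hinf0_add:
  assumes "f \<in> Hinf0 \<phi>" "g \<in> Hinf0 \<phi>"
  shows "(\<lambda>z. f z + g z) \<in> Hinf0 \<phi>"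
proof -
  obtain C s where f: "0 < C" "0 < s" "f holomorphic_on sector \<phi>"
    "\<And>z. z \<in> sector \<phi> \<Longrightarrow> cmod (f z) \<le> C * (cmod z * ray_weight s (cmod z))"
    using Hinf0E[OF assms(1)] by blast
  obtain C' s' where g: "0 < C'" "0 < s'" "g holomorphic_on sector \<phi>"
    "\<And>z. z \<in> sector \<phi> \<Longrightarrow> cmod (g z) \<le> C' * (cmod z * ray_weight s' (cmod z))"
    using Hinf0E[OF assms(2)] by blast
  show ?thesis
  proof (rule Hinf0I'[where s = "min s s'" and C = "C + C'"])
    fix z assume z: "z \<in> sector \<phi>"
    then have "0 < cmod z" by (simp add: sector_def)
    then have w: "ray_weight s (cmod z) \<le> ray_weight (min s s') (cmod z)"
      "ray_weight s' (cmod z) \<le> ray_weight (min s s') (cmod z)"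
      using f g by (auto intro!: ray_weight_mono)
    have "cmod (f z) \<le> C * (cmod z * ray_weight (min s s') (cmod z))"
      using f(4)[OF z] by (rule order_trans) (intro mult_left_mono w, use f in auto)
    moreover have "cmod (g z) \<le> C' * (cmod z * ray_weight (min s s') (cmod z))"
      using g(4)[OF z] by (rule order_trans) (intro mult_left_mono w, use g in auto)
    ultimately show "cmod (f z + g z) \<le> (C + C') * (cmod z * ray_weight (min s s') (cmod z))"
      using norm_triangle_ineq[of "f z" "g z"] by (simp add: distrib_right)
  qed (use f g in \<open>auto intro: holomorphic_intros\<close>)
qed

lemma Hinf0_mult_Hinf:
  assumes "f \<in> Hinf0 \<phi>" "g \<in> Hinf \<phi>"
  shows "(\<lambda>z. f z * g z) \<in> Hinf0 \<phi>"
proof -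
  obtain C s where f: "0 < C" "0 < s" "f holomorphic_on sector \<phi>"
    "\<And>z. z \<in> sector \<phi> \<Longrightarrow> cmod (f z) \<le> C * (cmod z * ray_weight s (cmod z))"
    using Hinf0E[OF assms(1)] by blast
  obtain B where g: "g holomorphic_on sector \<phi>" "\<And>z. z \<in> sector \<phi> \<Longrightarrow> cmod (g z) \<le> B"
    using assms(2) by (auto simp: Hinf_def bounded_iff)
  show ?thesis
  proof (rule Hinf0I'[where s = s and C = "C * B"])
    fix z assume z: "z \<in> sector \<phi>"
    have "cmod (f z * g z) \<le> (C * (cmod z * ray_weight s (cmod z))) * B"
      unfolding norm_mult using f g z by (intro mult_mono) auto
    then show "cmod (f z * g z) \<le> C * B * (cmod z * ray_weight s (cmod z))" by (simp add: mult_ac)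
  qed (use f g in \<open>auto intro: holomorphic_intros\<close>)
qed

lemma Hinf_const: "(\<lambda>z. c) \<in> Hinf \<phi>"
  by (auto simp: Hinf_def image_constant_conv)

lemma Hinf0_cmult: "f \<in> Hinf0 \<phi> \<Longrightarrow> (\<lambda>z. c * f z) \<in> Hinf0 \<phi>"
  using Hinf0_mult_Hinf[OF _ Hinf_const[of c]] by (simp add: mult.commute)

lemma Hinf0_diff: "f \<in> Hinf0 \<phi> \<Longrightarrow> g \<in> Hinf0 \<phi> \<Longrightarrow> (\<lambda>z. f z - g z) \<in> Hinf0 \<phi>"
  using Hinf0_add[OF _ Hinf0_cmult[of g \<phi> "-1"], of f] by simp

lemma Hinf0_cong: "f \<in> Hinf0 \<phi> \<Longrightarrow> (\<And>z. z \<in> sector \<phi> \<Longrightarrow> f z = g z) \<Longrightarrow> g \<in> Hinf0 \<phi>"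
proof -
  assume f: "f \<in> Hinf0 \<phi>" and eq: "\<And>z. z \<in> sector \<phi> \<Longrightarrow> f z = g z"
  obtain C s where "0 < C" "0 < s" "f holomorphic_on sector \<phi>"
    "\<And>z. z \<in> sector \<phi> \<Longrightarrow> cmod (f z) \<le> C * (cmod z * ray_weight s (cmod z))"
    using Hinf0E[OF f] by blast
  moreover from this have "g holomorphic_on sector \<phi>" by (simp add: eq cong: holomorphic_cong)
  ultimately show "g \<in> Hinf0 \<phi>" using eq by (intro Hinf0I'[of g \<phi> s C]) auto
qed

lemma Hinf_one_plus:
  assumes "0 < \<phi>" "\<phi> < pi"
  shows "(\<lambda>z. 1 / (1 + z)) \<in> Hinf \<phi>"
proof -
  obtain \<kappa> where \<kappa>: "0 < \<kappa>" "\<And>z. z \<in> sector \<phi> \<Longrightarrow> \<kappa> * (1 + cmod z) \<le> cmod (1 + z)"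
    using norm_one_plus_ge[OF assms] by blast
  have "cmod (1 / (1 + z)) \<le> 1 / \<kappa>" if "z \<in> sector \<phi>" for z
  proof -
    have "\<kappa> * 1 \<le> \<kappa> * (1 + cmod z)" using \<kappa>(1) by (intro mult_left_mono) auto
    then have "\<kappa> * 1 \<le> cmod (1 + z)" using \<kappa>(2)[OF that] by linarith
    then show ?thesis using \<kappa>(1) by (simp add: norm_divide frac_le)
  qed
  moreover have "(\<lambda>z. 1 / (1 + z)) holomorphic_on sector \<phi>"
    using assms by (auto intro!: holomorphic_intros dest: one_plus_nonzero)
  ultimately show ?thesis by (auto simp: Hinf_def bounded_iff)
qed

lemma Hinf_power: "f \<in> Hinf \<phi> \<Longrightarrow> (\<lambda>z. f z ^ n) \<in> Hinf \<phi>"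
proof -
  assume "f \<in> Hinf \<phi>"
  then obtain B where "f holomorphic_on sector \<phi>" "\<And>z. z \<in> sector \<phi> \<Longrightarrow> cmod (f z) \<le> B"
    by (auto simp: Hinf_def bounded_iff)
  then show ?thesis
    by (auto simp: Hinf_def bounded_iff norm_power intro!: holomorphic_intros exI[of _ "B ^ n"] power_mono)
qed

text \<open>With u = 1/(1+z) this function is u - u^2. Since u tends to 1 at 0 and lies outside
  \<open>Hinf0\<close>, this is the element through which contour integrals are compared with the
  resolvent at -1.\<close>

lemma Hinf0_Koebe:
  assumes "0 < \<phi>" "\<phi> < pi"
  shows "(\<lambda>z. z / (1 + z)\<^sup>2) \<in> Hinf0 \<phi>"
proof -
  obtain \<kappa> where \<kappa>: "0 < \<kappa>" "\<And>z. z \<in> sector \<phi> \<Longrightarrow> \<kappa> * (1 + cmod z) \<le> cmod (1 + z)"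
    using norm_one_plus_ge[OF assms] by blast
  show ?thesis
  proof (rule Hinf0I[where s = 1 and C = "1 / \<kappa>\<^sup>2"])
    fix z assume z: "z \<in> sector \<phi>"
    then have z0: "0 < cmod z" by (simp add: sector_def)
    have "cmod (z / (1 + z)\<^sup>2) \<le> cmod z / (\<kappa> * (1 + cmod z))\<^sup>2"
    proof -
      have "0 < \<kappa> * (1 + cmod z)" using \<kappa> z0 by (simp add: add_pos_pos)
      moreover from this have "0 < cmod (1 + z)" using \<kappa>(2)[OF z] by linarith
      moreover have "0 < 1 + cmod z" using z0 by linarith
      moreover note \<kappa>(1)
      ultimately show ?thesis
        unfolding norm_divide norm_power using \<kappa>(2)[OF z]
        by (intro divide_left_mono power_mono mult_pos_pos zero_less_power) auto
    qed
    also have "\<dots> \<le> 1 / \<kappa>\<^sup>2 * min (cmod z powr 1) (cmod z powr (- 1))"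
    proof -
      have "cmod z / (1 + cmod z)\<^sup>2 \<le> cmod z / 1" "cmod z / (1 + cmod z)\<^sup>2 \<le> cmod z / (cmod z)\<^sup>2"
        using z0 by (intro divide_left_mono power_mono one_le_power mult_pos_pos zero_less_power; simp add: add_pos_pos)+
      then have "cmod z / (1 + cmod z)\<^sup>2 \<le> min (cmod z powr 1) (cmod z powr (- 1))"
        using z0 by (simp add: powr_minus field_simps power2_eq_square)
      then have "1 / \<kappa>\<^sup>2 * (cmod z / (1 + cmod z)\<^sup>2) \<le> 1 / \<kappa>\<^sup>2 * min (cmod z powr 1) (cmod z powr (- 1))"
        by (rule mult_left_mono) simp
      then show ?thesis by (simp add: power_mult_distrib)
    qed
    finally show "cmod (z / (1 + z)\<^sup>2) \<le> 1 / \<kappa>\<^sup>2 * min (cmod z powr 1) (cmod z powr (- 1))" .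
  qed (use assms in \<open>auto intro!: holomorphic_intros dest: one_plus_nonzero\<close>)
qed

text \<open>The condition on z f(z) says that f itself is bounded by a ray weight, because here no
  resolvent supplies decay. As f is holomorphic inside the sector, one boundary ray can be rotated
  across the positive axis onto the other.\<close>

lemma sector_integral_eq_0:
  fixes x :: "'a::complex_banach"
  assumes hol: "f holomorphic_on sector \<phi>" and z: "(\<lambda>z. z * f z) \<in> Hinf0 \<phi>"
    and \<nu>: "0 < \<nu>" "\<nu> < \<phi>" "\<phi> \<le> pi"
  shows "sector_integral \<nu> (\<lambda>z. f z *\<^sub>C x) = 0"
proof -
  obtain C s where C: "0 < C" "0 < s"
    and le: "\<And>z. z \<in> sector \<phi> \<Longrightarrow> cmod (z * f z) \<le> C * (cmod z * ray_weight s (cmod z))"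
    using Hinf0E[OF z] by metis
  have mem: "complex_of_real r * cis \<theta> \<in> sector \<phi>" if "0 < r" "\<theta> \<in> {-\<nu>..\<nu>}" for r \<theta>
    using that \<nu> by (intro rcis_mem_sector) auto
  have op: "open (sector \<phi>)" using \<nu> by (intro open_sector) auto
  have "integral {0..} (\<lambda>r. cis (- \<nu>) *\<^sub>C f (of_real r * cis (- \<nu>)) *\<^sub>C x) =
        integral {0..} (\<lambda>r. cis \<nu> *\<^sub>C f (of_real r * cis \<nu>) *\<^sub>C x)"
  proof (rule ray_integral_rotate[where F' = "\<lambda>z. deriv f z *\<^sub>C x" and C = "C * norm x"])
    fix \<theta> r :: real assume "\<theta> \<in> {-\<nu>..\<nu>}" "0 < r"
    then have m: "complex_of_real r * cis \<theta> \<in> sector \<phi>" using mem by blast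
    have "(f has_field_derivative deriv f (of_real r * cis \<theta>)) (at (of_real r * cis \<theta>))"
      by (rule holomorphic_derivI[OF hol op m])
    from scaleC.FDERIV[OF this[unfolded has_field_derivative_def] has_derivative_const[of x]]
    show "((\<lambda>z. f z *\<^sub>C x) has_derivative (\<lambda>h. h *\<^sub>C deriv f (of_real r * cis \<theta>) *\<^sub>C x)) (at (of_real r * cis \<theta>))"
      by (simp add: scaleC_scaleC mult.commute scaleC.zero_right)
    have "cmod (f (of_real r * cis \<theta>)) \<le> C * ray_weight s r"
      using le[OF m] \<open>0 < r\<close> by (simp add: norm_mult)
    from mult_right_mono[OF this norm_ge_zero[of x]]
    show "norm (f (of_real r * cis \<theta>) *\<^sub>C x) \<le> C * norm x * ray_weight s r"
      by (simp add: norm_scaleC mult_ac)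
  next
    have "deriv f holomorphic_on sector \<phi>" using hol op by (rule holomorphic_deriv)
    then have "continuous_on (sector \<phi>) (deriv f)" by (rule holomorphic_on_imp_continuous_on)
    moreover have "{of_real r * cis \<theta> | r \<theta>. 0 < r \<and> \<theta> \<in> {-\<nu>..\<nu>}} \<subseteq> sector \<phi>"
      using mem by blast
    ultimately have "continuous_on {of_real r * cis \<theta> | r \<theta>. 0 < r \<and> \<theta> \<in> {-\<nu>..\<nu>}} (deriv f)"
      by (rule continuous_on_subset)
    then show "continuous_on {of_real r * cis \<theta> | r \<theta>. 0 < r \<and> \<theta> \<in> {-\<nu>..\<nu>}} (\<lambda>z. deriv f z *\<^sub>C x)"
      by (rule scaleC.continuous_on) (rule continuous_on_const)
  qed (use C(2) \<nu>(1) in simp_all)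
  then show ?thesis by (simp add: sector_integral_def)
qed

section \<open>Primitives of decaying functions and moments\<close>

text \<open>The Cauchy criterion in a form that keeps the rate. Limits at 0 are reduced to it by
  reciprocals.\<close>

lemma convergent_with_rate:
  fixes H :: "real \<Rightarrow> 'a::banach"
  assumes H: "\<And>a b. 0 < a \<Longrightarrow> a \<le> b \<Longrightarrow> norm (H b - H a) \<le> e a" and e: "(e \<longlongrightarrow> 0) at_top"
  shows "\<exists>L. \<forall>a>0. norm (H a - L) \<le> e a"
proof -
  let ?X = "\<lambda>n. H (real (Suc n))"
  have lim: "filterlim (\<lambda>n. real (Suc n)) at_top sequentially"
    by (rule filterlim_compose[OF filterlim_real_sequentially filterlim_Suc])
  have "Cauchy ?X"
  proof (rule metric_CauchyI)
    fix \<epsilon> :: real assume "0 < \<epsilon>"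
    then have "\<forall>\<^sub>F n in sequentially. e (real (Suc n)) < \<epsilon> / 2"
      using order_tendstoD(2)[OF filterlim_compose[OF e lim], of "\<epsilon> / 2"] by simp
    then obtain n0 where n0: "e (real (Suc n0)) < \<epsilon> / 2" by (auto simp: eventually_sequentially)
    have "dist (?X m) (?X n) < \<epsilon>" if "n0 \<le> m" "n0 \<le> n" for m n
    proof -
      have "dist (?X m) (?X n0) \<le> e (real (Suc n0))" "dist (?X n) (?X n0) \<le> e (real (Suc n0))"
        using that by (simp_all add: dist_norm H)
      then show ?thesis using n0 dist_triangle2[of "?X m" "?X n" "?X n0"] by linarith
    qed
    then show "\<exists>M. \<forall>m\<ge>M. \<forall>n\<ge>M. dist (?X m) (?X n) < \<epsilon>" by blast
  qed
  then obtain L where L: "?X \<longlonglongrightarrow> L" using Cauchy_convergent_iff convergent_def by blast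
  have "norm (H a - L) \<le> e a" if a: "0 < a" for a
  proof (rule tendsto_upperbound)
    show "(\<lambda>n. norm (H a - ?X n)) \<longlonglongrightarrow> norm (H a - L)" by (intro tendsto_intros L)
    have "\<forall>\<^sub>F n in sequentially. a \<le> real (Suc n)"
      using lim by (auto simp: filterlim_at_top)
    then show "\<forall>\<^sub>F n in sequentially. norm (H a - ?X n) \<le> e a"
      by eventually_elim (metis H a norm_minus_commute)
  qed simp
  then show ?thesis by blast
qed

text \<open>A primitive of -g(z)/z exists because the sector is starlike. Its limits at 0 and
  infinity are found along the positive axis and carried to other arguments along arcs of length at
  most \<pi> |z|. The decay of z g(z) makes the convergence at infinity faster than 1/|z|, so that z
  h(z) still decays.\<close>

lemma Hinf0_primitive:
  assumes \<phi>: "0 < \<phi>" "\<phi> < pi" and g: "g \<in> Hinf0 \<phi>" and zg: "(\<lambda>z. z * g z) \<in> Hinf0 \<phi>"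
  obtains h c where "\<And>z. z \<in> sector \<phi> \<Longrightarrow> (h has_field_derivative (- g z / z)) (at z)"
    "(\<lambda>z. z * h z) \<in> Hinf0 \<phi>" "(\<lambda>z. h z - c * (1 / (1 + z))) \<in> Hinf0 \<phi>"
proof -
  obtain C1 s1 where g1: "0 < C1" "0 < s1" and hol: "g holomorphic_on sector \<phi>"
    and gle: "\<And>z. z \<in> sector \<phi> \<Longrightarrow> cmod (g z) \<le> C1 * (cmod z * ray_weight s1 (cmod z))"
    using Hinf0E[OF g] by metis
  obtain C2 s2 where g2: "0 < C2" "0 < s2"
    and zgle: "\<And>z. z \<in> sector \<phi> \<Longrightarrow> cmod (z * g z) \<le> C2 * (cmod z * ray_weight s2 (cmod z))"
    using Hinf0E[OF zg] by metis
  \<comment> \<open>The cap at 1 is for the comparison of h with c/(1+z), which approaches c at 0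
    and 0 at infinity only to first order.\<close>
  define s where "s = min 1 (min s1 s2)"
  define C where "C = max C1 C2"
  have s: "0 < s" "s \<le> s1" "s \<le> s2" "s \<le> 1" and C: "0 < C" using g1 g2 by (auto simp: s_def C_def)
  have F: "cmod (g z / z) \<le> C * ray_weight s (cmod z)" "cmod z * cmod (g z / z) \<le> C * ray_weight s (cmod z)"
    if z: "z \<in> sector \<phi>" for z
  proof -
    have r: "0 < cmod z" using z by (simp add: sector_def)
    have "cmod (g z / z) \<le> C1 * ray_weight s1 (cmod z)"
      using gle[OF z] r by (simp add: norm_divide divide_le_eq mult_ac)
    also have "\<dots> \<le> C * ray_weight s (cmod z)"
      using s r g1 by (intro mult_mono ray_weight_mono) (auto simp: C_def)
    finally show "cmod (g z / z) \<le> C * ray_weight s (cmod z)" .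
    have "cmod (g z) \<le> C2 * ray_weight s2 (cmod z)"
      using zgle[OF z] r by (simp add: norm_mult mult_ac)
    also have "\<dots> \<le> C * ray_weight s (cmod z)"
      using s r g2 by (intro mult_mono ray_weight_mono) (auto simp: C_def)
    finally show "cmod z * cmod (g z / z) \<le> C * ray_weight s (cmod z)"
      using r by (simp add: norm_divide)
  qed
  have op: "open (sector \<phi>)" using \<phi> by (intro open_sector) auto
  have "(\<lambda>z. - g z / z) holomorphic_on sector \<phi>"
    using hol by (auto intro!: holomorphic_intros simp: sector_def)
  then obtain H where H: "\<And>z. z \<in> sector \<phi> \<Longrightarrow> (H has_field_derivative (- g z / z)) (at z)"
    using holomorphic_starlike_primitive[OF holomorphic_on_imp_continuous_on starlike_sector[OF \<phi>] op finite.emptyI,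
        of "\<lambda>z. - g z / z"] holomorphic_on_imp_differentiable_at[OF _ op] by blast
  have Hr: "((\<lambda>r. H (of_real r)) has_vector_derivative (- g (of_real r) / of_real r)) (at r within T)"
    if "0 < r" for r T
    using field_vector_diff_chain_within[of complex_of_real 1 r T H "- g (of_real r) / of_real r"]
      H[OF of_real_mem_sector[OF that \<phi>(1)]] has_vector_derivative_of_real[OF DERIV_ident[of "at r within T"]]
    by (simp add: o_def has_field_derivative_at_within)
  \<comment> \<open>The disjunction selects one of the two bounds in \<open>F\<close>: the first
    serves the limit at 0, the second, with its extra factor r, the limit at infinity.\<close>
  have rad: "cmod (H (of_real b) - H (of_real a)) \<le> P b - P a"
    if ab: "0 < a" "a \<le> b" and P: "\<And>r. 0 < r \<Longrightarrow> (P has_real_derivative P' r) (at r)"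
      and le: "\<And>r. 0 < r \<Longrightarrow> C * ray_weight s r \<le> P' r \<or> C * ray_weight s r \<le> r * P' r" for a b P P'
  proof (cases "a = b")
    case False
    with ab have "a < b" by simp
    have "norm ((\<lambda>r. H (of_real r)) b - (\<lambda>r. H (of_real r)) a) \<le> P b - P a"
    proof (rule differentiable_bound_general[OF \<open>a < b\<close>, where f' = "\<lambda>r. - g (of_real r) / of_real r" and \<phi>' = P'])
      show "continuous_on {a..b} (\<lambda>r. H (complex_of_real r))"
        using has_vector_derivative_continuous[OF Hr] ab by (auto simp: continuous_on_eq_continuous_within)
      show "continuous_on {a..b} P"
        using DERIV_continuous[OF P] ab by (auto intro!: continuous_at_imp_continuous_on)
      fix r assume "a < r" "r < b"
      then have r: "0 < r" using ab by simp
      show "((\<lambda>r. H (complex_of_real r)) has_vector_derivative - g (of_real r) / of_real r) (at r)" by (rule Hr[OF r])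
      show "(P has_vector_derivative P' r) (at r)"
        using P[OF r] by (simp add: has_real_derivative_iff_has_vector_derivative)
      have "cmod (g r / r) \<le> C * ray_weight s r" "r * cmod (g r / r) \<le> C * ray_weight s r"
        using F[OF of_real_mem_sector[OF r \<phi>(1)]] r by simp_all
      then have "cmod (g r / r) \<le> P' r" using le[OF r] r by (auto dest: order_trans)
      then show "norm (- g (of_real r) / of_real r) \<le> P' r" by simp
    qed
    then show ?thesis by simp
  qed simp
  \<comment> \<open>The circular arc from |z| to z, parametrised by x in [0,1] with angle x Arg
    z.\<close>
  have arc: "cmod (H z - H (of_real (cmod z))) \<le> pi * B"
    if z: "z \<in> sector \<phi>" and B: "\<And>w. w \<in> sector \<phi> \<Longrightarrow> cmod w = cmod z \<Longrightarrow> cmod w * cmod (g w / w) \<le> B" for z B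
  proof -
    let ?r = "cmod z"
    let ?\<gamma> = "\<lambda>x. complex_of_real ?r * cis (x * Arg z)"
    have r: "0 < ?r" and Arg: "\<bar>Arg z\<bar> < \<phi>" using z by (auto simp: sector_def)
    have m: "?\<gamma> x \<in> sector \<phi>" if "x \<in> {0..1}" for x
    proof (rule rcis_mem_sector[OF r])
      have "\<bar>x * Arg z\<bar> \<le> 1 * \<bar>Arg z\<bar>" using that unfolding abs_mult by (intro mult_right_mono) auto
      then show "\<bar>x * Arg z\<bar> < \<phi>" using Arg by simp
    qed (use \<phi> in simp)
    have d: "((\<lambda>x. H (?\<gamma> x)) has_vector_derivative (of_real ?r * (of_real (Arg z) * (\<i> * cis (x * Arg z)))) * (- g (?\<gamma> x) / ?\<gamma> x)) (at x within T)"
      if "x \<in> {0..1}" for x T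
    proof -
      have "((\<lambda>w. of_real ?r * exp (\<i> * (of_real (Arg z) * w))) has_field_derivative
          of_real ?r * (of_real (Arg z) * (\<i> * exp (\<i> * (of_real (Arg z) * of_real x))))) (at (of_real x))"
        by (auto intro!: derivative_eq_intros)
      from has_vector_derivative_real_field[OF this]
      have "(?\<gamma> has_vector_derivative of_real ?r * (of_real (Arg z) * (\<i> * cis (x * Arg z)))) (at x within T)"
        by (simp add: cis_conv_exp mult_ac)
      from field_vector_diff_chain_within[OF this has_field_derivative_at_within[OF H[OF m[OF that]]]]
      show ?thesis by (simp add: o_def)
    qed
    have "cmod (H (?\<gamma> 1) - H (?\<gamma> 0)) \<le> pi * B * 1 - pi * B * 0"
    proof (rule differentiable_bound_general[where \<phi> = "\<lambda>x. pi * B * x" and \<phi>' = "\<lambda>_. pi * B" and f = "\<lambda>x. H (?\<gamma> x)"])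
      show "continuous_on {0..1} (\<lambda>x. H (?\<gamma> x))"
        using has_vector_derivative_continuous[OF d] by (auto simp: continuous_on_eq_continuous_within)
      fix x :: real assume x: "0 < x" "x < 1"
      then show "((\<lambda>x. H (?\<gamma> x)) has_vector_derivative (of_real ?r * (of_real (Arg z) * (\<i> * cis (x * Arg z)))) * (- g (?\<gamma> x) / ?\<gamma> x)) (at x)"
        by (intro d) auto
      show "((\<lambda>x. pi * B * x) has_vector_derivative pi * B) (at x)"
        by (auto intro!: derivative_eq_intros simp flip: has_real_derivative_iff_has_vector_derivative)
      have n\<gamma>: "cmod (?\<gamma> x) = ?r" by (simp add: norm_mult)
      have "\<bar>Arg z\<bar> * (?r * cmod (g (?\<gamma> x) / ?\<gamma> x)) \<le> pi * B"
      proof (rule mult_mono)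
        show "\<bar>Arg z\<bar> \<le> pi" using Arg \<phi> by simp
        show "?r * cmod (g (?\<gamma> x) / ?\<gamma> x) \<le> B" using B[OF m n\<gamma>] x n\<gamma> by simp
      qed (use r in auto)
      then show "norm ((of_real ?r * (of_real (Arg z) * (\<i> * cis (x * Arg z)))) * (- g (?\<gamma> x) / ?\<gamma> x)) \<le> pi * B"
        by (cases "z = 0") (use r in \<open>simp_all add: norm_mult norm_divide mult_ac\<close>)
    qed (auto intro!: continuous_intros)
    moreover have "?\<gamma> 1 = z" using rcis_cmod_Arg[of z] by (simp add: rcis_def)
    ultimately show ?thesis by simp
  qed
  have "\<exists>L. \<forall>a>0. norm (H (of_real a) - L) \<le> C / (s + 1) * a powr (- s - 1)"
  proof (rule convergent_with_rate)
    fix a b :: real assume ab: "0 < a" "a \<le> b"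
    let ?P = "\<lambda>r. - (C / (s + 1)) * r powr (- s - 1)"
    have "cmod (H (of_real b) - H (of_real a)) \<le> ?P b - ?P a"
    proof (rule rad[OF ab, where P' = "\<lambda>r. C * r powr (- s - 2)"])
      fix r :: real assume r: "0 < r"
      show "(?P has_real_derivative C * r powr (- s - 2)) (at r)"
      proof -
        have "- (C / (s + 1)) * ((- s - 1) * X) = C * X" for X using s(1) by (simp add: field_simps)
        moreover have "- s - 1 - 1 = - s - 2" by simp
        ultimately show ?thesis
          using DERIV_cmult[OF has_real_derivative_powr[OF r, of "- s - 1"], of "- (C / (s + 1))"] by (simp only:)
      qed
      have "1 + (- s - 2) = - s - 1" by simp
      then have "r * r powr (- s - 2) = r powr (- s - 1)" using powr_mult_base[of r "- s - 2"] r by (simp only: less_imp_le)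
      then have "r * (C * r powr (- s - 2)) = C * r powr (- s - 1)" by (simp add: mult_ac)
      then show "C * ray_weight s r \<le> C * r powr (- s - 2) \<or> C * ray_weight s r \<le> r * (C * r powr (- s - 2))"
        using C by (simp add: ray_weight_def)
    qed
    also have "\<dots> \<le> C / (s + 1) * a powr (- s - 1)" using C s by simp
    finally show "cmod (H (of_real b) - H (of_real a)) \<le> C / (s + 1) * a powr (- s - 1)" .
  next
    have "((\<lambda>a. a powr (- s - 1)) \<longlongrightarrow> 0) at_top"
      using s(1) by (intro tendsto_neg_powr filterlim_ident) auto
    from tendsto_mult[OF tendsto_const[of "C / (s + 1)"] this]
    show "((\<lambda>a. C / (s + 1) * a powr (- s - 1)) \<longlongrightarrow> 0) at_top" by simp
  qed
  then obtain Linf where Linf: "\<And>a. 0 < a \<Longrightarrow> norm (H (of_real a) - Linf) \<le> C / (s + 1) * a powr (- s - 1)" by blast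
  have "\<exists>L. \<forall>a>0. norm ((\<lambda>a. H (of_real (inverse a))) a - L) \<le> C / s * a powr (- s)"
  proof (rule convergent_with_rate)
    fix a b :: real assume ab: "0 < a" "a \<le> b"
    let ?P = "\<lambda>r. C / s * r powr s"
    have "cmod (H (of_real (inverse a)) - H (of_real (inverse b))) \<le> ?P (inverse a) - ?P (inverse b)"
    proof (rule rad[where P' = "\<lambda>r. C * r powr (s - 1)"])
      fix r :: real assume r: "0 < r"
      show "(?P has_real_derivative C * r powr (s - 1)) (at r)"
      proof -
        have "C / s * (s * X) = C * X" for X using s(1) by simp
        then show ?thesis
          using DERIV_cmult[OF has_real_derivative_powr[OF r, of s], of "C / s"] by (simp only:)
      qed
      show "C * ray_weight s r \<le> C * r powr (s - 1) \<or> C * ray_weight s r \<le> r * (C * r powr (s - 1))"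
        using C by (simp add: ray_weight_def)
    qed (use ab in auto)
    also have "\<dots> \<le> C / s * a powr (- s)" using C s ab by (simp add: powr_minus inverse_powr)
    finally show "norm (H (of_real (inverse b)) - H (of_real (inverse a))) \<le> C / s * a powr (- s)"
      by (simp only: norm_minus_commute)
  next
    have "((\<lambda>a. a powr (- s)) \<longlongrightarrow> 0) at_top"
      using s(1) by (intro tendsto_neg_powr filterlim_ident) auto
    from tendsto_mult[OF tendsto_const[of "C / s"] this]
    show "((\<lambda>a. C / s * a powr (- s)) \<longlongrightarrow> 0) at_top" by simp
  qed
  then obtain L0 where L0': "\<And>a. 0 < a \<Longrightarrow> norm (H (of_real (inverse a)) - L0) \<le> C / s * a powr (- s)" by blast
  have L0: "norm (H (of_real a) - L0) \<le> C / s * a powr s" if "0 < a" for a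
    using L0'[of "inverse a"] that by (simp add: powr_minus inverse_powr)
  \<comment> \<open>h is normalised to vanish at infinity; \<open>c\<close> is then its limit at 0,
    that is, the integral of g(r)/r over (0,\<infinity>).\<close>
  define h where "h z = H z - Linf" for z
  define c where "c = L0 - Linf"
  define K1 where "K1 = C / s + pi * C"
  define K2 where "K2 = C / (s + 1) + pi * C"
  have K: "0 \<le> K1" "0 \<le> K2" using C s by (auto simp: K1_def K2_def)
  have small: "cmod (h z - c) \<le> K1 * cmod z powr s" if z: "z \<in> sector \<phi>" "cmod z \<le> 1" for z
  proof -
    have r: "0 < cmod z" using z by (simp add: sector_def)
    have "cmod (H z - H (of_real (cmod z))) \<le> pi * (C * cmod z powr s)"
    proof (rule arc[OF z(1)])
      fix w assume w: "w \<in> sector \<phi>" "cmod w = cmod z"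
      have "cmod w * cmod (g w / w) \<le> cmod w * (C * ray_weight s (cmod w))"
        using F(1)[OF w(1)] by (intro mult_left_mono) auto
      also have "\<dots> = C * (cmod z * cmod z powr (s - 1))"
        using w r z s by (simp add: ray_weight_eq_lower)
      also have "cmod z * cmod z powr (s - 1) = cmod z powr s" by (simp add: powr_mult_base)
      finally show "cmod w * cmod (g w / w) \<le> C * cmod z powr s" .
    qed
    moreover have "h z - c = (H z - H (of_real (cmod z))) + (H (of_real (cmod z)) - L0)"
      by (simp add: h_def c_def)
    ultimately have "cmod (h z - c) \<le> pi * (C * cmod z powr s) + C / s * cmod z powr s"
      using L0[OF r] norm_triangle_ineq[of "H z - H (of_real (cmod z))" "H (of_real (cmod z)) - L0"] by simp
    then show ?thesis by (simp add: K1_def algebra_simps)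
  qed
  have large: "cmod (h z) \<le> K2 * cmod z powr (- s - 1)" if z: "z \<in> sector \<phi>" "1 \<le> cmod z" for z
  proof -
    have r: "0 < cmod z" using z by (simp add: sector_def)
    have "cmod (H z - H (of_real (cmod z))) \<le> pi * (C * cmod z powr (- s - 1))"
    proof (rule arc[OF z(1)])
      fix w assume w: "w \<in> sector \<phi>" "cmod w = cmod z"
      show "cmod w * cmod (g w / w) \<le> C * cmod z powr (- s - 1)"
        using F(2)[OF w(1)] w z s by (simp add: ray_weight_eq_upper)
    qed
    moreover have "h z = (H z - H (of_real (cmod z))) + (H (of_real (cmod z)) - Linf)"
      by (simp add: h_def)
    ultimately have "cmod (h z) \<le> pi * (C * cmod z powr (- s - 1)) + C / (s + 1) * cmod z powr (- s - 1)"
      using Linf[OF r] norm_triangle_ineq[of "H z - H (of_real (cmod z))" "H (of_real (cmod z)) - Linf"] by simp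
    then show ?thesis by (simp add: K2_def algebra_simps)
  qed
  have hd: "(h has_field_derivative (- g z / z)) (at z)" if "z \<in> sector \<phi>" for z
    unfolding h_def[abs_def] using H[OF that] by (auto intro!: derivative_eq_intros)
  then have hh: "h holomorphic_on sector \<phi>"
    by (meson field_differentiable_at_within field_differentiable_def holomorphic_on_def)
  obtain \<kappa> where \<kappa>: "0 < \<kappa>" "\<And>z. z \<in> sector \<phi> \<Longrightarrow> \<kappa> * (1 + cmod z) \<le> cmod (1 + z)"
    using norm_one_plus_ge[OF \<phi>] by blast
  have w_lower: "cmod z * ray_weight s (cmod z) = cmod z powr s" if "z \<in> sector \<phi>" "cmod z \<le> 1" for z
    using that s by (intro mult_ray_weight_lower) (auto simp: sector_def)
  have w_upper: "cmod z * ray_weight s (cmod z) = cmod z powr (- s)" if "z \<in> sector \<phi>" "1 \<le> cmod z" for z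
    using that s by (intro mult_ray_weight_upper) auto
  have r_le: "cmod z \<le> cmod z powr s" if "z \<in> sector \<phi>" "cmod z \<le> 1" for z
    using powr_mono'[of s 1 "cmod z"] that s by (simp add: sector_def)
  show thesis
  proof (rule that[OF hd])
    show "(\<lambda>z. z * h z) \<in> Hinf0 \<phi>"
    proof (rule Hinf0I'[OF _ s(1), where C = "K1 + K2 + cmod c"])
      fix z assume z: "z \<in> sector \<phi>"
      show "cmod (z * h z) \<le> (K1 + K2 + cmod c) * (cmod z * ray_weight s (cmod z))"
      proof (cases "cmod z \<le> 1")
        case True
        have "cmod z powr s \<le> 1" using True s by (intro powr_le1) auto
        then have "K1 * cmod z powr s \<le> K1" using K by (simp add: mult_left_le)
        then have "cmod (h z) \<le> K1 + cmod c"
          using small[OF z True] norm_triangle_ineq[of "h z - c" c] by simp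
        also have "\<dots> \<le> K1 + K2 + cmod c" using K by simp
        finally have "cmod z * cmod (h z) \<le> cmod z powr s * (K1 + K2 + cmod c)"
          using r_le[OF z True] by (intro mult_mono) auto
        then show ?thesis using w_lower[OF z True] by (simp add: norm_mult mult.commute)
      next
        case False
        then have "cmod z * cmod (h z) \<le> cmod z * (K2 * cmod z powr (- s - 1))"
          using large[OF z] by (intro mult_left_mono) auto
        also have "\<dots> = K2 * cmod z powr (- s)" by (simp add: powr_mult_base mult.left_commute)
        also have "\<dots> \<le> (K1 + K2 + cmod c) * cmod z powr (- s)" using K by (intro mult_right_mono) auto
        finally show ?thesis using w_upper[OF z] False by (simp add: norm_mult)
      qed
    qed (use hh in \<open>auto intro!: holomorphic_intros\<close>)
    show "(\<lambda>z. h z - c * (1 / (1 + z))) \<in> Hinf0 \<phi>"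
    proof (rule Hinf0I'[OF _ s(1), where C = "K1 + K2 + cmod c / \<kappa>"])
      fix z assume z: "z \<in> sector \<phi>"
      have r: "0 < cmod z" using z by (simp add: sector_def)
      have pos: "0 < \<kappa> * (1 + cmod z)" using \<kappa>(1) r by (intro mult_pos_pos; linarith)
      have nz: "1 + z \<noteq> 0" using one_plus_nonzero[OF z] \<phi> by simp
      show "cmod (h z - c * (1 / (1 + z))) \<le> (K1 + K2 + cmod c / \<kappa>) * (cmod z * ray_weight s (cmod z))"
      proof (cases "cmod z \<le> 1")
        case True
        have "\<kappa> * 1 \<le> \<kappa> * (1 + cmod z)" using \<kappa>(1) r by (intro mult_left_mono) auto
        then have "\<kappa> \<le> cmod (1 + z)" using \<kappa>(2)[OF z] by linarith
        then have "cmod z / cmod (1 + z) \<le> cmod z powr s / \<kappa>"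
          using \<kappa>(1) r_le[OF z True] by (intro frac_le) auto
        then have *: "cmod c * (cmod z / cmod (1 + z)) \<le> cmod c * (cmod z powr s / \<kappa>)" by (intro mult_left_mono) auto
        have "h z - c * (1 / (1 + z)) = (h z - c) + c * (z / (1 + z))"
          using nz by (simp add: field_simps)
        then have "cmod (h z - c * (1 / (1 + z))) \<le> cmod (h z - c) + cmod (c * (z / (1 + z)))"
          by (metis norm_triangle_ineq)
        also have "\<dots> \<le> K1 * cmod z powr s + cmod c * (cmod z powr s / \<kappa>)"
          using small[OF z True] * by (simp add: norm_mult norm_divide)
        also have "\<dots> \<le> (K1 + K2 + cmod c / \<kappa>) * cmod z powr s" using K by (simp add: algebra_simps)
        finally show ?thesis using w_lower[OF z True] by simp
      next
        case False
        have "cmod z powr (- s - 1) \<le> cmod z powr (- s)" using False by (intro powr_mono) auto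
        moreover have "1 / cmod z \<le> cmod z powr (- s)"
          using False s powr_mono[of "-1" "- s" "cmod z"] by (simp add: powr_minus_divide)
        moreover have "\<kappa> * cmod z \<le> cmod (1 + z)"
          using \<kappa>(2)[OF z] \<kappa>(1) by (simp add: distrib_left)
        then have "1 / cmod (1 + z) \<le> 1 / (\<kappa> * cmod z)" using \<kappa>(1) r by (intro frac_le) auto
        ultimately have "1 / cmod (1 + z) \<le> 1 / \<kappa> * cmod z powr (- s)" "cmod z powr (- s - 1) \<le> cmod z powr (- s)"
          using \<kappa>(1) mult_left_mono[of "1 / cmod z" "cmod z powr (- s)" "1 / \<kappa>"] by auto
        then have "cmod c * (1 / cmod (1 + z)) \<le> cmod c * (1 / \<kappa> * cmod z powr (- s))"
          "K2 * cmod z powr (- s - 1) \<le> K2 * cmod z powr (- s)"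
          using K by (intro mult_left_mono; simp)+
        moreover have "cmod (h z - c * (1 / (1 + z))) \<le> cmod (h z) + cmod c * (1 / cmod (1 + z))"
          using norm_triangle_ineq4[of "h z" "c * (1 / (1 + z))"] by (simp add: norm_mult norm_divide)
        moreover have "cmod (h z) \<le> K2 * cmod z powr (- s - 1)" using large[OF z] False by simp
        ultimately have "cmod (h z - c * (1 / (1 + z))) \<le> (K2 + cmod c / \<kappa>) * cmod z powr (- s)"
          by (simp add: algebra_simps)
        also have "\<dots> \<le> (K1 + K2 + cmod c / \<kappa>) * cmod z powr (- s)" using K by (intro mult_right_mono) auto
        finally show ?thesis using w_upper[OF z] False by simp
      qed
    next
      show "(\<lambda>z. h z - c * (1 / (1 + z))) holomorphic_on sector \<phi>"
        using hh \<phi> by (auto intro!: holomorphic_intros dest: one_plus_nonzero)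
    qed
  qed
qed

text \<open>Orthogonality to all powers gives orthogonality to every polynomial p, so the integral
  of f^2 equals that of (f - p) f, which Weierstrass approximation makes arbitrarily small.\<close>

lemma vanishing_moments:
  fixes f :: "real \<Rightarrow> real"
  assumes f: "continuous_on {0..1} f" and mom: "\<And>j::nat. ((\<lambda>u. u ^ j * f u) has_integral 0) {0..1}"
    and u: "u \<in> {0..1}"
  shows "f u = 0"
proof -
  have pol: "((\<lambda>u. p u * f u) has_integral 0) {0..1}" if p: "real_polynomial_function p" for p :: "real \<Rightarrow> real"
  proof -
    obtain a n where p: "p = (\<lambda>x. \<Sum>i\<le>n. a i * x ^ i)"
      using p by (auto simp: real_polynomial_function_iff_sum)
    have "((\<lambda>u. \<Sum>i\<le>n. a i * (u ^ i * f u)) has_integral (\<Sum>i\<le>n. a i * 0)) {0..1}"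
      by (intro has_integral_sum has_integral_mult_right mom) auto
    then show ?thesis by (simp add: p sum_distrib_right mult.assoc)
  qed
  have ff: "(\<lambda>u. f u * f u) integrable_on {0..1}"
    by (intro integrable_continuous_real continuous_on_mult f)
  have "compact (f ` {0..1})" by (intro compact_continuous_image f) simp
  then obtain B where B: "0 < B" "\<And>u. u \<in> {0..1} \<Longrightarrow> \<bar>f u\<bar> \<le> B"
    using compact_imp_bounded bounded_pos by (metis image_eqI real_norm_def)
  have small: "integral {0..1} (\<lambda>u. f u * f u) \<le> \<epsilon>" if \<epsilon>: "0 < \<epsilon>" for \<epsilon>
  proof -
    obtain p where p: "real_polynomial_function p" "\<And>u. u \<in> {0..1} \<Longrightarrow> \<bar>f u - p u\<bar> < \<epsilon> / B"
      using Stone_Weierstrass_real_polynomial_function[of "{0..1}" f "\<epsilon> / B"] f \<epsilon> B(1) by auto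
    have "((\<lambda>u. f u * f u - p u * f u) has_integral (integral {0..1} (\<lambda>u. f u * f u) - 0)) {0..1}"
      by (intro has_integral_diff integrable_integral ff pol p)
    then have "((\<lambda>u. (f u - p u) * f u) has_integral (integral {0..1} (\<lambda>u. f u * f u))) {0..1}"
      by (simp add: left_diff_distrib)
    moreover have "((\<lambda>u. \<epsilon>) has_integral \<epsilon>) {0..1::real}" using has_integral_const_real[of \<epsilon> 0 1] by simp
    ultimately show ?thesis
    proof (rule has_integral_le)
      fix u :: real assume u: "u \<in> {0..1}"
      have "\<bar>(f u - p u) * f u\<bar> \<le> \<epsilon> / B * B"
        unfolding abs_mult using p(2)[OF u] B(2)[OF u] B(1) \<epsilon> by (intro mult_mono) auto
      then show "(f u - p u) * f u \<le> \<epsilon>" using B(1) by simp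
    qed
  qed
  have "integral {0..1} (\<lambda>u. f u * f u) \<le> 0"
  proof (rule field_le_epsilon)
    show "integral {0..1} (\<lambda>u. f u * f u) \<le> 0 + \<epsilon>" if "0 < \<epsilon>" for \<epsilon> :: real
      using small[OF that] by linarith
  qed
  moreover have "0 \<le> integral {0..1} (\<lambda>u. f u * f u)" by (rule Henstock_Kurzweil_Integration.integral_nonneg[OF ff]) simp
  ultimately have "integral {0..1} (\<lambda>u. f u * f u) = 0" by simp
  then have "\<forall>u\<in>{0..1}. f u * f u = 0"
    by (subst (asm) integral_eq_0_iff) (use f in \<open>auto intro: continuous_on_mult\<close>)
  then show ?thesis using u by simp
qed

section \<open>The contour calculus\<close>

definition sector_integrable :: "real \<Rightarrow> (complex \<Rightarrow> 'a::complex_banach) \<Rightarrow> bool" where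
  "sector_integrable \<nu> F \<longleftrightarrow>
     (\<forall>\<theta>\<in>{- \<nu>, \<nu>}. (\<lambda>r. cis \<theta> *\<^sub>C F (of_real r * cis \<theta>)) integrable_on {0..})"

lemma sector_integral_cong:
  assumes "\<And>r \<theta>. 0 < r \<Longrightarrow> \<theta> \<in> {- \<nu>, \<nu>} \<Longrightarrow> F (of_real r * cis \<theta>) = G (of_real r * cis \<theta>)"
  shows "sector_integral \<nu> F = sector_integral \<nu> G"
  unfolding sector_integral_def
  by (intro arg_cong2[of _ _ _ _ minus] integral_spike[of "{0}"]) (auto simp: assms)

lemma sector_integrable_cong:
  assumes "sector_integrable \<nu> F"
    and "\<And>r \<theta>. 0 < r \<Longrightarrow> \<theta> \<in> {- \<nu>, \<nu>} \<Longrightarrow> F (of_real r * cis \<theta>) = G (of_real r * cis \<theta>)"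
  shows "sector_integrable \<nu> G"
  unfolding sector_integrable_def
proof
  fix \<theta> assume \<theta>: "\<theta> \<in> {- \<nu>, \<nu>}"
  then have "(\<lambda>r. cis \<theta> *\<^sub>C F (of_real r * cis \<theta>)) integrable_on {0..}"
    using assms(1) unfolding sector_integrable_def by blast
  then show "(\<lambda>r. cis \<theta> *\<^sub>C G (of_real r * cis \<theta>)) integrable_on {0..}"
  proof (rule integrable_spike)
    show "cis \<theta> *\<^sub>C G (of_real r * cis \<theta>) = cis \<theta> *\<^sub>C F (of_real r * cis \<theta>)" if "r \<in> {0..} - {0}" for r
      using assms(2)[of r \<theta>] \<theta> that by simp
  qed simp
qed

lemma sector_integral_add:
  "sector_integrable \<nu> F \<Longrightarrow> sector_integrable \<nu> G \<Longrightarrow>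
    sector_integral \<nu> (\<lambda>z. F z + G z) = sector_integral \<nu> F + sector_integral \<nu> G"
  by (simp add: sector_integral_def sector_integrable_def scaleC_add_right
      Henstock_Kurzweil_Integration.integral_add)

lemma sector_integrable_add:
  "sector_integrable \<nu> F \<Longrightarrow> sector_integrable \<nu> G \<Longrightarrow> sector_integrable \<nu> (\<lambda>z. F z + G z)"
  by (simp add: sector_integrable_def scaleC_add_right integrable_add)

lemma sector_integral_linear:
  assumes T: "bounded_linear T" "\<And>c x. T (c *\<^sub>C x) = c *\<^sub>C T x" and F: "sector_integrable \<nu> F"
  shows "sector_integral \<nu> (\<lambda>z. T (F z)) = T (sector_integral \<nu> F)"
    and "sector_integrable \<nu> (\<lambda>z. T (F z))"
proof -
  have *: "integral {0..} (\<lambda>r. cis \<theta> *\<^sub>C T (F (of_real r * cis \<theta>))) =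
      T (integral {0..} (\<lambda>r. cis \<theta> *\<^sub>C F (of_real r * cis \<theta>)))" if "\<theta> \<in> {- \<nu>, \<nu>}" for \<theta>
    using integral_linear[OF _ T(1), of "\<lambda>r. cis \<theta> *\<^sub>C F (of_real r * cis \<theta>)"] F that
    by (simp only: sector_integrable_def o_def T(2))
  show "sector_integral \<nu> (\<lambda>z. T (F z)) = T (sector_integral \<nu> F)"
    by (simp add: sector_integral_def * linear_diff[OF bounded_linear.linear[OF T(1)]])
  show "sector_integrable \<nu> (\<lambda>z. T (F z))"
    using integrable_linear[OF _ T(1)] F unfolding sector_integrable_def o_def T(2)[symmetric]
    by blast
qed

lemma sector_integral_scaleC:
  assumes "sector_integrable \<nu> F"
  shows "sector_integral \<nu> (\<lambda>z. c *\<^sub>C F z) = c *\<^sub>C sector_integral \<nu> F"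
    and "sector_integrable \<nu> (\<lambda>z. c *\<^sub>C F z)"
  by (rule sector_integral_linear[OF scaleC.bounded_linear_right _ assms],
      simp add: scaleC_scaleC mult.commute)+

text \<open>\<open>C\<close> and \<open>s\<close> are fixed before \<open>G\<close> and
  \<open>K\<close> are chosen. With G(z) = R(z,tA)x and K = M |x| the estimate is therefore uniform
  in t.\<close>

lemma Hinf0_ray:
  assumes f: "f \<in> Hinf0 \<phi>" and \<nu>: "0 < \<mu>" "\<mu> < \<nu>" "\<nu> < \<phi>" "\<phi> < pi"
  obtains C s where "0 < C" "0 < s"
    "\<And>(G :: complex \<Rightarrow> 'a::complex_banach) K \<theta>. continuous_on (cosector \<mu>) G \<Longrightarrow>
       (\<And>z. z \<in> cosector \<mu> \<Longrightarrow> cmod z * norm (G z) \<le> K) \<Longrightarrow> \<theta> \<in> {- \<nu>, \<nu>} \<Longrightarrow>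
       continuous_on {0<..} (\<lambda>r. cis \<theta> *\<^sub>C f (of_real r * cis \<theta>) *\<^sub>C G (of_real r * cis \<theta>)) \<and>
       (\<forall>r>0. norm (cis \<theta> *\<^sub>C f (of_real r * cis \<theta>) *\<^sub>C G (of_real r * cis \<theta>)) \<le> C * K * ray_weight s r)"
proof -
  obtain C s where C: "0 < C" "0 < s" and hol: "f holomorphic_on sector \<phi>"
    and le: "\<And>z. z \<in> sector \<phi> \<Longrightarrow> cmod (f z) \<le> C * (cmod z * ray_weight s (cmod z))"
    using Hinf0E[OF f] by metis
  show thesis
  proof (rule that[OF C])
    fix G :: "complex \<Rightarrow> 'a" and K \<theta>
    assume G: "continuous_on (cosector \<mu>) G" and K: "\<And>z. z \<in> cosector \<mu> \<Longrightarrow> cmod z * norm (G z) \<le> K"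
      and \<theta>: "\<theta> \<in> {- \<nu>, \<nu>}"
    have mem: "complex_of_real r * cis \<theta> \<in> sector \<phi>" "complex_of_real r * cis \<theta> \<in> cosector \<mu>"
      if "0 < r" for r
      using \<theta> \<nu> that by (auto intro!: rcis_mem_sector rcis_mem_cosector)
    have cont: "continuous_on {0<..} (\<lambda>r. complex_of_real r * cis \<theta>)"
      by (intro continuous_intros)
    have cf: "continuous_on {0<..} (\<lambda>r. f (complex_of_real r * cis \<theta>))"
      by (rule continuous_on_compose2[OF holomorphic_on_imp_continuous_on[OF hol] cont]) (use mem in auto)
    have cG: "continuous_on {0<..} (\<lambda>r. G (complex_of_real r * cis \<theta>))"
      by (rule continuous_on_compose2[OF G cont]) (use mem in auto)
    have c: "continuous_on {0<..} (\<lambda>r. cis \<theta> *\<^sub>C f (of_real r * cis \<theta>) *\<^sub>C G (of_real r * cis \<theta>))"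
      by (rule scaleC.continuous_on continuous_on_const cf cG)+
    have b: "norm (cis \<theta> *\<^sub>C f (of_real r * cis \<theta>) *\<^sub>C G (of_real r * cis \<theta>)) \<le> C * K * ray_weight s r"
      if r: "0 < r" for r
    proof -
      have "cmod (f (of_real r * cis \<theta>)) * norm (G (of_real r * cis \<theta>))
          \<le> C * (r * ray_weight s r) * norm (G (of_real r * cis \<theta>))"
        using le[OF mem(1)[OF r]] r by (intro mult_right_mono) (auto simp: norm_mult)
      also have "\<dots> = C * ray_weight s r * (r * norm (G (of_real r * cis \<theta>)))" by simp
      also have "\<dots> \<le> C * ray_weight s r * K"
        using K[OF mem(2)[OF r]] C r by (intro mult_left_mono) (auto simp: norm_mult)
      finally show ?thesis by (simp add: norm_scaleC mult_ac)
    qed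
    show "continuous_on {0<..} (\<lambda>r. cis \<theta> *\<^sub>C f (of_real r * cis \<theta>) *\<^sub>C G (of_real r * cis \<theta>)) \<and>
       (\<forall>r>0. norm (cis \<theta> *\<^sub>C f (of_real r * cis \<theta>) *\<^sub>C G (of_real r * cis \<theta>)) \<le> C * K * ray_weight s r)"
      using c b by blast
  qed
qed

lemma sector_integral_Hinf0:
  assumes f: "f \<in> Hinf0 \<phi>" and \<nu>: "0 < \<mu>" "\<mu> < \<nu>" "\<nu> < \<phi>" "\<phi> < pi"
  obtains C where "0 \<le> C"
    "\<And>(G :: complex \<Rightarrow> 'a::complex_banach) K. continuous_on (cosector \<mu>) G \<Longrightarrow>
       (\<And>z. z \<in> cosector \<mu> \<Longrightarrow> cmod z * norm (G z) \<le> K) \<Longrightarrow>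
       sector_integrable \<nu> (\<lambda>z. f z *\<^sub>C G z) \<and> norm (sector_integral \<nu> (\<lambda>z. f z *\<^sub>C G z)) \<le> C * K"
proof (rule Hinf0_ray[OF f \<nu>, where 'a = 'a])
  fix C s :: real
  assume C: "0 < C" "0 < s" and *:
    "\<And>(G :: complex \<Rightarrow> 'a) K \<theta>. continuous_on (cosector \<mu>) G \<Longrightarrow>
       (\<And>z. z \<in> cosector \<mu> \<Longrightarrow> cmod z * norm (G z) \<le> K) \<Longrightarrow> \<theta> \<in> {- \<nu>, \<nu>} \<Longrightarrow>
       continuous_on {0<..} (\<lambda>r. cis \<theta> *\<^sub>C f (of_real r * cis \<theta>) *\<^sub>C G (of_real r * cis \<theta>)) \<and>
       (\<forall>r>0. norm (cis \<theta> *\<^sub>C f (of_real r * cis \<theta>) *\<^sub>C G (of_real r * cis \<theta>)) \<le> C * K * ray_weight s r)"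
  show thesis
  proof (rule that[of "4 * C / s"])
    fix G :: "complex \<Rightarrow> 'a" and K
    assume G: "continuous_on (cosector \<mu>) G" and K: "\<And>z. z \<in> cosector \<mu> \<Longrightarrow> cmod z * norm (G z) \<le> K"
    have *: "(\<lambda>r. cis \<theta> *\<^sub>C f (of_real r * cis \<theta>) *\<^sub>C G (of_real r * cis \<theta>)) integrable_on {0..} \<and>
        norm (integral {0..} (\<lambda>r. cis \<theta> *\<^sub>C f (of_real r * cis \<theta>) *\<^sub>C G (of_real r * cis \<theta>))) \<le> 2 * (C * K) / s"
      if "\<theta> \<in> {- \<nu>, \<nu>}" for \<theta>
      using *[OF G K that] ray_integrable[OF _ C(2)] ray_integral_bound[OF _ C(2)] by blast
    show "sector_integrable \<nu> (\<lambda>z. f z *\<^sub>C G z) \<and> norm (sector_integral \<nu> (\<lambda>z. f z *\<^sub>C G z)) \<le> 4 * C / s * K"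
    proof
      show "sector_integrable \<nu> (\<lambda>z. f z *\<^sub>C G z)"
        using * by (simp add: sector_integrable_def)
      have "norm (sector_integral \<nu> (\<lambda>z. f z *\<^sub>C G z)) \<le> 2 * (C * K) / s + 2 * (C * K) / s"
        unfolding sector_integral_def using *
        by (intro order_trans[OF norm_triangle_ineq4] add_mono) auto
      then show "norm (sector_integral \<nu> (\<lambda>z. f z *\<^sub>C G z)) \<le> 4 * C / s * K" by simp
    qed
  qed (use C in simp)
qed

text \<open>A constant vector fits \<open>sector_integral_Hinf0\<close> after writing f(z) x as z
  f(z) times x/z: the factor x/z obeys a bound |z| |G(z)| \<le> |x| of the kind satisfied by a
  resolvent.\<close>

lemma sector_integral_constant:
  fixes x :: "'a::complex_banach"
  assumes hol: "f holomorphic_on sector \<phi>" and z: "(\<lambda>z. z * f z) \<in> Hinf0 \<phi>"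
    and \<nu>: "0 < \<nu>" "\<nu> < \<phi>" "\<phi> < pi"
  shows "sector_integrable \<nu> (\<lambda>z. f z *\<^sub>C x)"
proof -
  have "continuous_on (cosector (\<nu> / 2)) (\<lambda>z. inverse z *\<^sub>C x)"
    by (intro scaleC.continuous_on continuous_intros) (auto dest: cosector_nonzero)
  moreover have "cmod z * norm (inverse z *\<^sub>C x) \<le> norm x" if "z \<in> cosector (\<nu> / 2)" for z
    using cosector_nonzero[OF that] by (simp add: norm_scaleC norm_inverse flip: mult.assoc)
  moreover obtain C where "\<And>(G :: complex \<Rightarrow> 'a) K. continuous_on (cosector (\<nu> / 2)) G \<Longrightarrow>
       (\<And>z. z \<in> cosector (\<nu> / 2) \<Longrightarrow> cmod z * norm (G z) \<le> K) \<Longrightarrow>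
       sector_integrable \<nu> (\<lambda>z. (z * f z) *\<^sub>C G z) \<and> norm (sector_integral \<nu> (\<lambda>z. (z * f z) *\<^sub>C G z)) \<le> C * K"
    by (rule sector_integral_Hinf0[OF z, of "\<nu> / 2" \<nu>]) (use \<nu> in auto)
  ultimately have "sector_integrable \<nu> (\<lambda>z. (z * f z) *\<^sub>C inverse z *\<^sub>C x)" by blast
  moreover have "(w * f w) *\<^sub>C inverse w *\<^sub>C x = f w *\<^sub>C x" if "w \<noteq> 0" for w
    using that by (simp add: scaleC_scaleC field_simps)
  ultimately show ?thesis
    by (rule sector_integrable_cong) simp
qed

text \<open>True for every z, in the resolvent set or not: both sides choose from the same set of
  preimages, since dividing the equation by t does not change its solutions.\<close>

lemma resolvent_scaleR:
  assumes "0 < t"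
  shows "resolvent D (\<lambda>y. t *\<^sub>R A y) z x = resolvent D A (inverse t *\<^sub>R z) (inverse t *\<^sub>R (x::'a::complex_banach))"
proof -
  have "(b \<in> D \<and> z *\<^sub>C b - t *\<^sub>R A b = x) \<longleftrightarrow>
      (b \<in> D \<and> (inverse t *\<^sub>R z) *\<^sub>C b - A b = inverse t *\<^sub>R x)" for b
  proof -
    have "(inverse t *\<^sub>R z) *\<^sub>C b - A b = inverse t *\<^sub>R (z *\<^sub>C b - t *\<^sub>R A b)"
      using assms by (simp add: scaleC.scaleR_left scaleR_right_diff_distrib)
    then show ?thesis using assms by auto
  qed
  then show ?thesis unfolding resolvent_def inv_into_def by simp
qed

lemma bij_betw_scaleR:
  assumes t: "0 < t" and bij: "bij_betw (\<lambda>x. (inverse t *\<^sub>R z) *\<^sub>C x - A x) D (UNIV :: 'a::complex_banach set)"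
  shows "bij_betw (\<lambda>x. z *\<^sub>C x - t *\<^sub>R A x) D UNIV"
proof -
  have "bij_betw (\<lambda>v::'a. t *\<^sub>R v) UNIV UNIV"
    by (rule bij_betw_byWitness[where f' = "\<lambda>v. inverse t *\<^sub>R v"]) (use t in auto)
  from bij_betw_trans[OF bij this]
  have "bij_betw ((\<lambda>v. t *\<^sub>R v) \<circ> (\<lambda>x. (inverse t *\<^sub>R z) *\<^sub>C x - A x)) D UNIV" .
  also have "(\<lambda>v. t *\<^sub>R v) \<circ> (\<lambda>x. (inverse t *\<^sub>R z) *\<^sub>C x - A x) = (\<lambda>x. z *\<^sub>C x - t *\<^sub>R A x)"
    using t by (simp add: fun_eq_iff scaleC.scaleR_left scaleR_right_diff_distrib)
  finally show ?thesis .
qed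

text \<open>Three nested angles: resolvents are controlled outside \<mu>, contours run at \<nu>,
  functions are holomorphic inside \<phi>. All constants are parameters because the locale is
  reinterpreted for tA with the same values. The choice M \<ge> 1 makes the powers of
  \<open>M\<close> increasing.\<close>

locale sectorial_calculus =
  fixes D :: "'a::complex_banach set" and A :: "'a \<Rightarrow> 'a" and \<mu> M \<nu> \<phi> :: real
  assumes lin: "linear_operator D A"
    and bij: "z \<in> cosector \<mu> \<Longrightarrow> bij_betw (\<lambda>x. z *\<^sub>C x - A x) D UNIV"
    and bnd: "z \<in> cosector \<mu> \<Longrightarrow> cmod z * norm (resolvent D A z x) \<le> M * norm x"
    and M: "1 \<le> M"
    and \<mu>: "0 < \<mu>" and \<mu>_\<nu>: "\<mu> < \<nu>" and \<nu>_\<phi>: "\<nu> < \<phi>" and \<phi>: "\<phi> < pi"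
begin

abbreviation R :: "complex \<Rightarrow> 'a \<Rightarrow> 'a" where "R \<equiv> resolvent D A"

lemma D_add: "x \<in> D \<Longrightarrow> y \<in> D \<Longrightarrow> x + y \<in> D"
  and A_add: "x \<in> D \<Longrightarrow> y \<in> D \<Longrightarrow> A (x + y) = A x + A y"
  and D_scaleC: "x \<in> D \<Longrightarrow> c *\<^sub>C x \<in> D"
  and A_scaleC: "x \<in> D \<Longrightarrow> A (c *\<^sub>C x) = c *\<^sub>C A x"
  using lin by (auto simp: linear_operator_def)

context
  fixes z assumes z: "z \<in> cosector \<mu>"
begin

lemma R_mem: "R z x \<in> D"
  unfolding resolvent_def using bij[OF z] by (auto simp: bij_betw_def intro: inv_into_into)

lemma R_right: "z *\<^sub>C R z x - A (R z x) = x"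
  unfolding resolvent_def using bij[OF z] f_inv_into_f[of x "\<lambda>x. z *\<^sub>C x - A x" D]
  by (auto simp: bij_betw_def)

lemma R_left: "b \<in> D \<Longrightarrow> R z (z *\<^sub>C b - A b) = b"
  unfolding resolvent_def using bij[OF z] inv_into_f_f[of "\<lambda>x. z *\<^sub>C x - A x" D b]
  by (simp add: bij_betw_def)

lemma R_eqI: "b \<in> D \<Longrightarrow> z *\<^sub>C b - A b = x \<Longrightarrow> R z x = b"
  using R_left by blast

lemma A_R: "A (R z x) = z *\<^sub>C R z x - x"
  using R_right[of x] by (simp add: algebra_simps)

lemma R_add: "R z (x + y) = R z x + R z y"
  by (rule R_eqI) (simp_all add: D_add A_add R_mem A_R scaleC_add_right)

lemma R_scaleC: "R z (c *\<^sub>C x) = c *\<^sub>C R z x"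
  by (rule R_eqI) (simp_all add: D_scaleC A_scaleC R_mem A_R scaleC_scaleC scaleC.diff_right mult.commute)

lemma norm_R: "norm (R z x) \<le> M / cmod z * norm x"
  using bnd[OF z, of x] cosector_nonzero[OF z] by (simp add: field_simps)

lemma bounded_linear_R: "bounded_linear (R z)"
  by (rule bounded_linear_intro[where K = "M / cmod z"])
    (use norm_R in \<open>auto simp: R_add R_scaleC mult.commute simp flip: scaleC_of_real\<close>)

lemma R_diff: "R z (x - y) = R z x - R z y"
  by (rule linear_diff[OF bounded_linear.linear[OF bounded_linear_R]])

end

lemma resolvent_identity:
  assumes "z \<in> cosector \<mu>" "w \<in> cosector \<mu>"
  shows "R z x - R w x = (w - z) *\<^sub>C R z (R w x)"
proof -
  have "R z x = R z (w *\<^sub>C R w x - A (R w x))" by (simp add: R_right assms)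
  also have "w *\<^sub>C R w x - A (R w x) = (w - z) *\<^sub>C R w x + (z *\<^sub>C R w x - A (R w x))"
    by (simp add: scaleC.diff_left)
  finally show ?thesis
    by (simp only: R_add R_scaleC R_left R_mem assms) simp
qed

lemma R_commute:
  assumes "z \<in> cosector \<mu>" "w \<in> cosector \<mu>"
  shows "R z (R w x) = R w (R z x)"
proof (cases "z = w")
  case False
  have "(w - z) *\<^sub>C R z (R w x) = (w - z) *\<^sub>C R w (R z x)"
    using resolvent_identity[OF assms, of x] resolvent_identity[OF assms(2,1), of x]
    by (metis minus_diff_eq scaleC.minus_left)
  then show ?thesis using False by (simp add: scaleC_left_eq_iff)
qed simp

text \<open>Two applications of the resolvent identity leave the remainder (y - z)^2 R(y) R(z)^2
  x.\<close>

lemma R_has_derivative: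
  assumes z: "z \<in> cosector \<mu>"
  shows "((\<lambda>z. R z x) has_derivative (\<lambda>h. h *\<^sub>C (- R z (R z x)))) (at z)"
proof -
  obtain e0 where e0: "e0 > 0" "ball z e0 \<subseteq> cosector \<mu>"
    using open_cosector z by (meson openE)
  \<comment> \<open>A radius of at most |z|/2 keeps y away from 0, where the bound M/|y|
    degenerates.\<close>
  define e where "e = min e0 (cmod z / 2)"
  have e: "e > 0" using e0 cosector_nonzero[OF z] by (simp add: e_def)
  let ?K = "2 * M / cmod z * norm (R z (R z x))"
  show ?thesis
  proof (rule has_derivativeI_sandwich[OF e, where H = "\<lambda>y. ?K * cmod (y - z)"])
    show "bounded_linear (\<lambda>h. h *\<^sub>C (- R z (R z x)))" by (rule scaleC.bounded_linear_left)
    fix y assume y: "y \<noteq> z" "dist y z < e"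
    then have yc: "y \<in> cosector \<mu>" using e0(2) by (auto simp: e_def dist_commute)
    have "R y x - R z x - (y - z) *\<^sub>C (- R z (R z x)) = (y - z) *\<^sub>C (R z (R z x) - R y (R z x))"
      using resolvent_identity[OF yc z, of x]
      by (simp add: scaleC.diff_right scaleC.diff_left scaleC.minus_right)
    also have "R z (R z x) - R y (R z x) = (y - z) *\<^sub>C R y (R z (R z x))"
      using resolvent_identity[OF z yc, of "R z x"] R_commute[OF z yc] by simp
    finally have eq: "R y x - R z x - (y - z) *\<^sub>C (- R z (R z x)) = ((y - z) * (y - z)) *\<^sub>C R y (R z (R z x))"
      by (simp add: scaleC_scaleC)
    have "cmod z / 2 \<le> cmod y"
    proof -
      have "cmod z \<le> cmod y + cmod (y - z)"
        using norm_triangle_ineq4[of y "y - z"] by simp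
      then show ?thesis using y by (simp add: e_def dist_norm)
    qed
    then have "M / cmod y \<le> 2 * M / cmod z"
      using M cosector_nonzero[OF z] cosector_nonzero[OF yc] by (simp add: field_simps)
    then have "norm (R y (R z (R z x))) \<le> ?K"
      by (intro order_trans[OF norm_R[OF yc]] mult_right_mono) auto
    then have "norm (R y x - R z x - (y - z) *\<^sub>C (- R z (R z x))) \<le> cmod (y - z) * cmod (y - z) * ?K"
      unfolding eq norm_scaleC norm_mult by (intro mult_left_mono) auto
    then show "norm (R y x - R z x - (y - z) *\<^sub>C (- R z (R z x))) / norm (y - z) \<le> ?K * cmod (y - z)"
      using y by (simp add: divide_le_eq mult_ac)
  next
    show "((\<lambda>y. ?K * cmod (y - z)) \<longlongrightarrow> 0) (at z)"
      by (rule tendsto_eq_intros | simp)+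
  qed
qed

lemma continuous_R: "continuous_on (cosector \<mu>) (\<lambda>z. R z x)"
  by (rule continuous_at_imp_continuous_on) (use has_derivative_continuous[OF R_has_derivative] in blast)

lemma minus_one_mem_cosector: "- 1 \<in> cosector \<mu>"
  using cos_monotone_0_pi[of \<mu> pi] \<mu> \<mu>_\<nu> \<nu>_\<phi> \<phi> by (simp add: cosector_def)

text \<open>The body repeats the term that occurs in \<open>calculus\<close>, so that unfolding
  \<open>calculus\<close> for tA meets \<open>U\<close> of the scaled operator literally.\<close>

definition U :: "'a \<Rightarrow> 'a" where "U x = inv_into D (\<lambda>y. y + A y) x"

lemma U_eq: "U x = - R (- 1) x"
proof -
  have "U x = R (-1) (- x)"
    unfolding U_def resolvent_def inv_into_def
    by (intro arg_cong[where f = Eps] ext) (auto simp: algebra_simps minus_equation_iff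
        neg_eq_iff_add_eq_0 add_eq_0_iff2)
  also have "\<dots> = - R (-1) x"
    using R_scaleC[OF minus_one_mem_cosector, of "-1" x] by simp
  finally show ?thesis .
qed

lemma U_mem: "U x \<in> D"
  using D_scaleC[OF R_mem[OF minus_one_mem_cosector], of "-1" x] by (simp add: U_eq)

lemma A_U: "A (U x) = x - U x"
  using A_scaleC[OF R_mem[OF minus_one_mem_cosector], of "-1" x] A_R[OF minus_one_mem_cosector, of x]
  by (simp add: U_eq)

lemma U_left: "b \<in> D \<Longrightarrow> U (b + A b) = b"
  using R_left[OF minus_one_mem_cosector, of b] R_scaleC[OF minus_one_mem_cosector, of "-1" "b + A b"]
  by (simp add: U_eq)

lemma bounded_linear_U: "bounded_linear U"
  unfolding U_eq[abs_def] by (intro bounded_linear_minus bounded_linear_R minus_one_mem_cosector)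

lemma U_scaleC: "U (c *\<^sub>C x) = c *\<^sub>C U x"
  by (simp add: U_eq R_scaleC minus_one_mem_cosector scaleC.minus_right)

lemma norm_U: "norm (U x) \<le> M * norm x"
  using norm_R[OF minus_one_mem_cosector] by (simp add: U_eq)

lemma U_inject: "U x = U y \<Longrightarrow> x = y"
  by (metis A_U diff_add_cancel)

lemma A_commutes_U: "b \<in> D \<Longrightarrow> A (U b) = U (A b)"
proof -
  assume "b \<in> D"
  then have "U (A b) + U b = b"
    by (metis U_left add.commute linear_add[OF bounded_linear.linear[OF bounded_linear_U]])
  then have "U (A b) = b - U b" by (simp only: eq_diff_eq)
  then show ?thesis by (simp only: A_U)
qed

text \<open>\<open>calculus0\<close> with the contour angle of the locale in place of the chosen
  one.\<close>

definition B :: "(complex \<Rightarrow> complex) \<Rightarrow> 'a \<Rightarrow> 'a" where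
  "B f x = (1 / (2 * of_real pi * \<i>)) *\<^sub>C sector_integral \<nu> (\<lambda>z. f z *\<^sub>C R z x)"

lemma ray_mem:
  assumes "0 < r" "\<theta> \<in> {- \<nu>, \<nu>}"
  shows "complex_of_real r * cis \<theta> \<in> sector \<phi>" "complex_of_real r * cis \<theta> \<in> cosector \<mu>"
  using assms \<mu> \<mu>_\<nu> \<nu>_\<phi> \<phi>
  by (auto intro!: rcis_mem_sector rcis_mem_cosector)

lemma B_integrable:
  assumes "f \<in> Hinf0 \<phi>" shows "sector_integrable \<nu> (\<lambda>z. f z *\<^sub>C R z x)"
  by (rule sector_integral_Hinf0[OF assms \<mu> \<mu>_\<nu> \<nu>_\<phi> \<phi>]) (use continuous_R bnd in blast)

lemma B_cong: "(\<And>z. z \<in> sector \<phi> \<Longrightarrow> f z = g z) \<Longrightarrow> B f x = B g x"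
  unfolding B_def using ray_mem by (intro arg_cong[where f = "scaleC _"] sector_integral_cong) simp

lemma B_add:
  assumes "f \<in> Hinf0 \<phi>" "g \<in> Hinf0 \<phi>"
  shows "B (\<lambda>z. f z + g z) x = B f x + B g x"
  unfolding B_def by (simp add: scaleC_add_left sector_integral_add B_integrable assms scaleC_add_right)

lemma B_cmult:
  assumes "f \<in> Hinf0 \<phi>"
  shows "B (\<lambda>z. c * f z) x = c *\<^sub>C B f x"
  unfolding B_def using sector_integral_scaleC(1)[OF B_integrable[OF assms], of c x]
  by (simp add: scaleC_scaleC mult.commute)

lemma B_diff:
  assumes "f \<in> Hinf0 \<phi>" "g \<in> Hinf0 \<phi>"
  shows "B (\<lambda>z. f z - g z) x = B f x - B g x"
  using B_add[OF assms(1) Hinf0_cmult[OF assms(2), of "-1"]] B_cmult[OF assms(2), of "-1"] by simp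

lemma B_U_commute:
  assumes "f \<in> Hinf0 \<phi>"
  shows "U (B f x) = B f (U x)"
proof -
  have "U (B f x) = (1 / (2 * of_real pi * \<i>)) *\<^sub>C sector_integral \<nu> (\<lambda>z. U (f z *\<^sub>C R z x))"
    unfolding B_def
    by (simp only: U_scaleC[of "1 / (2 * of_real pi * \<i>)"]
        sector_integral_linear(1)[OF bounded_linear_U U_scaleC B_integrable[OF assms]])
  also have "sector_integral \<nu> (\<lambda>z. U (f z *\<^sub>C R z x)) = sector_integral \<nu> (\<lambda>z. f z *\<^sub>C R z (U x))"
  proof (rule sector_integral_cong)
    fix r \<theta> :: real assume "0 < r" "\<theta> \<in> {- \<nu>, \<nu>}"
    from ray_mem(2)[OF this] show "U (f (of_real r * cis \<theta>) *\<^sub>C R (of_real r * cis \<theta>) x) =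
        f (of_real r * cis \<theta>) *\<^sub>C R (of_real r * cis \<theta>) (U x)"
      unfolding U_scaleC
      using R_commute[OF _ minus_one_mem_cosector] R_scaleC[of _ "-1"] by (simp add: U_eq)
  qed
  finally show ?thesis by (simp add: B_def)
qed

lemma Hinf_id_over: "(\<lambda>z. z * (1 / (1 + z))) \<in> Hinf \<phi>"
proof -
  have "0 < \<phi>" using \<mu> \<mu>_\<nu> \<nu>_\<phi> by simp
  from Hinf_one_plus[OF this \<phi>] obtain K where K: "(\<lambda>z. 1 / (1 + z)) holomorphic_on sector \<phi>"
    "\<And>z. z \<in> sector \<phi> \<Longrightarrow> cmod (1 / (1 + z)) \<le> K" by (auto simp: Hinf_def bounded_iff)
  have "cmod (z * (1 / (1 + z))) \<le> 1 + K" if "z \<in> sector \<phi>" for z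
  proof -
    have "z * (1 / (1 + z)) = 1 - 1 / (1 + z)"
      using one_plus_nonzero[OF that] \<phi> by (simp add: field_simps)
    then have "cmod (z * (1 / (1 + z))) \<le> cmod 1 + cmod (1 / (1 + z))"
      using norm_triangle_ineq4[of 1 "1 / (1 + z)"] by (simp only:)
    then show ?thesis using K(2)[OF that] by simp
  qed
  then show ?thesis
    using holomorphic_on_mult[OF holomorphic_on_ident K(1)]
    unfolding Hinf_def bounded_iff by blast
qed

text \<open>The resolvent identity gives (1+z) R(z) U x = R(z) x + U x. After division by 1+z the
  term with the constant vector U x integrates to 0, since f(z)/(1+z) is holomorphic inside the
  sector and bounded by a ray weight.\<close>

lemma B_mult_U:
  assumes f: "f \<in> Hinf0 \<phi>"
  shows "B (\<lambda>z. f z * (1 / (1 + z))) x = B f (U x)"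
proof -
  let ?g = "\<lambda>z. f z * (1 / (1 + z))"
  have \<phi>0: "0 < \<phi>" and \<nu>0: "0 < \<nu>" using \<mu> \<mu>_\<nu> \<nu>_\<phi> by simp_all
  have g: "?g \<in> Hinf0 \<phi>" by (rule Hinf0_mult_Hinf[OF f Hinf_one_plus[OF \<phi>0 \<phi>]])
  have zg: "(\<lambda>z. z * ?g z) \<in> Hinf0 \<phi>"
    using Hinf0_mult_Hinf[OF f Hinf_id_over] by (simp add: mult_ac)
  have gh: "?g holomorphic_on sector \<phi>" using Hinf0E[OF g] by metis
  have "sector_integral \<nu> (\<lambda>z. f z *\<^sub>C R z (U x)) = sector_integral \<nu> (\<lambda>z. ?g z *\<^sub>C R z x + ?g z *\<^sub>C U x)"
  proof (rule sector_integral_cong)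
    fix r \<theta> :: real assume "0 < r" "\<theta> \<in> {- \<nu>, \<nu>}"
    note m = ray_mem[OF this]
    let ?z = "complex_of_real r * cis \<theta>"
    have nz: "1 + ?z \<noteq> 0" using one_plus_nonzero[OF m(1)] \<phi> by simp
    have "R ?z (U x) = - R ?z (R (-1) x)"
      using R_scaleC[OF m(2), of "-1"] by (simp add: U_eq)
    moreover have "(1 + ?z) *\<^sub>C (- R ?z (R (-1) x)) = R ?z x + U x"
      using resolvent_identity[OF m(2) minus_one_mem_cosector, of x]
      by (simp add: U_eq scaleC.minus_right scaleC.minus_left[symmetric])
    ultimately have "(1 / (1 + ?z)) *\<^sub>C (1 + ?z) *\<^sub>C R ?z (U x) = (1 / (1 + ?z)) *\<^sub>C (R ?z x + U x)"
      by (simp only:)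
    moreover have "(1 / (1 + ?z)) *\<^sub>C (1 + ?z) *\<^sub>C R ?z (U x) = R ?z (U x)"
      using nz unfolding scaleC_scaleC by simp
    ultimately have "R ?z (U x) = (1 / (1 + ?z)) *\<^sub>C (R ?z x + U x)" by (simp only:)
    then show "f ?z *\<^sub>C R ?z (U x) = ?g ?z *\<^sub>C R ?z x + ?g ?z *\<^sub>C U x"
      by (simp add: scaleC_scaleC scaleC_add_right)
  qed
  also have "\<dots> = sector_integral \<nu> (\<lambda>z. ?g z *\<^sub>C R z x)"
    using sector_integral_add[OF B_integrable[OF g] sector_integral_constant[OF gh zg \<nu>0 \<nu>_\<phi> \<phi>]]
      sector_integral_eq_0[OF gh zg \<nu>0 \<nu>_\<phi>] \<phi> by simp
  finally show ?thesis by (simp add: B_def)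
qed

lemma B_mult_U_power:
  assumes "f \<in> Hinf0 \<phi>"
  shows "B (\<lambda>z. f z * (1 / (1 + z)) ^ n) x = (U ^^ n) (B f x)"
proof (induction n)
  case (Suc n)
  have \<phi>0: "0 < \<phi>" using \<mu> \<mu>_\<nu> \<nu>_\<phi> by simp
  have h: "(\<lambda>z. f z * (1 / (1 + z)) ^ n) \<in> Hinf0 \<phi>"
    by (intro Hinf0_mult_Hinf assms Hinf_power Hinf_one_plus \<phi> \<phi>0)
  show ?case
    using B_mult_U[OF h, of x] B_U_commute[OF h, of x] Suc by (simp add: mult.assoc mult.commute)
qed simp

text \<open>Writing f as (f + z f)/(1+z) trades a power of z for one factor \<open>U\<close>. This
  single identity yields both the mapping into \<open>D\<close> and the commutation with
  \<open>A\<close>.\<close>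

lemma B_split:
  assumes f: "f \<in> Hinf0 \<phi>" and zf: "(\<lambda>z. z * f z) \<in> Hinf0 \<phi>"
  shows "B f x = B f (U x) + B (\<lambda>z. z * f z) (U x)"
proof -
  have "B f x = B (\<lambda>z. (f z + z * f z) * (1 / (1 + z))) x"
  proof (rule B_cong)
    fix z assume "z \<in> sector \<phi>"
    then have "1 + z \<noteq> 0" using one_plus_nonzero \<phi> by simp
    moreover have "f z + z * f z = f z * (1 + z)" by (simp add: algebra_simps)
    ultimately show "f z = (f z + z * f z) * (1 / (1 + z))" by simp
  qed
  then show ?thesis
    by (simp only: B_mult_U[OF Hinf0_add[OF f zf]] B_add[OF f zf])
qed

text \<open>\<open>B_split\<close> exhibits f(A)x as \<open>U\<close> applied to f(A)x + (z f)(A)x.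
  It therefore lies in the range of \<open>U\<close>, and A U = 1 - U identifies its image under
  \<open>A\<close>.\<close>

lemma B_D:
  assumes f: "f \<in> Hinf0 \<phi>" and zf: "(\<lambda>z. z * f z) \<in> Hinf0 \<phi>"
  shows B_mem: "B f x \<in> D" and A_B: "A (B f x) = B (\<lambda>z. z * f z) x"
proof -
  have eq: "B f x = U (B f x + B (\<lambda>z. z * f z) x)"
    by (rule B_split[OF assms, of x, folded B_U_commute[OF f] B_U_commute[OF zf]
          linear_add[OF bounded_linear.linear[OF bounded_linear_U]]])
  show "B f x \<in> D" by (subst eq) (rule U_mem)
  show "A (B f x) = B (\<lambda>z. z * f z) x"
    by (subst eq, subst A_U, subst eq[symmetric]) simp
qed

lemma B_add_right: "f \<in> Hinf0 \<phi> \<Longrightarrow> B f (x + y) = B f x + B f y"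
proof -
  assume f: "f \<in> Hinf0 \<phi>"
  have "sector_integral \<nu> (\<lambda>z. f z *\<^sub>C R z (x + y)) = sector_integral \<nu> (\<lambda>z. f z *\<^sub>C R z x + f z *\<^sub>C R z y)"
    by (rule sector_integral_cong) (simp only: R_add[OF ray_mem(2)] scaleC_add_right)
  then show ?thesis
    by (simp add: B_def sector_integral_add B_integrable f scaleC_add_right)
qed

text \<open>\<open>B_split\<close> is evaluated at b + A b, which \<open>U\<close> maps to b;
  cancelling f(A)b leaves the claim.\<close>

lemma B_A:
  assumes f: "f \<in> Hinf0 \<phi>" and zf: "(\<lambda>z. z * f z) \<in> Hinf0 \<phi>" and b: "b \<in> D"
  shows "B (\<lambda>z. z * f z) b = B f (A b)"
proof -
  have "B f b + B (\<lambda>z. z * f z) b = B f b + B f (A b)"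
    using B_split[OF f zf, of "b + A b"] B_add_right[OF f, of b "A b"]
    by (simp only: U_left[OF b])
  then show ?thesis by (rule add_left_imp_eq)
qed

end

section \<open>Normalization of the calculus\<close>

lemma norm_one_minus_ge:
  assumes "0 < \<mu>" "\<mu> < pi"
  obtains \<kappa> where "0 < \<kappa>" "\<And>z. z \<in> cosector \<mu> \<Longrightarrow> \<kappa> * (1 + cmod z) \<le> cmod (1 - z)"
proof (rule norm_one_plus_ge[of "pi - \<mu>"])
  fix \<kappa> assume \<kappa>: "0 < \<kappa>" "\<And>z. z \<in> sector (pi - \<mu>) \<Longrightarrow> \<kappa> * (1 + cmod z) \<le> cmod (1 + z)"
  show thesis
  proof (rule that[OF \<kappa>(1)])
    fix z assume "z \<in> cosector \<mu>"
    then have "- z \<in> sector (pi - \<mu>)"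
      using assms by (subst sector_iff) (auto simp: cosector_def)
    from \<kappa>(2)[OF this] show "\<kappa> * (1 + cmod z) \<le> cmod (1 - z)" by simp
  qed
qed (use assms in auto)

text \<open>The antiderivative is the logarithm of a constant multiple of (1-z)/(1+z). On the ray
  the imaginary part of this quotient has the sign opposite to sin \<theta>, so the multiple
  \<sigma> \<i> moves it into the right half plane, away from the cut of \<open>Ln\<close>. From r =
  0 to r = \<infinity> the argument of \<open>Ln\<close> runs from \<sigma> \<i> to -\<sigma>
  \<i>.\<close>

lemma ray_integral_two_over_square_minus_one:
  assumes \<nu>: "0 < \<nu>" "\<nu> < pi" and \<theta>: "\<theta> = \<sigma> * \<nu>" "\<sigma> \<in> {- 1, 1}"
  shows "(\<lambda>r. cis \<theta> * (2 / ((of_real r * cis \<theta>)\<^sup>2 - 1))) integrable_on {0..}"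
    and "integral {0..} (\<lambda>r. cis \<theta> * (2 / ((of_real r * cis \<theta>)\<^sup>2 - 1))) = - of_real \<sigma> * \<i> * of_real pi"
proof -
  let ?F = "\<lambda>r::real. cis \<theta> * (2 / ((of_real r * cis \<theta>)\<^sup>2 - 1))"
  let ?w = "\<lambda>r::real. complex_of_real r * cis \<theta>"
  let ?m = "\<lambda>v::complex. (1 - v) / (1 + v)"
  let ?H = "\<lambda>r. Ln (of_real \<sigma> * \<i> * ?m (?w r))"
  have \<theta>abs: "\<bar>\<theta>\<bar> = \<nu>" using \<theta> \<nu> by auto
  have sin: "0 < \<sigma> * sin \<theta>" using \<theta> \<nu> by (auto intro: sin_gt_zero)
  obtain \<kappa> where \<kappa>: "0 < \<kappa>" "\<And>z. z \<in> sector ((\<nu> + pi) / 2) \<Longrightarrow> \<kappa> * (1 + cmod z) \<le> cmod (1 + z)"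
    using norm_one_plus_ge[of "(\<nu> + pi) / 2"] \<nu> by auto
  obtain \<kappa>' where \<kappa>': "0 < \<kappa>'" "\<And>z. z \<in> cosector (\<nu> / 2) \<Longrightarrow> \<kappa>' * (1 + cmod z) \<le> cmod (1 - z)"
    using norm_one_minus_ge[of "\<nu> / 2"] \<nu> by auto
  have p: "\<kappa> * (1 + r) \<le> cmod (1 + ?w r)" and q: "\<kappa>' * (1 + r) \<le> cmod (1 - ?w r)" if "0 < r" for r
  proof -
    have "?w r \<in> sector ((\<nu> + pi) / 2)" "?w r \<in> cosector (\<nu> / 2)"
      using that \<theta>abs \<nu> by (auto intro!: rcis_mem_sector rcis_mem_cosector)
    from \<kappa>(2)[OF this(1)] \<kappa>'(2)[OF this(2)]
    show "\<kappa> * (1 + r) \<le> cmod (1 + ?w r)" "\<kappa>' * (1 + r) \<le> cmod (1 - ?w r)"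
      using that by (simp_all add: norm_mult)
  qed
  have nz: "1 + ?w r \<noteq> 0" "1 - ?w r \<noteq> 0" if "0 < r" for r
  proof -
    have "0 < \<kappa> * (1 + r)" "0 < \<kappa>' * (1 + r)" using \<kappa>(1) \<kappa>'(1) that by simp_all
    then have "0 < cmod (1 + ?w r)" "0 < cmod (1 - ?w r)" using p[OF that] q[OF that] by linarith+
    then show "1 + ?w r \<noteq> 0" "1 - ?w r \<noteq> 0" by auto
  qed
  have fac: "(?w r)\<^sup>2 - 1 = - ((1 + ?w r) * (1 - ?w r))" for r
    by (simp add: power2_eq_square algebra_simps)
  have nz2: "(?w r)\<^sup>2 - 1 \<noteq> 0" if "0 < r" for r
    unfolding fac using nz[OF that] by simp
  have cont: "continuous_on {0<..} ?F"
    using nz2 by (intro continuous_intros) auto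
  have bound: "norm (?F r) \<le> 2 / (\<kappa> * \<kappa>') * ray_weight 1 r" if r: "0 < r" for r
  proof -
    have "\<kappa> * (1 + r) * (\<kappa>' * (1 + r)) \<le> cmod (1 + ?w r) * cmod (1 - ?w r)"
      using p[OF r] q[OF r] \<kappa>(1) \<kappa>'(1) r by (intro mult_mono) auto
    then have "norm (?F r) \<le> 2 / (\<kappa> * (1 + r) * (\<kappa>' * (1 + r)))"
      unfolding fac norm_mult norm_divide norm_minus_cancel norm_cis mult_1 norm_numeral
    proof (rule divide_left_mono)
      have "0 < \<kappa> * (1 + r) * (\<kappa>' * (1 + r))" using \<kappa>(1) \<kappa>'(1) r by (intro mult_pos_pos) auto
      moreover have "0 < cmod (1 + ?w r) * cmod (1 - ?w r)" using nz[OF r] by simp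
      ultimately show "0 < cmod (1 + ?w r) * cmod (1 - ?w r) * (\<kappa> * (1 + r) * (\<kappa>' * (1 + r)))"
        by (rule mult_pos_pos[rotated])
    qed simp
    also have "\<dots> = 2 / (\<kappa> * \<kappa>') * (1 / (1 + r)\<^sup>2)" by (simp add: power2_eq_square)
    also have "\<dots> \<le> 2 / (\<kappa> * \<kappa>') * ray_weight 1 r"
    proof (rule mult_left_mono)
      have "1 / (1 + r)\<^sup>2 \<le> 1 / 1" "1 / (1 + r)\<^sup>2 \<le> 1 / r\<^sup>2"
        using r by (intro divide_left_mono power_mono one_le_power; simp)+
      moreover have "r powr (- 2) = 1 / r\<^sup>2" using r by (simp add: powr_minus_divide)
      ultimately show "1 / (1 + r)\<^sup>2 \<le> ray_weight 1 r" using r by (simp add: ray_weight_def)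
    qed (use \<kappa>(1) \<kappa>'(1) in simp)
    finally show ?thesis .
  qed
  show "?F integrable_on {0..}" by (rule ray_integrable[OF cont _ bound]) simp
  have dH: "(?H has_vector_derivative ?F r) (at r within T)" if r: "0 < r" for r T
  proof -
    let ?v = "?w r"
    have "Re (of_real \<sigma> * \<i> * ?m ?v) = 2 * (\<sigma> * (r * sin \<theta>)) / (cmod (1 + ?v))\<^sup>2"
    proof -
      have "?m ?v = (1 - ?v) * cnj (1 + ?v) / of_real ((cmod (1 + ?v))\<^sup>2)"
        using nz[OF r] by (simp add: complex_norm_square[symmetric] field_simps del: complex_cnj_add complex_cnj_mult
            of_real_power)
      then have "Im (?m ?v) = - 2 * (r * sin \<theta>) / (cmod (1 + ?v))\<^sup>2"
        by (simp only: Im_divide_of_real) (simp add: algebra_simps)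
      moreover have "Re (of_real \<sigma> * \<i> * v) = - \<sigma> * Im v" for v by simp
      ultimately have "Re (of_real \<sigma> * \<i> * ?m ?v) = - \<sigma> * (- 2 * (r * sin \<theta>) / (cmod (1 + ?v))\<^sup>2)"
        by (simp only:)
      then show ?thesis by simp
    qed
    moreover have "0 < 2 * (\<sigma> * (r * sin \<theta>)) / (cmod (1 + ?v))\<^sup>2"
    proof (rule divide_pos_pos)
      show "0 < 2 * (\<sigma> * (r * sin \<theta>))" using mult_pos_pos[OF r sin] by (simp add: mult_ac)
    qed (use nz[OF r] in auto)
    ultimately have "0 < Re (of_real \<sigma> * \<i> * ?m ?v)" by simp
    then have notin: "of_real \<sigma> * \<i> * ?m ?v \<notin> \<real>\<^sub>\<le>\<^sub>0"
      by (metis complex_nonpos_Reals_iff not_le)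
    have \<sigma>0: "complex_of_real \<sigma> \<noteq> 0" using \<theta> by auto
    have "((\<lambda>v. Ln (of_real \<sigma> * \<i> * ?m v)) has_field_derivative (2 / (?v\<^sup>2 - 1))) (at ?v)"
      using notin nz[OF r] \<sigma>0 nz2[OF r]
      by (auto intro!: derivative_eq_intros simp: divide_simps) (simp add: power2_eq_square algebra_simps)?
    moreover have "(?w has_vector_derivative cis \<theta>) (at r within T)"
      by (rule derivative_eq_intros | simp add: has_vector_derivative_of_real)+
    ultimately show ?thesis
      using field_vector_diff_chain_within[of ?w "cis \<theta>" r T "\<lambda>v. Ln (of_real \<sigma> * \<i> * ?m v)" "2 / (?v\<^sup>2 - 1)"]
      by (simp add: o_def has_field_derivative_at_within)
  qed
  let ?a = "\<lambda>n. inverse (real (Suc n))" and ?b = "\<lambda>n. real (Suc n)"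
  have "integral {?a n..?b n} ?F = ?H (?b n) - ?H (?a n)" for n
  proof (rule integral_unique, rule fundamental_theorem_of_calculus)
    have "?a n \<le> 1" by (simp add: inverse_le_1_iff)
    then show "?a n \<le> ?b n" by simp
    show "(?H has_vector_derivative ?F r) (at r within {?a n..?b n})" if "r \<in> {?a n..?b n}" for r
    proof (rule dH)
      have "0 < ?a n" by simp
      also have "?a n \<le> r" using that by (simp only: atLeastAtMost_iff)
      finally show "0 < r" .
    qed
  qed
  then have lim: "(\<lambda>n. ?H (?b n) - ?H (?a n)) \<longlonglongrightarrow> integral {0..} ?F"
    using ray_integral_limit[OF cont _ bound] by simp
  have m: "(\<lambda>n. ?m (of_real (?a n) * cis \<beta>)) \<longlonglongrightarrow> 1" for \<beta>
  proof -
    have "(\<lambda>n. complex_of_real (?a n)) \<longlonglongrightarrow> of_real 0"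
      by (intro tendsto_of_real LIMSEQ_inverse_real_of_nat)
    note T = this
    have "(\<lambda>n. ?m (of_real (?a n) * cis \<beta>)) \<longlonglongrightarrow> ?m (of_real 0 * cis \<beta>)"
      by (intro tendsto_divide tendsto_diff tendsto_add tendsto_mult tendsto_const T) auto
    then show ?thesis by simp
  qed
  have \<sigma>i: "complex_of_real \<sigma> * \<i> * 1 \<notin> \<real>\<^sub>\<le>\<^sub>0" "complex_of_real \<sigma> * \<i> * (- 1) \<notin> \<real>\<^sub>\<le>\<^sub>0"
    using \<theta> by (auto simp: complex_nonpos_Reals_iff)
  have a: "(\<lambda>n. ?H (?a n)) \<longlonglongrightarrow> Ln (of_real \<sigma> * \<i> * 1)"
    by (intro isCont_tendsto_compose[OF isCont_Ln'[OF continuous_ident \<sigma>i(1)]] tendsto_intros m)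
  \<comment> \<open>Replacing z by 1/z changes the sign of (1-z)/(1+z), so the limit at infinity
    reduces to the limit \<open>m\<close> at 0.\<close>
  have "?m (?w (?b n)) = - ?m (of_real (?a n) * cis (- \<theta>))" for n
  proof -
    have "0 < ?b n" by simp
    note n = nz[OF this]
    have inv: "of_real (?a n) * cis (- \<theta>) = 1 / ?w (?b n)"
      by (simp add: divide_inverse cis_inverse)
    have "?w (?b n) \<noteq> 0" by (simp del: of_nat_Suc)
    then show ?thesis unfolding inv using n by (simp add: divide_simps) (simp add: algebra_simps)?
  qed
  then have "(\<lambda>n. ?m (?w (?b n))) \<longlonglongrightarrow> - 1"
    using tendsto_minus[OF m[of "- \<theta>"]] by (simp only:)
  then have b: "(\<lambda>n. ?H (?b n)) \<longlonglongrightarrow> Ln (of_real \<sigma> * \<i> * (- 1))"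
    by (intro isCont_tendsto_compose[OF isCont_Ln'[OF continuous_ident \<sigma>i(2)]] tendsto_intros)
  have "integral {0..} ?F = Ln (of_real \<sigma> * \<i> * (- 1)) - Ln (of_real \<sigma> * \<i> * 1)"
    using LIMSEQ_unique[OF lim tendsto_diff[OF b a]] .
  also have "\<dots> = - of_real \<sigma> * \<i> * of_real pi"
    using \<theta>(2) by auto
  finally show "integral {0..} ?F = - of_real \<sigma> * \<i> * of_real pi" .
qed

context sectorial_calculus
begin

lemma \<phi>_pos: "0 < \<phi>" and \<nu>_pos: "0 < \<nu>" and \<mu>_pi: "\<mu> < pi" and \<nu>_pi: "\<nu> < pi"
  using \<mu> \<mu>_\<nu> \<nu>_\<phi> \<phi> by simp_all

text \<open>The resolvent is strongly continuous and locally uniformly bounded; together these give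
  continuity when the vector varies as well.\<close>

lemma continuous_R_comp:
  assumes g: "continuous_on (cosector \<mu>) g"
  shows "continuous_on (cosector \<mu>) (\<lambda>z. R z (g z))"
  unfolding continuous_on_def
proof
  fix z assume z: "z \<in> cosector \<mu>"
  have "((\<lambda>w. M / cmod w * norm (g w - g z) + norm (R w (g z) - R z (g z))) \<longlongrightarrow>
      M / cmod z * norm (g z - g z) + norm (R z (g z) - R z (g z))) (at z within cosector \<mu>)"
    using g continuous_R[of "g z"] z cosector_nonzero[OF z]
    by (intro tendsto_intros) (auto simp: continuous_on_def)
  then have lim: "((\<lambda>w. M / cmod w * norm (g w - g z) + norm (R w (g z) - R z (g z))) \<longlongrightarrow> 0)
      (at z within cosector \<mu>)" by simp
  have "((\<lambda>w. R w (g w) - R z (g z)) \<longlongrightarrow> 0) (at z within cosector \<mu>)"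
  proof (rule Lim_null_comparison[OF _ lim])
    have "norm (R w (g w) - R z (g z)) \<le> M / cmod w * norm (g w - g z) + norm (R w (g z) - R z (g z))"
      if w: "w \<in> cosector \<mu>" for w
    proof -
      have "R w (g w) - R z (g z) = R w (g w - g z) + (R w (g z) - R z (g z))"
        by (simp add: R_diff w)
      also have "norm \<dots> \<le> norm (R w (g w - g z)) + norm (R w (g z) - R z (g z))"
        by (rule norm_triangle_ineq)
      finally show ?thesis using norm_R[OF w, of "g w - g z"] by linarith
    qed
    then show "\<forall>\<^sub>F w in at z within cosector \<mu>.
        norm (R w (g w) - R z (g z)) \<le> M / cmod w * norm (g w - g z) + norm (R w (g z) - R z (g z))"
      by (simp add: eventually_at_filter)
  qed
  then show "((\<lambda>w. R w (g w)) \<longlongrightarrow> R z (g z)) (at z within cosector \<mu>)" by (rule LIM_zero_cancel)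
qed

text \<open>\<open>ray_weight 1\<close> is min(1, r^-2). Both boundary rays are rotated through the
  outer region to the negative axis, where they coincide and cancel.\<close>

lemma sector_integral_outside_eq_0:
  assumes der: "\<And>z. z \<in> cosector \<mu> \<Longrightarrow> (F has_derivative (\<lambda>h. h *\<^sub>C F' z)) (at z)"
    and cont: "continuous_on (cosector \<mu>) F'"
    and le: "\<And>z. z \<in> cosector \<mu> \<Longrightarrow> norm (F z) \<le> C * ray_weight 1 (cmod z)"
  shows "sector_integral \<nu> (F :: complex \<Rightarrow> 'a) = 0"
proof -
  have *: "integral {0..} (\<lambda>r. cis \<alpha> *\<^sub>C F (of_real r * cis \<alpha>)) =
         integral {0..} (\<lambda>r. cis \<beta> *\<^sub>C F (of_real r * cis \<beta>))"
    if ab: "\<alpha> \<le> \<beta>" "\<And>\<theta>. \<theta> \<in> {\<alpha>..\<beta>} \<Longrightarrow> \<mu> < \<bar>\<theta>\<bar> \<and> \<bar>\<theta>\<bar> \<le> pi" for \<alpha> \<beta>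
  proof -
    have mem: "complex_of_real r * cis \<theta> \<in> cosector \<mu>" if "\<theta> \<in> {\<alpha>..\<beta>}" "0 < r" for r \<theta>
      using that ab(2)[of \<theta>] \<mu> by (intro rcis_mem_cosector) auto
    show ?thesis
    proof (rule ray_integral_rotate[OF ab(1) zero_less_one])
      show "(F has_derivative (\<lambda>h. h *\<^sub>C F' (of_real r * cis \<theta>))) (at (of_real r * cis \<theta>))"
        if "\<theta> \<in> {\<alpha>..\<beta>}" "0 < r" for \<theta> r
        by (rule der[OF mem[OF that]])
      show "continuous_on {of_real r * cis \<theta> | r \<theta>. 0 < r \<and> \<theta> \<in> {\<alpha>..\<beta>}} F'"
        by (rule continuous_on_subset[OF cont]) (use mem in blast)
      show "norm (F (of_real r * cis \<theta>)) \<le> C * ray_weight 1 r" if "\<theta> \<in> {\<alpha>..\<beta>}" "0 < r" for \<theta> r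
        using le[OF mem[OF that]] that by (simp add: norm_mult)
    qed
  qed
  have pi: "cis (- pi) = cis pi" by (simp add: complex_eq_iff)
  show ?thesis
    unfolding sector_integral_def
    using *[of \<nu> pi] *[of "- pi" "- \<nu>"] \<mu>_\<nu> \<nu>_pi \<nu>_pos by (simp add: pi)
qed

text \<open>The integrand is split into its singular part at \<open>-1\<close>, corrected by a pole at \<open>1\<close> so as to decay
  at infinity, and a part that is holomorphic outside the sector.\<close>

lemma B_Koebe: "B (\<lambda>z. z / (1 + z)\<^sup>2) x = U x - U (U x)"
proof -
  let ?e = "\<lambda>z::complex. z / (1 + z)\<^sup>2"
  define w where "w = U x"
  define y where "y = U w"
  define G where "G z = z *\<^sub>C R z y - y + (1 / (z - 1)) *\<^sub>C (y - w)" for z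
  define G' where "G' z = R z y - z *\<^sub>C R z (R z y) - (1 / (z - 1)\<^sup>2) *\<^sub>C (y - w)" for z
  obtain \<kappa> where \<kappa>: "0 < \<kappa>" "\<And>z. z \<in> cosector \<mu> \<Longrightarrow> \<kappa> * (1 + cmod z) \<le> cmod (1 - z)"
    using norm_one_minus_ge[OF \<mu> \<mu>_pi] by blast
  have \<kappa>': "\<kappa> \<le> cmod (z - 1)" if "z \<in> cosector \<mu>" for z
  proof -
    have "\<kappa> * 1 \<le> \<kappa> * (1 + cmod z)" using \<kappa>(1) by (intro mult_left_mono) auto
    then show ?thesis using \<kappa>(2)[OF that] by (simp add: norm_minus_commute)
  qed
  have nz1: "z - 1 \<noteq> 0" if "z \<in> cosector \<mu>" for z
    using \<kappa>'[OF that] \<kappa>(1) by auto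
  \<comment> \<open>The first term is holomorphic on the sector and integrates to 0. The second has
    its pole at 1 inside the contour and contributes 2 \<pi> \<i> (w - y). The pole of
    \<open>G\<close> at 1 is inside the sector, so \<open>G\<close> is holomorphic outside it and
    integrates to 0.\<close>
  have split: "?e z *\<^sub>C R z x = (1 / (1 + z)\<^sup>2) *\<^sub>C w + (2 / (z\<^sup>2 - 1)) *\<^sub>C (w - y) + G z"
    if z: "z \<in> cosector \<mu>" and z1: "1 + z \<noteq> 0" for z
  proof -
    have RU: "R z (U v) = (1 / (1 + z)) *\<^sub>C (R z v + U v)" for v
    proof -
      have "(1 + z) *\<^sub>C R z (U v) = R z v + U v"
        using resolvent_identity[OF z minus_one_mem_cosector, of v] R_scaleC[OF z, of "-1"]
        by (simp add: U_eq scaleC.minus_right scaleC.minus_left[symmetric])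
      then have "(1 / (1 + z)) *\<^sub>C (1 + z) *\<^sub>C R z (U v) = (1 / (1 + z)) *\<^sub>C (R z v + U v)" by (simp only:)
      then show ?thesis using z1 unfolding scaleC_scaleC by simp
    qed
    have Ry: "R z y = (1 / (1 + z)\<^sup>2) *\<^sub>C R z x + (1 / (1 + z)\<^sup>2) *\<^sub>C w + (1 / (1 + z)) *\<^sub>C y"
      unfolding y_def RU w_def by (simp add: scaleC_add_right scaleC_scaleC power2_eq_square)
    have p: "z\<^sup>2 - 1 = (z - 1) * (1 + z)" by (simp add: power2_eq_square algebra_simps)
    have "(1 / (1 + z)\<^sup>2) *\<^sub>C w + (2 / (z\<^sup>2 - 1)) *\<^sub>C (w - y) + G z =
        ?e z *\<^sub>C R z x + (1 / (1 + z)\<^sup>2 + 2 / (z\<^sup>2 - 1) + z / (1 + z)\<^sup>2 - 1 / (z - 1)) *\<^sub>C w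
          + (z / (1 + z) - 2 / (z\<^sup>2 - 1) - 1 + 1 / (z - 1)) *\<^sub>C y"
      unfolding G_def Ry
      by (simp add: scaleC_add_right scaleC_scaleC scaleC.diff_right scaleC.diff_left scaleC_add_left algebra_simps)
    also have "1 / (1 + z)\<^sup>2 + 2 / (z\<^sup>2 - 1) + z / (1 + z)\<^sup>2 - 1 / (z - 1) = 0"
    proof -
      have "1 / (1 + z)\<^sup>2 + z / (1 + z)\<^sup>2 = 1 / (1 + z)"
        using z1 by (simp add: power2_eq_square add_divide_distrib[symmetric])
      moreover have "1 / (1 + z) + 2 / (z\<^sup>2 - 1) - 1 / (z - 1) = 0"
        unfolding p using z1 nz1[OF z] by (simp add: divide_simps)
      moreover have "a + b + c - d = (a + c) + b - d" for a b c d :: complex by simp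
      ultimately show ?thesis by metis
    qed
    also have "z / (1 + z) - 2 / (z\<^sup>2 - 1) - 1 + 1 / (z - 1) = 0"
      unfolding p using z1 nz1[OF z] by (simp add: divide_simps) (simp add: algebra_simps)?
    finally show ?thesis by (simp add: scaleC.zero_left)
  qed
  have e: "?e \<in> Hinf0 \<phi>" by (rule Hinf0_Koebe[OF \<phi>_pos \<phi>])
  have G0: "sector_integral \<nu> G = 0"
  proof -
    define K0 where "K0 = M * norm y + norm y + norm (y - w) / \<kappa>"
    define K1 where "K1 = 4 * (M * norm x) + 4 * norm w + 4 / \<kappa> * norm (w - y)"
    have K0: "norm (G z) \<le> K0" if z: "z \<in> cosector \<mu>" for z
    proof -
      have "norm ((1 / (z - 1)) *\<^sub>C (y - w)) \<le> norm (y - w) / \<kappa>"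
        using \<kappa>'[OF z] \<kappa>(1) by (simp add: norm_scaleC norm_divide frac_le)
      moreover have "norm (z *\<^sub>C R z y) \<le> M * norm y" using bnd[OF z] by (simp add: norm_scaleC)
      ultimately show ?thesis
        unfolding G_def K0_def
        using norm_triangle_ineq[of "z *\<^sub>C R z y - y" "(1 / (z - 1)) *\<^sub>C (y - w)"] norm_triangle_ineq4[of "z *\<^sub>C R z y" y]
        by linarith
    qed
    \<comment> \<open>The decay of order |z|^-2 comes from a cancellation between the terms of
      \<open>G\<close>; it is read off after solving \<open>split\<close> for G(z).\<close>
    have K1: "norm (G z) \<le> K1 / (cmod z)\<^sup>2" if z: "z \<in> cosector \<mu>" "2 \<le> cmod z" for z
    proof -
      have r: "0 < cmod z" using z by linarith
      have h: "cmod z / 2 \<le> cmod (1 + z)" using norm_triangle_ineq4[of "1 + z" 1] z by simp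
      then have h0: "0 < cmod (1 + z)" using r by linarith
      then have z1: "1 + z \<noteq> 0" by auto
      have h2: "(cmod z)\<^sup>2 / 4 \<le> (cmod (1 + z))\<^sup>2"
        using power_mono[OF h, of 2] r by (simp add: power_divide)
      have *: "1 / (cmod (1 + z))\<^sup>2 \<le> 4 / (cmod z)\<^sup>2"
        using h2 h0 r by (simp add: divide_simps)
      have "norm (?e z *\<^sub>C R z x) = (cmod z * norm (R z x)) * (1 / (cmod (1 + z))\<^sup>2)"
        by (simp add: norm_scaleC norm_divide norm_power)
      also have "\<dots> \<le> (M * norm x) * (4 / (cmod z)\<^sup>2)"
        by (rule mult_mono[OF bnd[OF z(1)] *]) (use M in auto)
      finally have 1: "norm (?e z *\<^sub>C R z x) \<le> 4 * (M * norm x) / (cmod z)\<^sup>2" by (simp add: mult_ac)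
      have 2: "norm ((1 / (1 + z)\<^sup>2) *\<^sub>C w) \<le> 4 * norm w / (cmod z)\<^sup>2"
        using mult_right_mono[OF *, of "norm w"] by (simp add: norm_scaleC norm_divide norm_power)
      have "\<kappa> * cmod z * (cmod z / 2) \<le> cmod (z - 1) * cmod (1 + z)"
      proof (intro mult_mono h)
        have "\<kappa> * cmod z \<le> \<kappa> * (1 + cmod z)" using \<kappa>(1) by (intro mult_left_mono) auto
        then show "\<kappa> * cmod z \<le> cmod (z - 1)" using \<kappa>(2)[OF z(1)] by (simp add: norm_minus_commute)
      qed (use r in auto)
      then have "\<kappa> * (cmod z)\<^sup>2 / 2 \<le> cmod (z\<^sup>2 - 1)"
        by (simp add: power2_eq_square norm_mult[symmetric] algebra_simps)
      moreover have "0 < \<kappa> * (cmod z)\<^sup>2 / 2" using \<kappa>(1) r by simp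
      ultimately have "2 / cmod (z\<^sup>2 - 1) \<le> 2 / (\<kappa> * (cmod z)\<^sup>2 / 2)"
        by (intro divide_left_mono mult_pos_pos) linarith+
      then have "2 / cmod (z\<^sup>2 - 1) \<le> 4 / \<kappa> / (cmod z)\<^sup>2" by simp
      from mult_right_mono[OF this norm_ge_zero[of "w - y"]]
      have 3: "norm ((2 / (z\<^sup>2 - 1)) *\<^sub>C (w - y)) \<le> 4 / \<kappa> * norm (w - y) / (cmod z)\<^sup>2"
        by (simp add: norm_scaleC norm_divide)
      have tri: "norm (a - b - c) \<le> norm a + norm b + norm c" for a b c :: 'a
        using norm_triangle_ineq4[of "a - b" c] norm_triangle_ineq4[of a b] by linarith
      have "G z = ?e z *\<^sub>C R z x - (1 / (1 + z)\<^sup>2) *\<^sub>C w - (2 / (z\<^sup>2 - 1)) *\<^sub>C (w - y)"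
        using split[OF z(1) z1] by simp
      then have "norm (G z) \<le> norm (?e z *\<^sub>C R z x) + norm ((1 / (1 + z)\<^sup>2) *\<^sub>C w) + norm ((2 / (z\<^sup>2 - 1)) *\<^sub>C (w - y))"
        by (simp only: tri)
      also have "\<dots> \<le> 4 * (M * norm x) / (cmod z)\<^sup>2 + 4 * norm w / (cmod z)\<^sup>2 + 4 / \<kappa> * norm (w - y) / (cmod z)\<^sup>2"
        using 1 2 3 by linarith
      also have "\<dots> = K1 / (cmod z)\<^sup>2" by (simp add: K1_def add_divide_distrib)
      finally show ?thesis .
    qed
    have K: "0 \<le> K0" "0 \<le> K1" using M \<kappa>(1) by (auto simp: K0_def K1_def)
    have le: "norm (G z) \<le> (4 * K0 + K1) * ray_weight 1 (cmod z)" if z: "z \<in> cosector \<mu>" for z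
    proof -
      have r: "0 < cmod z" using cosector_nonzero[OF z] by simp
      have rw: "cmod z powr (- 2) = 1 / (cmod z)\<^sup>2" using r by (simp add: powr_minus_divide)
      have "norm (G z) \<le> (4 * K0 + K1) * 1" using K0[OF z] K by simp
      moreover have "norm (G z) \<le> (4 * K0 + K1) * (1 / (cmod z)\<^sup>2)"
      proof (cases "2 \<le> cmod z")
        case True
        have "K1 * (1 / (cmod z)\<^sup>2) \<le> (4 * K0 + K1) * (1 / (cmod z)\<^sup>2)"
          using K by (intro mult_right_mono) auto
        then show ?thesis using K1[OF z True] by simp
      next
        case False
        then have "(cmod z)\<^sup>2 \<le> 2\<^sup>2" using r by (intro power_mono) auto
        then have "1 \<le> 4 * (1 / (cmod z)\<^sup>2)" using r by (simp add: divide_simps)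
        then have "K0 * 1 \<le> K0 * (4 * (1 / (cmod z)\<^sup>2))" using K by (intro mult_left_mono)
        moreover have "0 \<le> K1 * (1 / (cmod z)\<^sup>2)" using K by simp
        ultimately show ?thesis using K0[OF z] by (simp add: add_divide_distrib mult.commute)
      qed
      ultimately show ?thesis using r rw by (auto simp: ray_weight_def min_def)
    qed
    have der: "(G has_derivative (\<lambda>h. h *\<^sub>C G' z)) (at z)" if z: "z \<in> cosector \<mu>" for z
    proof -
      have 1: "((\<lambda>z. z *\<^sub>C R z y) has_derivative (\<lambda>h. z *\<^sub>C (h *\<^sub>C (- R z (R z y))) + h *\<^sub>C R z y)) (at z)"
        by (rule scaleC.FDERIV[OF has_derivative_ident R_has_derivative[OF z]])
      have "((\<lambda>z. 1 / (z - 1)) has_field_derivative (- 1 / (z - 1)\<^sup>2)) (at z)"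
        using nz1[OF z] by (auto intro!: derivative_eq_intros simp: power2_eq_square)
      then have 2: "((\<lambda>z. (1 / (z - 1)) *\<^sub>C (y - w)) has_derivative (\<lambda>h. ((- 1 / (z - 1)\<^sup>2) * h) *\<^sub>C (y - w))) (at z)"
        using scaleC.FDERIV[OF _ has_derivative_const[of "y - w"]]
        by (fastforce simp: has_field_derivative_def scaleC.zero_right)
      have "(\<lambda>h. (z *\<^sub>C (h *\<^sub>C (- R z (R z y))) + h *\<^sub>C R z y - 0) + ((- 1 / (z - 1)\<^sup>2) * h) *\<^sub>C (y - w)) =
          (\<lambda>h. h *\<^sub>C G' z)"
        by (rule ext) (simp add: G'_def scaleC_scaleC scaleC.diff_right scaleC.minus_right scaleC.minus_left mult.commute)
      then show ?thesis
        using has_derivative_add[OF has_derivative_diff[OF 1 has_derivative_const[of y]] 2]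
        unfolding G_def[abs_def] by (simp only:)
    qed
    have contG': "continuous_on (cosector \<mu>) G'"
      unfolding G'_def[abs_def] using nz1
      by (intro continuous_on_diff continuous_on_add scaleC.continuous_on continuous_R_comp continuous_R
          continuous_intros) auto
    show ?thesis by (rule sector_integral_outside_eq_0[OF der contG' le])
  qed
  let ?F1 = "\<lambda>z::complex. (1 / (1 + z)\<^sup>2) *\<^sub>C w" and ?F2 = "\<lambda>z::complex. (2 / (z\<^sup>2 - 1)) *\<^sub>C (w - y)"
  have hol: "(\<lambda>z. 1 / (1 + z)\<^sup>2) holomorphic_on sector \<phi>"
    using \<phi> by (auto intro!: holomorphic_intros dest: one_plus_nonzero)
  have e': "(\<lambda>z. z * (1 / (1 + z)\<^sup>2)) \<in> Hinf0 \<phi>" using e by simp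
  have F1: "sector_integrable \<nu> ?F1" "sector_integral \<nu> ?F1 = 0"
    using sector_integral_constant[OF hol e' \<nu>_pos \<nu>_\<phi> \<phi>] sector_integral_eq_0[OF hol e' \<nu>_pos \<nu>_\<phi>] \<phi>
    by auto
  have F2: "sector_integrable \<nu> ?F2" "sector_integral \<nu> ?F2 = (2 * of_real pi * \<i>) *\<^sub>C (w - y)"
  proof -
    have eq: "cis \<theta> *\<^sub>C ?F2 (of_real r * cis \<theta>) = (cis \<theta> * (2 / ((of_real r * cis \<theta>)\<^sup>2 - 1))) *\<^sub>C (w - y)" for r \<theta>
      by (simp add: scaleC_scaleC)
    note P = ray_integral_two_over_square_minus_one[OF \<nu>_pos \<nu>_pi, of \<nu> 1, simplified]
    note N = ray_integral_two_over_square_minus_one[OF \<nu>_pos \<nu>_pi, of "- \<nu>" "- 1", simplified]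
    note bl = scaleC.bounded_linear_left[of "w - y"]
    show "sector_integrable \<nu> ?F2"
      unfolding sector_integrable_def eq
      using integrable_linear[OF P(1) bl] integrable_linear[OF N(1) bl] by (auto simp: o_def)
    show "sector_integral \<nu> ?F2 = (2 * of_real pi * \<i>) *\<^sub>C (w - y)"
      unfolding sector_integral_def eq
      using integral_linear[OF P(1) bl] integral_linear[OF N(1) bl] P(2) N(2)
      by (simp add: o_def scaleC.diff_left[symmetric] mult_ac)
  qed
  have eint: "sector_integrable \<nu> (\<lambda>z. ?e z *\<^sub>C R z x)" by (rule B_integrable[OF e])
  have "sector_integrable \<nu> (\<lambda>z. ?e z *\<^sub>C R z x + (- 1) *\<^sub>C (?F1 z + ?F2 z))"
    by (intro sector_integrable_add eint sector_integral_scaleC F1 F2)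
  have nz: "1 + complex_of_real r * cis \<theta> \<noteq> 0" if "0 < r" "\<theta> \<in> {- \<nu>, \<nu>}" for r \<theta>
    using ray_mem(1)[OF that] \<phi> by (intro one_plus_nonzero[of _ \<phi>]) auto
  have "sector_integral \<nu> (\<lambda>z. ?e z *\<^sub>C R z x + (- 1) *\<^sub>C (?F1 z + ?F2 z)) = sector_integral \<nu> G"
  proof (rule sector_integral_cong)
    fix r \<theta> :: real assume r: "0 < r" "\<theta> \<in> {- \<nu>, \<nu>}"
    show "?e (of_real r * cis \<theta>) *\<^sub>C R (of_real r * cis \<theta>) x
        + (- 1) *\<^sub>C (?F1 (of_real r * cis \<theta>) + ?F2 (of_real r * cis \<theta>)) = G (of_real r * cis \<theta>)"
      using split[OF ray_mem(2)[OF r] nz[OF r]] by simp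
  qed
  then have "sector_integral \<nu> (\<lambda>z. ?e z *\<^sub>C R z x) - (2 * of_real pi * \<i>) *\<^sub>C (w - y) = 0"
    using G0 sector_integral_add[OF eint sector_integral_scaleC(2)[OF sector_integrable_add[OF F1(1) F2(1)], of "- 1"]]
      sector_integral_scaleC(1)[OF sector_integrable_add[OF F1(1) F2(1)], of "- 1"]
      sector_integral_add[OF F1(1) F2(1)] F1(2) F2(2) by simp
  then have "B ?e x = (1 / (2 * of_real pi * \<i>)) *\<^sub>C (2 * of_real pi * \<i>) *\<^sub>C (w - y)"
    unfolding B_def by (simp only: right_minus_eq)
  also have "\<dots> = w - y" unfolding scaleC_scaleC by simp
  finally show ?thesis by (simp add: w_def y_def)
qed

end

section \<open>Scaled operators\<close>

context sectorial_calculus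
begin

text \<open>Dilation maps the region outside a sector to itself and leaves |z| |R(z)| unchanged, so
  one \<open>M\<close> serves every tA. This is the source of all uniformity in t.\<close>

lemma scaled:
  assumes t: "0 < t"
  shows "sectorial_calculus D (\<lambda>y. t *\<^sub>R A y) \<mu> M \<nu> \<phi>"
proof
  show "linear_operator D (\<lambda>y. t *\<^sub>R A y)"
    using lin by (auto simp: linear_operator_def scaleR_right_distrib scaleC.scaleR_right)
  fix z assume z: "z \<in> cosector \<mu>"
  then have z': "inverse t *\<^sub>R z \<in> cosector \<mu>" using t by (intro scaleR_mem_cosector) auto
  show "bij_betw (\<lambda>x. z *\<^sub>C x - t *\<^sub>R A x) D UNIV"
    by (rule bij_betw_scaleR[OF t bij[OF z']])
  fix x
  have "inverse t * cmod z * norm (R (inverse t *\<^sub>R z) (inverse t *\<^sub>R x)) \<le> inverse t * (M * norm x)"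
    using bnd[OF z', of "inverse t *\<^sub>R x"] t by (simp add: mult_ac)
  then show "cmod z * norm (resolvent D (\<lambda>y. t *\<^sub>R A y) z x) \<le> M * norm x"
    unfolding resolvent_scaleR[OF t] using t by (simp add: mult_ac)
qed (use M \<mu> \<mu>_\<nu> \<nu>_\<phi> \<phi> in auto)

abbreviation Rt :: "real \<Rightarrow> complex \<Rightarrow> 'a \<Rightarrow> 'a" where "Rt t \<equiv> resolvent D (\<lambda>y. t *\<^sub>R A y)"
abbreviation Bt :: "real \<Rightarrow> (complex \<Rightarrow> complex) \<Rightarrow> 'a \<Rightarrow> 'a" where
  "Bt t \<equiv> sectorial_calculus.B D (\<lambda>y. t *\<^sub>R A y) \<nu>"
abbreviation Ut :: "real \<Rightarrow> 'a \<Rightarrow> 'a" where "Ut t \<equiv> sectorial_calculus.U D (\<lambda>y. t *\<^sub>R A y)"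

lemma norm_B_factor: "norm ((1 / (2 * complex_of_real pi * \<i>)) *\<^sub>C v) \<le> norm (v::'a)"
proof -
  have "cmod (1 / (2 * complex_of_real pi * \<i>)) = 1 / (2 * pi)"
    by (simp add: norm_divide norm_mult)
  also have "\<dots> \<le> 1" using pi_ge_two by simp
  finally have "cmod (1 / (2 * complex_of_real pi * \<i>)) * norm v \<le> 1 * norm v"
    by (rule mult_right_mono) simp
  then show ?thesis by (simp add: norm_scaleC)
qed

lemma norm_Bt:
  assumes f: "f \<in> Hinf0 \<phi>"
  obtains C where "0 \<le> C" "\<And>t x. 0 < t \<Longrightarrow> norm (Bt t f x) \<le> C * norm x"
proof -
  obtain C where C: "0 \<le> C" "\<And>(G :: complex \<Rightarrow> 'a) K. continuous_on (cosector \<mu>) G \<Longrightarrow>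
       (\<And>z. z \<in> cosector \<mu> \<Longrightarrow> cmod z * norm (G z) \<le> K) \<Longrightarrow>
       sector_integrable \<nu> (\<lambda>z. f z *\<^sub>C G z) \<and> norm (sector_integral \<nu> (\<lambda>z. f z *\<^sub>C G z)) \<le> C * K"
    using sector_integral_Hinf0[OF f \<mu> \<mu>_\<nu> \<nu>_\<phi> \<phi>] by blast
  show thesis
  proof (rule that[of "C * M"])
    fix t :: real and x :: 'a assume "0 < t"
    interpret S: sectorial_calculus D "\<lambda>y. t *\<^sub>R A y" \<mu> M \<nu> \<phi> by (rule scaled) fact
    have "norm (sector_integral \<nu> (\<lambda>z. f z *\<^sub>C Rt t z x)) \<le> C * (M * norm x)"
      using C(2)[OF S.continuous_R S.bnd] by blast
    then show "norm (Bt t f x) \<le> C * M * norm x"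
      unfolding S.B_def using norm_B_factor[of "sector_integral \<nu> (\<lambda>z. f z *\<^sub>C Rt t z x)"]
      by (simp add: mult.assoc)
  qed (use C M in simp)
qed

text \<open>A R(z)y = z R(z)y - y is bounded in y, so the perturbation (t-1)A acts on R(z)y without
  loss: applying z - tA to R(z)y gives y - (t-1)(z R(z)y - y).\<close>

lemma resolvent_perturb:
  assumes t: "0 < t" and z: "z \<in> cosector \<mu>"
  shows "Rt t z y = R z y + (t - 1) *\<^sub>R Rt t z (z *\<^sub>C R z y - y)"
proof -
  interpret S: sectorial_calculus D "\<lambda>y. t *\<^sub>R A y" \<mu> M \<nu> \<phi> by (rule scaled[OF t])
  let ?d = "z *\<^sub>C R z y - y"
  have e: "z *\<^sub>C R z y - t *\<^sub>R A (R z y) = y - (t - 1) *\<^sub>R ?d"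
    by (simp add: A_R[OF z] scaleR_left_diff_distrib)
  have "Rt t z y - (t - 1) *\<^sub>R Rt t z ?d = Rt t z (y - (t - 1) *\<^sub>R ?d)"
    by (simp only: S.R_diff[OF z] linear_scale[OF bounded_linear.linear[OF S.bounded_linear_R[OF z]]])
  also have "\<dots> = R z y"
    unfolding e[symmetric] by (rule S.R_left[OF z R_mem[OF z]])
  finally show ?thesis by (simp only: diff_eq_eq)
qed

lemma resolvent_perturb2:
  assumes "0 < t" "z \<in> cosector \<mu>"
  shows "Rt t z x = R z x + (t - 1) *\<^sub>R R z (z *\<^sub>C R z x - x) +
    (t - 1)\<^sup>2 *\<^sub>R Rt t z (z *\<^sub>C R z (z *\<^sub>C R z x - x) - (z *\<^sub>C R z x - x))"
  using resolvent_perturb[OF assms, of x] resolvent_perturb[OF assms, of "z *\<^sub>C R z x - x"]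
  by (simp add: scaleR_right_distrib power2_eq_square add.assoc)

lemma norm_defect:
  assumes "z \<in> cosector \<mu>" shows "norm (z *\<^sub>C R z x - x) \<le> (M + 1) * norm x"
  using norm_triangle_ineq4[of "z *\<^sub>C R z x" x] bnd[OF assms, of x]
  by (simp add: norm_scaleC distrib_right)

lemma continuous_defect:
  "continuous_on (cosector \<mu>) g \<Longrightarrow> continuous_on (cosector \<mu>) (\<lambda>z. z *\<^sub>C R z (g z) - g z)"
  by (intro continuous_on_diff scaleC.continuous_on continuous_R_comp continuous_on_id)

text \<open>Integration by parts along each ray: the derivative of z f(z) R(z)x is z f'(z) R(z)x -
  f(z) R(z)(z R(z)x - x), and z f(z) R(z)x vanishes at both ends of the ray.\<close>

lemma B_derivative_integral:
  assumes f: "f \<in> Hinf0 \<phi>" and f': "\<And>z. z \<in> sector \<phi> \<Longrightarrow> (f has_field_derivative f' z) (at z)"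
    and zf': "(\<lambda>z. z * f' z) \<in> Hinf0 \<phi>"
  shows "sector_integral \<nu> (\<lambda>z. f z *\<^sub>C R z (z *\<^sub>C R z x - x)) = sector_integral \<nu> (\<lambda>z. (z * f' z) *\<^sub>C R z x)"
proof -
  let ?G = "\<lambda>z. R z (z *\<^sub>C R z x - x)"
  have cG: "continuous_on (cosector \<mu>) ?G"
    by (intro continuous_R_comp continuous_defect continuous_on_const)
  have bG: "cmod z * norm (?G z) \<le> M * ((M + 1) * norm x)" if "z \<in> cosector \<mu>" for z
    by (rule order_trans[OF bnd[OF that] mult_left_mono[OF norm_defect[OF that]]]) (use M in auto)
  obtain C s where C: "0 < C" "0 < s" and ray:
    "\<And>(G :: complex \<Rightarrow> 'a) K \<theta>. continuous_on (cosector \<mu>) G \<Longrightarrow>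
       (\<And>z. z \<in> cosector \<mu> \<Longrightarrow> cmod z * norm (G z) \<le> K) \<Longrightarrow> \<theta> \<in> {- \<nu>, \<nu>} \<Longrightarrow>
       continuous_on {0<..} (\<lambda>r. cis \<theta> *\<^sub>C f (of_real r * cis \<theta>) *\<^sub>C G (of_real r * cis \<theta>)) \<and>
       (\<forall>r>0. norm (cis \<theta> *\<^sub>C f (of_real r * cis \<theta>) *\<^sub>C G (of_real r * cis \<theta>)) \<le> C * K * ray_weight s r)"
    using Hinf0_ray[OF f \<mu> \<mu>_\<nu> \<nu>_\<phi> \<phi>] by blast
  obtain C' s' where C': "0 < C'" "0 < s'" and ray':
    "\<And>(G :: complex \<Rightarrow> 'a) K \<theta>. continuous_on (cosector \<mu>) G \<Longrightarrow>
       (\<And>z. z \<in> cosector \<mu> \<Longrightarrow> cmod z * norm (G z) \<le> K) \<Longrightarrow> \<theta> \<in> {- \<nu>, \<nu>} \<Longrightarrow>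
       continuous_on {0<..} (\<lambda>r. cis \<theta> *\<^sub>C ((of_real r * cis \<theta>) * f' (of_real r * cis \<theta>)) *\<^sub>C G (of_real r * cis \<theta>)) \<and>
       (\<forall>r>0. norm (cis \<theta> *\<^sub>C ((of_real r * cis \<theta>) * f' (of_real r * cis \<theta>)) *\<^sub>C G (of_real r * cis \<theta>)) \<le> C' * K * ray_weight s' r)"
    using Hinf0_ray[OF zf' \<mu> \<mu>_\<nu> \<nu>_\<phi> \<phi>] by blast
  have key: "(f z * z) *\<^sub>C h *\<^sub>C (- R z (R z x)) + ((f' z * z + f z) * h) *\<^sub>C R z x =
      h *\<^sub>C ((z * f' z) *\<^sub>C R z x - f z *\<^sub>C ?G z)" if "z \<in> cosector \<mu>" for z h
    by (simp add: R_diff[OF that] R_scaleC[OF that] scaleC_scaleC scaleC.diff_right scaleC.minus_right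
        scaleC_add_left distrib_right) (simp add: mult_ac)
  have eq: "integral {0..} (\<lambda>r. cis \<theta> *\<^sub>C f (of_real r * cis \<theta>) *\<^sub>C ?G (of_real r * cis \<theta>)) =
      integral {0..} (\<lambda>r. cis \<theta> *\<^sub>C ((of_real r * cis \<theta>) * f' (of_real r * cis \<theta>)) *\<^sub>C R (of_real r * cis \<theta>) x)"
    (is "integral _ ?F1 = integral _ ?F2")
    if \<theta>: "\<theta> \<in> {- \<nu>, \<nu>}" for \<theta>
  proof -
    let ?w = "\<lambda>r. complex_of_real r * cis \<theta>"
    let ?H = "\<lambda>r. (f (?w r) * ?w r) *\<^sub>C R (?w r) x"
    let ?a = "\<lambda>n. inverse (real (Suc n))" and ?b = "\<lambda>n. real (Suc n)"
    note r1 = ray[OF cG bG \<theta>] and r2 = ray'[OF continuous_R bnd \<theta>, of x]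
    have l1: "(\<lambda>n. integral {?a n..?b n} ?F1) \<longlonglongrightarrow> integral {0..} ?F1"
      using r1 by (intro ray_integral_limit[OF _ C(2)]) blast+
    have l2: "(\<lambda>n. integral {?a n..?b n} ?F2) \<longlonglongrightarrow> integral {0..} ?F2"
      using r2 by (intro ray_integral_limit[OF _ C'(2)]) blast+
    have dH: "(?H has_vector_derivative (?F2 r - ?F1 r)) (at r within T)" if r: "0 < r" for r T
    proof -
      note m = ray_mem[OF r \<theta>]
      have "((\<lambda>z. f z * z) has_field_derivative (f' (?w r) * ?w r + f (?w r))) (at (?w r))"
        using f'[OF m(1)] by (auto intro!: derivative_eq_intros)
      from scaleC.FDERIV[OF this[unfolded has_field_derivative_def] R_has_derivative[OF m(2), of x]]
      have "((\<lambda>z. (f z * z) *\<^sub>C R z x) has_derivative (\<lambda>h. h *\<^sub>C ((?w r * f' (?w r)) *\<^sub>C R (?w r) x - f (?w r) *\<^sub>C ?G (?w r))))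
          (at (?w r))"
        by (rule has_derivative_eq_rhs) (rule ext, rule key[OF m(2)])
      moreover have "(?w has_vector_derivative cis \<theta>) (at r within T)"
        by (rule derivative_eq_intros | simp add: has_vector_derivative_of_real)+
      ultimately have "(?H has_vector_derivative cis \<theta> *\<^sub>C ((?w r * f' (?w r)) *\<^sub>C R (?w r) x - f (?w r) *\<^sub>C ?G (?w r))) (at r within T)"
        using has_vector_derivative_chain_scaleC[where F = "\<lambda>z. (f z * z) *\<^sub>C R z x" and \<gamma> = ?w] by blast
      then show ?thesis by (simp only: scaleC.diff_right)
    qed
    have ab: "?a n \<le> ?b n" "0 < ?a n" for n
    proof -
      have "?a n \<le> 1" by (simp add: inverse_le_1_iff)
      then show "?a n \<le> ?b n" by simp
    qed simp
    have diff: "integral {?a n..?b n} ?F2 - integral {?a n..?b n} ?F1 = ?H (?b n) - ?H (?a n)" for n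
    proof -
      have sub: "{?a n..?b n} \<subseteq> {0<..}" using ab(2)[of n] by (metis atLeastAtMost_iff greaterThan_iff order_less_le_trans subsetI)
      have i1: "?F1 integrable_on {?a n..?b n}"
        by (rule integrable_continuous_real[OF continuous_on_subset[OF conjunct1[OF r1] sub]])
      have i2: "?F2 integrable_on {?a n..?b n}"
        by (rule integrable_continuous_real[OF continuous_on_subset[OF conjunct1[OF r2] sub]])
      have "((\<lambda>r. ?F2 r - ?F1 r) has_integral (?H (?b n) - ?H (?a n))) {?a n..?b n}"
        using sub by (intro fundamental_theorem_of_calculus ab dH) auto
      then show ?thesis
        using Henstock_Kurzweil_Integration.integral_diff[OF i2 i1] by (simp add: integral_unique)
    qed
    have H: "norm (?H r) \<le> C * M * norm x * (r * ray_weight s r)" if r: "0 < r" for r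
    proof -
      have "norm (?H r) = r * norm (cis \<theta> *\<^sub>C f (?w r) *\<^sub>C R (?w r) x)"
        using r by (simp add: norm_scaleC norm_mult)
      also have "\<dots> \<le> r * (C * (M * norm x) * ray_weight s r)"
        using ray[OF continuous_R bnd \<theta>, of x] r by (intro mult_left_mono) auto
      finally show ?thesis by (simp add: mult_ac)
    qed
    note w = mult_ray_weight_Suc[OF C(2)]
    have "(\<lambda>n. ?H (?b n) - ?H (?a n)) \<longlonglongrightarrow> 0"
    proof (rule Lim_null_comparison)
      have "(\<lambda>n. ?b n powr (- s)) \<longlonglongrightarrow> 0"
        by (rule real_Suc_powr_tendsto_0[OF C(2)])
      then have "(\<lambda>n. C * M * norm x * ?b n powr (- s) + C * M * norm x * ?b n powr (- s)) \<longlonglongrightarrow>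
          C * M * norm x * 0 + C * M * norm x * 0"
        by (intro tendsto_add tendsto_mult tendsto_const)
      then show "(\<lambda>n. C * M * norm x * ?b n powr (- s) + C * M * norm x * ?b n powr (- s)) \<longlonglongrightarrow> 0" by simp
      have "norm (?H (?b n) - ?H (?a n)) \<le> C * M * norm x * ?b n powr (- s) + C * M * norm x * ?b n powr (- s)" for n
        using norm_triangle_ineq4[of "?H (?b n)" "?H (?a n)"] H[of "?b n"] H[of "?a n"] ab(2)[of n]
        unfolding w by (simp del: of_nat_Suc)
      then show "\<forall>\<^sub>F n in sequentially. norm (?H (?b n) - ?H (?a n)) \<le>
          C * M * norm x * ?b n powr (- s) + C * M * norm x * ?b n powr (- s)"
        by (intro always_eventually allI)
    qed
    then have "(\<lambda>n. integral {?a n..?b n} ?F2 - integral {?a n..?b n} ?F1) \<longlonglongrightarrow> 0"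
      by (simp only: diff)
    from LIMSEQ_unique[OF this tendsto_diff[OF l2 l1]] show ?thesis by simp
  qed
  show ?thesis unfolding sector_integral_def using eq by simp
qed

text \<open>\<open>resolvent_perturb2\<close> is multiplied by f and integrated;
  \<open>B_derivative_integral\<close> identifies the linear coefficient. An expansion at t = 1
  suffices, since for another t it can be applied to the operator tA.\<close>

lemma Bt_quadratic:
  assumes f: "f \<in> Hinf0 \<phi>" and f': "\<And>z. z \<in> sector \<phi> \<Longrightarrow> (f has_field_derivative f' z) (at z)"
    and zf': "(\<lambda>z. z * f' z) \<in> Hinf0 \<phi>"
  shows "\<exists>K. \<forall>t>0. norm (Bt t f x - B f x - (t - 1) *\<^sub>R B (\<lambda>z. z * f' z) x) \<le> K * (t - 1)\<^sup>2"
proof -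
  obtain C where C: "0 \<le> C" "\<And>(G :: complex \<Rightarrow> 'a) K. continuous_on (cosector \<mu>) G \<Longrightarrow>
       (\<And>z. z \<in> cosector \<mu> \<Longrightarrow> cmod z * norm (G z) \<le> K) \<Longrightarrow>
       sector_integrable \<nu> (\<lambda>z. f z *\<^sub>C G z) \<and> norm (sector_integral \<nu> (\<lambda>z. f z *\<^sub>C G z)) \<le> C * K"
    using sector_integral_Hinf0[OF f \<mu> \<mu>_\<nu> \<nu>_\<phi> \<phi>] by blast
  let ?S = "\<lambda>g z. z *\<^sub>C R z (g z) - g z"
  let ?S1 = "?S (\<lambda>_. x)"
  let ?S2 = "?S ?S1"
  let ?K = "M * ((M + 1) * ((M + 1) * norm x))"
  let ?c = "1 / (2 * complex_of_real pi * \<i>)"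
  show ?thesis
  proof (intro exI[of _ "C * ?K"] allI impI)
    fix t :: real assume t: "0 < t"
    have int: "sector_integral \<nu> (\<lambda>z. f z *\<^sub>C R z (?S1 z)) = sector_integral \<nu> (\<lambda>z. (z * f' z) *\<^sub>C R z x)"
      by (rule B_derivative_integral[OF f f' zf'])
    interpret S: sectorial_calculus D "\<lambda>y. t *\<^sub>R A y" \<mu> M \<nu> \<phi> by (rule scaled[OF t])
    have c1: "continuous_on (cosector \<mu>) ?S1" by (intro continuous_defect continuous_on_const)
    have cV: "continuous_on (cosector \<mu>) (\<lambda>z. Rt t z (?S2 z))"
      by (intro S.continuous_R_comp continuous_defect continuous_on_const)
    have bV: "cmod z * norm (Rt t z (?S2 z)) \<le> ?K" if z: "z \<in> cosector \<mu>" for z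
    proof -
      have "norm (?S2 z) \<le> (M + 1) * norm (?S1 z)" by (rule norm_defect[OF z])
      also have "\<dots> \<le> (M + 1) * ((M + 1) * norm x)"
        by (intro mult_left_mono norm_defect z) (use M in auto)
      finally have "M * norm (?S2 z) \<le> ?K" by (intro mult_left_mono) (use M in auto)
      then show ?thesis using S.bnd[OF z, of "?S2 z"] by linarith
    qed
    note V = C(2)[OF cV bV]
    have cT: "continuous_on (cosector \<mu>) (\<lambda>z. R z (?S1 z))" by (intro continuous_R_comp c1)
    have bT: "cmod z * norm (R z (?S1 z)) \<le> M * ((M + 1) * norm x)" if "z \<in> cosector \<mu>" for z
      by (rule order_trans[OF bnd[OF that] mult_left_mono[OF norm_defect[OF that]]]) (use M in auto)
    note T = C(2)[OF cT bT]
    have "sector_integral \<nu> (\<lambda>z. f z *\<^sub>C Rt t z x) = sector_integral \<nu> (\<lambda>z. f z *\<^sub>C R z x +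
        (of_real (t - 1) *\<^sub>C (f z *\<^sub>C R z (?S1 z)) + of_real ((t - 1)\<^sup>2) *\<^sub>C (f z *\<^sub>C Rt t z (?S2 z))))"
    proof (rule sector_integral_cong)
      fix r \<theta> :: real assume r: "0 < r" "\<theta> \<in> {- \<nu>, \<nu>}"
      let ?z = "complex_of_real r * cis \<theta>"
      show "f ?z *\<^sub>C Rt t ?z x = f ?z *\<^sub>C R ?z x +
          (of_real (t - 1) *\<^sub>C (f ?z *\<^sub>C R ?z (?S1 ?z)) + of_real ((t - 1)\<^sup>2) *\<^sub>C (f ?z *\<^sub>C Rt t ?z (?S2 ?z)))"
        unfolding resolvent_perturb2[OF t ray_mem(2)[OF r], of x] scaleC_of_real
        by (simp only: scaleC_add_right scaleC.scaleR_right add.assoc)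
    qed
    also have "\<dots> = sector_integral \<nu> (\<lambda>z. f z *\<^sub>C R z x) +
        (of_real (t - 1) *\<^sub>C sector_integral \<nu> (\<lambda>z. f z *\<^sub>C R z (?S1 z)) +
         of_real ((t - 1)\<^sup>2) *\<^sub>C sector_integral \<nu> (\<lambda>z. f z *\<^sub>C Rt t z (?S2 z)))"
      using T V sector_integral_scaleC[of \<nu> "\<lambda>z. f z *\<^sub>C R z (?S1 z)" "of_real (t - 1)"]
        sector_integral_scaleC[of \<nu> "\<lambda>z. f z *\<^sub>C Rt t z (?S2 z)" "of_real ((t - 1)\<^sup>2)"]
      by (subst sector_integral_add sector_integrable_add | simp add: B_integrable f sector_integrable_add)+
    finally have "Bt t f x = B f x + (t - 1) *\<^sub>R (?c *\<^sub>C sector_integral \<nu> (\<lambda>z. f z *\<^sub>C R z (?S1 z))) +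
         (t - 1)\<^sup>2 *\<^sub>R (?c *\<^sub>C sector_integral \<nu> (\<lambda>z. f z *\<^sub>C Rt t z (?S2 z)))"
      unfolding S.B_def B_def scaleC_of_real by (simp only: scaleC_add_right scaleC.scaleR_right add.assoc)
    also have "?c *\<^sub>C sector_integral \<nu> (\<lambda>z. f z *\<^sub>C R z (?S1 z)) = B (\<lambda>z. z * f' z) x"
      by (simp only: B_def int)
    finally have eq: "Bt t f x - B f x - (t - 1) *\<^sub>R B (\<lambda>z. z * f' z) x =
        (t - 1)\<^sup>2 *\<^sub>R (?c *\<^sub>C sector_integral \<nu> (\<lambda>z. f z *\<^sub>C Rt t z (?S2 z)))" by simp
    have "norm (?c *\<^sub>C sector_integral \<nu> (\<lambda>z. f z *\<^sub>C Rt t z (?S2 z))) \<le> C * ?K"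
      using V norm_B_factor order_trans by blast
    then have "(t - 1)\<^sup>2 * norm (?c *\<^sub>C sector_integral \<nu> (\<lambda>z. f z *\<^sub>C Rt t z (?S2 z))) \<le> (t - 1)\<^sup>2 * (C * ?K)"
      by (rule mult_left_mono) simp
    then show "norm (Bt t f x - B f x - (t - 1) *\<^sub>R B (\<lambda>z. z * f' z) x) \<le> C * ?K * (t - 1)\<^sup>2"
      unfolding eq by (simp add: mult.commute)
  qed
qed

text \<open>The same expansion at the single point z = -1. The linear coefficient U^2 - U
  corresponds to z times the derivative of 1/(1+z), which is -z/(1+z)^2.\<close>

lemma Ut_quadratic:
  "\<exists>K. \<forall>t>0. norm (Ut t x - U x - (t - 1) *\<^sub>R (U (U x) - U x)) \<le> K * (t - 1)\<^sup>2"
proof -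
  let ?z = "- 1 :: complex"
  note m = minus_one_mem_cosector
  let ?S1 = "?z *\<^sub>C R ?z x - x"
  let ?S2 = "?z *\<^sub>C R ?z ?S1 - ?S1"
  show ?thesis
  proof (intro exI[of _ "M * norm ?S2"] allI impI)
    fix t :: real assume t: "0 < t"
    interpret S: sectorial_calculus D "\<lambda>y. t *\<^sub>R A y" \<mu> M \<nu> \<phi> by (rule scaled[OF t])
    have "R ?z ?S1 = U x - U (U x)"
      using R_diff[OF m, of "- R ?z x" x] by (simp add: U_eq)
    then have "Ut t x - U x - (t - 1) *\<^sub>R (U (U x) - U x) = - ((t - 1)\<^sup>2 *\<^sub>R Rt t ?z ?S2)"
      using resolvent_perturb2[OF t m, of x]
      by (simp only: S.U_eq U_eq[of x]) (simp add: scaleR_right_diff_distrib scaleR_right_distrib)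
    then have "norm (Ut t x - U x - (t - 1) *\<^sub>R (U (U x) - U x)) = (t - 1)\<^sup>2 * norm (Rt t ?z ?S2)"
      by simp
    also have "\<dots> \<le> (t - 1)\<^sup>2 * (M * norm ?S2)"
      using S.norm_R[OF m, of ?S2] by (intro mult_left_mono) auto
    finally show "norm (Ut t x - U x - (t - 1) *\<^sub>R (U (U x) - U x)) \<le> M * norm ?S2 * (t - 1)\<^sup>2"
      by (simp add: mult.commute)
  qed
qed

end

text \<open>The increment is multiplicative, from t to \<tau> t, because the expansion at 1 for the
  operator tA concerns the operators \<tau>(tA).\<close>

lemma has_vector_derivative_of_quadratic:
  fixes f :: "real \<Rightarrow> 'a::real_normed_vector"
  assumes t: "0 < t" and K: "\<And>\<tau>. 0 < \<tau> \<Longrightarrow> norm (f (\<tau> * t) - f t - (\<tau> - 1) *\<^sub>R d) \<le> K * (\<tau> - 1)\<^sup>2"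
  shows "(f has_vector_derivative (1 / t) *\<^sub>R d) (at t)"
  unfolding has_vector_derivative_def
proof (rule has_derivativeI_sandwich[OF t, where H = "\<lambda>y. K / t\<^sup>2 * \<bar>y - t\<bar>"])
  show "bounded_linear (\<lambda>h. h *\<^sub>R (1 / t) *\<^sub>R d)" by (rule bounded_linear_scaleR_left)
  have "((\<lambda>y. K / t\<^sup>2 * \<bar>y - t\<bar>) \<longlongrightarrow> K / t\<^sup>2 * \<bar>t - t\<bar>) (at t)" by (intro tendsto_intros)
  then show "((\<lambda>y. K / t\<^sup>2 * \<bar>y - t\<bar>) \<longlongrightarrow> 0) (at t)" by simp
  fix y assume y: "y \<noteq> t" "dist y t < t"
  then have "0 < y / t" using t by (auto simp: dist_real_def abs_if split: if_splits)
  from K[OF this] have "norm (f y - f t - (y - t) *\<^sub>R (1 / t) *\<^sub>R d) \<le> K * ((y - t) / t)\<^sup>2"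
    using t by (simp add: field_simps)
  also have "\<dots> = K / t\<^sup>2 * \<bar>y - t\<bar> * \<bar>y - t\<bar>"
    by (simp add: power_divide power2_eq_square[symmetric])
  finally show "norm (f y - f t - (y - t) *\<^sub>R (1 / t) *\<^sub>R d) / norm (y - t) \<le> K / t\<^sup>2 * \<bar>y - t\<bar>"
    using y by (simp add: divide_le_eq)
qed

context sectorial_calculus
begin

lemma Bt_has_vector_derivative:
  assumes f: "f \<in> Hinf0 \<phi>" and f': "\<And>z. z \<in> sector \<phi> \<Longrightarrow> (f has_field_derivative f' z) (at z)"
    and zf': "(\<lambda>z. z * f' z) \<in> Hinf0 \<phi>" and t: "0 < t"
  shows "((\<lambda>t. Bt t f x) has_vector_derivative (1 / t) *\<^sub>R Bt t (\<lambda>z. z * f' z) x) (at t)"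
proof -
  interpret S: sectorial_calculus D "\<lambda>y. t *\<^sub>R A y" \<mu> M \<nu> \<phi> by (rule scaled[OF t])
  obtain K where "\<And>\<tau>. 0 < \<tau> \<Longrightarrow> norm (S.Bt \<tau> f x - S.B f x - (\<tau> - 1) *\<^sub>R S.B (\<lambda>z. z * f' z) x) \<le> K * (\<tau> - 1)\<^sup>2"
    using S.Bt_quadratic[OF f f' zf'] by blast
  then show ?thesis
    by (intro has_vector_derivative_of_quadratic[OF t]) simp
qed

lemma Ut_has_vector_derivative:
  assumes t: "0 < t"
  shows "((\<lambda>t. Ut t x) has_vector_derivative (1 / t) *\<^sub>R (Ut t (Ut t x) - Ut t x)) (at t)"
proof -
  interpret S: sectorial_calculus D "\<lambda>y. t *\<^sub>R A y" \<mu> M \<nu> \<phi> by (rule scaled[OF t])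
  obtain K where "\<And>\<tau>. 0 < \<tau> \<Longrightarrow> norm (S.Ut \<tau> x - S.U x - (\<tau> - 1) *\<^sub>R (S.U (S.U x) - S.U x)) \<le> K * (\<tau> - 1)\<^sup>2"
    using S.Ut_quadratic by blast
  then show ?thesis
    by (intro has_vector_derivative_of_quadratic[OF t]) simp
qed

text \<open>The contour integral of f(z)/z times the vector b vanishes, so R(z,tA)b may be replaced
  by G(z) = R(z,tA)b - b/z. As b lies in \<open>D\<close>, z G(z) = R(z,tA)(tAb), which is small
  where |z| is large compared with t.\<close>

lemma Bt_tendsto_0:
  assumes f: "f \<in> Hinf0 \<phi>" and b: "b \<in> D"
  shows "((\<lambda>t. Bt t f b) \<longlongrightarrow> 0) (at_right 0)"
proof -
  obtain C s where C: "0 < C" "0 < s" and ray: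
    "\<And>(G :: complex \<Rightarrow> 'a) K \<theta>. continuous_on (cosector \<mu>) G \<Longrightarrow>
       (\<And>z. z \<in> cosector \<mu> \<Longrightarrow> cmod z * norm (G z) \<le> K) \<Longrightarrow> \<theta> \<in> {- \<nu>, \<nu>} \<Longrightarrow>
       continuous_on {0<..} (\<lambda>r. cis \<theta> *\<^sub>C f (of_real r * cis \<theta>) *\<^sub>C G (of_real r * cis \<theta>)) \<and>
       (\<forall>r>0. norm (cis \<theta> *\<^sub>C f (of_real r * cis \<theta>) *\<^sub>C G (of_real r * cis \<theta>)) \<le> C * K * ray_weight s r)"
    using Hinf0_ray[OF f \<mu> \<mu>_\<nu> \<nu>_\<phi> \<phi>] by blast
  have hol: "f holomorphic_on sector \<phi>" using Hinf0E[OF f] by metis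
  obtain C2 s2 where C2: "0 < C2" "0 < s2" and
    fle: "\<And>z. z \<in> sector \<phi> \<Longrightarrow> cmod (f z) \<le> C2 * (cmod z * ray_weight s2 (cmod z))"
    using Hinf0E[OF f] by metis
  \<comment> \<open>min(1, t/|z|) is bounded by (t/|z|)^\<sigma>. The loss |z|^-\<sigma> is absorbed
    by the decay of f at 0, which still leaves the exponent s2 - \<sigma> \<ge> \<sigma>.\<close>
  define \<sigma> where "\<sigma> = min 1 (s2 / 2)"
  have \<sigma>: "0 < \<sigma>" "\<sigma> \<le> 1" "\<sigma> \<le> s2 - \<sigma>" using C2 by (auto simp: \<sigma>_def min_def)
  define K where "K = max (M * norm (A b)) ((M + 1) * norm b)"
  have K: "0 \<le> K" using M by (simp add: K_def le_max_iff_disj)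
  have est: "norm (Bt t f b) \<le> 4 * C2 * K / \<sigma> * t powr \<sigma>" if t: "0 < t" for t
  proof -
    interpret S: sectorial_calculus D "\<lambda>y. t *\<^sub>R A y" \<mu> M \<nu> \<phi> by (rule scaled[OF t])
    define G where "G z = Rt t z b + (- inverse z) *\<^sub>C b" for z
    have zR: "z *\<^sub>C Rt t z b - b = Rt t z (t *\<^sub>R A b)" if z: "z \<in> cosector \<mu>" for z
    proof -
      have "Rt t z (z *\<^sub>C b) - Rt t z (t *\<^sub>R A b) = b"
        using S.R_left[OF z b] by (simp only: S.R_diff[OF z])
      then show ?thesis by (simp add: S.R_scaleC[OF z] algebra_simps)
    qed
    have nG: "cmod z * norm (G z) = norm (z *\<^sub>C Rt t z b - b)" if z: "z \<in> cosector \<mu>" for z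
    proof -
      have "z *\<^sub>C G z = z *\<^sub>C Rt t z b - b"
        using cosector_nonzero[OF z] by (simp add: G_def scaleC_add_right scaleC.diff_right scaleC_scaleC scaleC.minus_left)
      then show ?thesis by (metis norm_scaleC)
    qed
    have G1: "cmod z * norm (G z) \<le> K" if z: "z \<in> cosector \<mu>" for z
      unfolding nG[OF z] using S.norm_defect[OF z, of b] by (simp add: K_def le_max_iff_disj)
    have G2: "cmod z * norm (G z) \<le> K * (t / cmod z)" if z: "z \<in> cosector \<mu>" for z
    proof -
      have "norm (Rt t z (t *\<^sub>R A b)) \<le> M * norm (A b) * (t / cmod z)"
        using S.norm_R[OF z, of "t *\<^sub>R A b"] t by (simp add: mult_ac)
      also have "\<dots> \<le> K * (t / cmod z)" using t by (intro mult_right_mono) (auto simp: K_def)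
      finally show ?thesis unfolding nG[OF z] zR[OF z] .
    qed
    have G: "cmod z * norm (G z) \<le> K * (t powr \<sigma> * cmod z powr (- \<sigma>))" if z: "z \<in> cosector \<mu>" for z
    proof -
      let ?q = "t / cmod z"
      have r: "0 < cmod z" using cosector_nonzero[OF z] by simp
      have q: "0 < ?q" using r t by simp
      have "min 1 ?q \<le> ?q powr \<sigma>"
      proof (cases "?q \<le> 1")
        case True
        then have "?q powr 1 \<le> ?q powr \<sigma>" using \<sigma> q by (intro powr_mono') auto
        then show ?thesis using q t by (simp add: min_le_iff_disj)
      next
        case False
        then show ?thesis using \<sigma> by (simp add: min_le_iff_disj ge_one_powr_ge_zero)
      qed
      moreover have "?q powr \<sigma> = t powr \<sigma> * cmod z powr (- \<sigma>)"
        using t r by (simp add: powr_divide powr_minus_divide)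
      moreover have "cmod z * norm (G z) \<le> K * min 1 ?q"
        using G1[OF z] G2[OF z] by (simp add: min_def)
      ultimately show ?thesis using K by (metis mult_left_mono order_trans)
    qed
    have cG: "continuous_on (cosector \<mu>) G"
      unfolding G_def[abs_def] using cosector_nonzero
      by (intro continuous_on_add S.continuous_R scaleC.continuous_on continuous_intros) auto
    have ray_est: "norm (integral {0..} (\<lambda>r. cis \<theta> *\<^sub>C f (of_real r * cis \<theta>) *\<^sub>C G (of_real r * cis \<theta>)))
        \<le> 2 * (C2 * K * t powr \<sigma>) / \<sigma>" if \<theta>: "\<theta> \<in> {- \<nu>, \<nu>}" for \<theta>
    proof (rule ray_integral_bound[OF _ \<sigma>(1)])
      show "continuous_on {0<..} (\<lambda>r. cis \<theta> *\<^sub>C f (of_real r * cis \<theta>) *\<^sub>C G (of_real r * cis \<theta>))"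
        using ray[OF cG G1 \<theta>] by blast
      fix r :: real assume r: "0 < r"
      let ?z = "complex_of_real r * cis \<theta>"
      note m = ray_mem[OF r \<theta>]
      have "ray_weight s2 r * r powr (- \<sigma>) \<le> ray_weight \<sigma> r"
      proof (cases "r \<le> 1")
        case True
        then have "r powr (s2 - 1) * r powr (- \<sigma>) \<le> r powr (\<sigma> - 1)"
          unfolding powr_add[symmetric] using r \<sigma> by (intro powr_mono') auto
        then show ?thesis using True r \<sigma> C2 by (simp add: ray_weight_eq_lower)
      next
        case False
        then have "r powr (- s2 - 1) * r powr (- \<sigma>) \<le> r powr (- \<sigma> - 1)"
          unfolding powr_add[symmetric] using r C2 by (intro powr_mono) auto
        then show ?thesis using False r \<sigma> C2 by (simp add: ray_weight_eq_upper)
      qed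
      then have w: "C2 * K * t powr \<sigma> * (ray_weight s2 r * r powr (- \<sigma>)) \<le> C2 * K * t powr \<sigma> * ray_weight \<sigma> r"
        using C2 K by (intro mult_left_mono) auto
      have "cmod (f ?z) * norm (G ?z) \<le> (C2 * (r * ray_weight s2 r)) * norm (G ?z)"
        using fle[OF m(1)] r by (intro mult_right_mono) (auto simp: norm_mult)
      also have "\<dots> = C2 * ray_weight s2 r * (r * norm (G ?z))" by simp
      also have "\<dots> \<le> C2 * ray_weight s2 r * (K * (t powr \<sigma> * r powr (- \<sigma>)))"
        using G[OF m(2)] r C2 by (intro mult_left_mono) (auto simp: norm_mult)
      also have "\<dots> = C2 * K * t powr \<sigma> * (ray_weight s2 r * r powr (- \<sigma>))" by simp
      finally show "norm (cis \<theta> *\<^sub>C f ?z *\<^sub>C G ?z) \<le> C2 * K * t powr \<sigma> * ray_weight \<sigma> r"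
        using w by (simp add: norm_scaleC)
    qed
    have hf: "(\<lambda>z. f z / z) holomorphic_on sector \<phi>"
      using hol by (auto intro!: holomorphic_intros simp: sector_def)
    have zf: "(\<lambda>z. z * (f z / z)) \<in> Hinf0 \<phi>"
      by (rule Hinf0_cong[OF f]) (simp add: sector_def)
    note c = sector_integral_constant[OF hf zf \<nu>_pos \<nu>_\<phi> \<phi>, of "- b"]
    have "sector_integral \<nu> (\<lambda>z. f z *\<^sub>C G z) = sector_integral \<nu> (\<lambda>z. f z *\<^sub>C Rt t z b + (f z / z) *\<^sub>C (- b))"
      by (rule sector_integral_cong)
        (simp add: G_def scaleC_add_right scaleC.diff_right scaleC_scaleC scaleC.minus_left scaleC.minus_right divide_inverse)
    also have "\<dots> = sector_integral \<nu> (\<lambda>z. f z *\<^sub>C Rt t z b)"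
      using sector_integral_add[OF S.B_integrable[OF f] c] sector_integral_eq_0[OF hf zf \<nu>_pos \<nu>_\<phi>] \<phi> by simp
    finally have "Bt t f b = (1 / (2 * of_real pi * \<i>)) *\<^sub>C sector_integral \<nu> (\<lambda>z. f z *\<^sub>C G z)"
      by (simp add: S.B_def)
    then have "norm (Bt t f b) \<le> norm (sector_integral \<nu> (\<lambda>z. f z *\<^sub>C G z))"
      using norm_B_factor by simp
    also have "\<dots> \<le> 2 * (C2 * K * t powr \<sigma>) / \<sigma> + 2 * (C2 * K * t powr \<sigma>) / \<sigma>"
      unfolding sector_integral_def
      by (intro order_trans[OF norm_triangle_ineq4] add_mono ray_est) auto
    finally show ?thesis by simp
  qed
  show ?thesis
  proof (rule Lim_null_comparison)
    show "\<forall>\<^sub>F t in at_right 0. norm (Bt t f b) \<le> 4 * C2 * K / \<sigma> * t powr \<sigma>"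
      using est by (auto simp: eventually_at_filter)
    have "((\<lambda>t. t powr \<sigma>) \<longlongrightarrow> 0) (at_right (0::real))"
      by (rule tendsto_zero_powrI[OF tendsto_ident_at tendsto_const _ \<sigma>(1)]) (simp add: eventually_at_filter)
    then have "((\<lambda>t. 4 * C2 * K / \<sigma> * t powr \<sigma>) \<longlongrightarrow> 4 * C2 * K / \<sigma> * 0) (at_right 0)"
      by (intro tendsto_intros)
    then show "((\<lambda>t. 4 * C2 * K / \<sigma> * t powr \<sigma>) \<longlongrightarrow> 0) (at_right 0)" by simp
  qed
qed

end

section \<open>The reproducing formula\<close>

context sectorial_calculus
begin

text \<open>Gives continuity in t for functions whose z f'(z) is not known to lie in
  \<open>Hinf0\<close>, such as the decaying part of \<psi>; the first-order expansion is
  enough.\<close>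

lemma Bt_lipschitz:
  assumes f: "f \<in> Hinf0 \<phi>"
  shows "\<exists>K. \<forall>t>0. norm (Bt t f x - B f x) \<le> K * \<bar>t - 1\<bar>"
proof -
  obtain C where C: "0 \<le> C" "\<And>(G :: complex \<Rightarrow> 'a) K. continuous_on (cosector \<mu>) G \<Longrightarrow>
       (\<And>z. z \<in> cosector \<mu> \<Longrightarrow> cmod z * norm (G z) \<le> K) \<Longrightarrow>
       sector_integrable \<nu> (\<lambda>z. f z *\<^sub>C G z) \<and> norm (sector_integral \<nu> (\<lambda>z. f z *\<^sub>C G z)) \<le> C * K"
    using sector_integral_Hinf0[OF f \<mu> \<mu>_\<nu> \<nu>_\<phi> \<phi>] by blast
  let ?S = "\<lambda>z. z *\<^sub>C R z x - x"
  let ?c = "1 / (2 * complex_of_real pi * \<i>)"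
  show ?thesis
  proof (intro exI[of _ "C * (M * ((M + 1) * norm x))"] allI impI)
    fix t :: real assume t: "0 < t"
    interpret S: sectorial_calculus D "\<lambda>y. t *\<^sub>R A y" \<mu> M \<nu> \<phi> by (rule scaled[OF t])
    have cV: "continuous_on (cosector \<mu>) (\<lambda>z. Rt t z (?S z))"
      by (intro S.continuous_R_comp continuous_defect continuous_on_const)
    have bV: "cmod z * norm (Rt t z (?S z)) \<le> M * ((M + 1) * norm x)" if "z \<in> cosector \<mu>" for z
      by (rule order_trans[OF S.bnd[OF that] mult_left_mono[OF norm_defect[OF that]]]) (use M in auto)
    note V = C(2)[OF cV bV]
    have "sector_integral \<nu> (\<lambda>z. f z *\<^sub>C Rt t z x) = sector_integral \<nu> (\<lambda>z. f z *\<^sub>C R z x +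
        of_real (t - 1) *\<^sub>C (f z *\<^sub>C Rt t z (?S z)))"
    proof (rule sector_integral_cong)
      fix r \<theta> :: real assume r: "0 < r" "\<theta> \<in> {- \<nu>, \<nu>}"
      let ?z = "complex_of_real r * cis \<theta>"
      show "f ?z *\<^sub>C Rt t ?z x = f ?z *\<^sub>C R ?z x + of_real (t - 1) *\<^sub>C (f ?z *\<^sub>C Rt t ?z (?S ?z))"
        unfolding resolvent_perturb[OF t ray_mem(2)[OF r], of x] scaleC_of_real
        by (simp only: scaleC_add_right scaleC.scaleR_right)
    qed
    also have "\<dots> = sector_integral \<nu> (\<lambda>z. f z *\<^sub>C R z x) +
        of_real (t - 1) *\<^sub>C sector_integral \<nu> (\<lambda>z. f z *\<^sub>C Rt t z (?S z))"
      using V sector_integral_scaleC[of \<nu> "\<lambda>z. f z *\<^sub>C Rt t z (?S z)" "of_real (t - 1)"]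
        sector_integral_add[OF B_integrable[OF f]] by simp
    finally have "Bt t f x = B f x + (t - 1) *\<^sub>R (?c *\<^sub>C sector_integral \<nu> (\<lambda>z. f z *\<^sub>C Rt t z (?S z)))"
      unfolding S.B_def B_def scaleC_of_real by (simp only: scaleC_add_right scaleC.scaleR_right)
    then have eq: "Bt t f x - B f x = (t - 1) *\<^sub>R (?c *\<^sub>C sector_integral \<nu> (\<lambda>z. f z *\<^sub>C Rt t z (?S z)))"
      by simp
    have "norm (?c *\<^sub>C sector_integral \<nu> (\<lambda>z. f z *\<^sub>C Rt t z (?S z))) \<le> C * (M * ((M + 1) * norm x))"
      using V norm_B_factor order_trans by blast
    then have "\<bar>t - 1\<bar> * norm (?c *\<^sub>C sector_integral \<nu> (\<lambda>z. f z *\<^sub>C Rt t z (?S z))) \<le> \<bar>t - 1\<bar> * (C * (M * ((M + 1) * norm x)))"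
      by (rule mult_left_mono) simp
    then show "norm (Bt t f x - B f x) \<le> C * (M * ((M + 1) * norm x)) * \<bar>t - 1\<bar>"
      unfolding eq norm_scaleR by (simp only: mult.commute)
  qed
qed

lemma continuous_on_Bt:
  assumes f: "f \<in> Hinf0 \<phi>"
  shows "continuous_on {0<..} (\<lambda>t. Bt t f x)"
  unfolding continuous_on_def
proof
  fix t :: real assume "t \<in> {0<..}"
  then have t: "0 < t" by simp
  interpret S: sectorial_calculus D "\<lambda>y. t *\<^sub>R A y" \<mu> M \<nu> \<phi> by (rule scaled[OF t])
  obtain K where K: "\<And>\<tau>. 0 < \<tau> \<Longrightarrow> norm (S.Bt \<tau> f x - S.B f x) \<le> K * \<bar>\<tau> - 1\<bar>"
    using S.Bt_lipschitz[OF f] by blast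
  have "((\<lambda>s. Bt s f x - Bt t f x) \<longlongrightarrow> 0) (at t within {0<..})"
  proof (rule Lim_null_comparison)
    show "\<forall>\<^sub>F s in at t within {0<..}. norm (Bt s f x - Bt t f x) \<le> K * \<bar>s / t - 1\<bar>"
      using K[of "s / t" for s] t by (auto simp: eventually_at_filter)
    have "((\<lambda>s. K * \<bar>s / t - 1\<bar>) \<longlongrightarrow> K * \<bar>t / t - 1\<bar>) (at t within {0<..})"
      using t by (intro tendsto_intros) auto
    then show "((\<lambda>s. K * \<bar>s / t - 1\<bar>) \<longlongrightarrow> 0) (at t within {0<..})" using t by simp
  qed
  then show "((\<lambda>s. Bt s f x) \<longlongrightarrow> Bt t f x) (at t within {0<..})" by (rule LIM_zero_cancel)
qed

lemma continuous_on_Ut: "continuous_on {0<..} (\<lambda>t. Ut t x)"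
  using has_vector_derivative_continuous[OF Ut_has_vector_derivative]
  by (auto intro: continuous_at_imp_continuous_on)

text \<open>\<psi>(tA) for \<psi> = \<psi>0 + m z/(1+z), because tA (1 + tA)^-1 = 1 -
  \<open>Ut t\<close>.\<close>

definition psi_op :: "(complex \<Rightarrow> complex) \<Rightarrow> complex \<Rightarrow> real \<Rightarrow> 'a \<Rightarrow> 'a" where
  "psi_op \<psi>0 m t x = Bt t \<psi>0 x + m *\<^sub>C (x - Ut t x)"

lemma continuous_on_psi_op:
  assumes "\<psi>0 \<in> Hinf0 \<phi>"
  shows "continuous_on {0<..} (\<lambda>t. psi_op \<psi>0 m t x)"
  unfolding psi_op_def
  by (intro continuous_on_add scaleC.continuous_on continuous_on_diff continuous_on_const
      continuous_on_Bt continuous_on_Ut assms)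

lemma U_add: "U (x + y) = U x + U y" and U_diff: "U (x - y) = U x - U y"
  by (rule linear_add linear_diff, rule bounded_linear.linear[OF bounded_linear_U])+

lemma psi_op_add:
  assumes "\<psi>0 \<in> Hinf0 \<phi>" "0 < t"
  shows "psi_op \<psi>0 m t (x + y) = psi_op \<psi>0 m t x + psi_op \<psi>0 m t y"
proof -
  interpret S: sectorial_calculus D "\<lambda>y. t *\<^sub>R A y" \<mu> M \<nu> \<phi> by (rule scaled) fact
  show ?thesis
    by (simp add: psi_op_def S.B_add_right assms S.U_add scaleC_add_right scaleC.diff_right)
qed

lemma norm_psi_op:
  assumes "\<psi>0 \<in> Hinf0 \<phi>"
  obtains C where "0 \<le> C" "\<And>t x. 0 < t \<Longrightarrow> norm (psi_op \<psi>0 m t x) \<le> C * norm x"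
proof -
  obtain C where C: "0 \<le> C" "\<And>t x. 0 < t \<Longrightarrow> norm (Bt t \<psi>0 x) \<le> C * norm x"
    using norm_Bt[OF assms] by blast
  show thesis
  proof (rule that[of "C + cmod m * (1 + M)"])
    fix t :: real and x assume t: "0 < t"
    interpret S: sectorial_calculus D "\<lambda>y. t *\<^sub>R A y" \<mu> M \<nu> \<phi> by (rule scaled[OF t])
    have "norm (x - Ut t x) \<le> (1 + M) * norm x"
      using norm_triangle_ineq4[of x "Ut t x"] S.norm_U[of x] by (simp add: distrib_right)
    then have "norm (m *\<^sub>C (x - Ut t x)) \<le> cmod m * ((1 + M) * norm x)"
      unfolding norm_scaleC by (intro mult_left_mono) auto
    then show "norm (psi_op \<psi>0 m t x) \<le> (C + cmod m * (1 + M)) * norm x"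
      unfolding psi_op_def using norm_triangle_ineq[of "Bt t \<psi>0 x" "m *\<^sub>C (x - Ut t x)"] C(2)[OF t, of x]
      by (simp add: distrib_right mult.assoc)
  qed (use C M in simp)
qed

text \<open>With \<chi> the function in the second hypothesis, \<psi>0 = z \<chi> + k z/(1+z)^2, and
  each summand passes one factor tA on to b. The correction k/(1+z)^2, rather than k/(1+z), keeps z
  \<chi>(z) in \<open>Hinf0\<close>.\<close>

lemma norm_psi_op_domain:
  assumes \<psi>0: "\<psi>0 \<in> Hinf0 \<phi>" and \<chi>: "(\<lambda>z. \<psi>0 z / z - k / (1 + z)\<^sup>2) \<in> Hinf0 \<phi>"
  obtains C where "0 \<le> C" "\<And>t b. 0 < t \<Longrightarrow> b \<in> D \<Longrightarrow> norm (psi_op \<psi>0 m t b) \<le> C * t * norm (A b)"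
proof -
  let ?\<chi> = "\<lambda>z. \<psi>0 z / z - k / (1 + z)\<^sup>2" and ?e = "\<lambda>z::complex. z / (1 + z)\<^sup>2"
  obtain C where C: "0 \<le> C" "\<And>t x. 0 < t \<Longrightarrow> norm (Bt t ?\<chi> x) \<le> C * norm x"
    using norm_Bt[OF \<chi>] by blast
  have e: "?e \<in> Hinf0 \<phi>" by (rule Hinf0_Koebe[OF \<phi>_pos \<phi>])
  have z\<chi>: "(\<lambda>z. z * ?\<chi> z) \<in> Hinf0 \<phi>"
    by (rule Hinf0_cong[OF Hinf0_diff[OF \<psi>0 Hinf0_cmult[OF e, of k]]])
      (auto simp: sector_def right_diff_distrib)
  show thesis
  proof (rule that[of "C + cmod k * (M * M) + cmod m * M"])
    fix t :: real and b assume t: "0 < t" and b: "b \<in> D"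
    interpret S: sectorial_calculus D "\<lambda>y. t *\<^sub>R A y" \<mu> M \<nu> \<phi> by (rule scaled[OF t])
    let ?a = "t *\<^sub>R A b"
    have bU: "b - S.U b = S.U ?a" using S.A_U[of b] S.A_commutes_U[OF b] by simp
    have "Bt t \<psi>0 b = Bt t (\<lambda>z. z * ?\<chi> z + k * ?e z) b"
      by (rule S.B_cong) (auto simp: sector_def right_diff_distrib)
    also have "\<dots> = Bt t ?\<chi> ?a + k *\<^sub>C (S.U b - S.U (S.U b))"
      by (simp only: S.B_add[OF z\<chi> Hinf0_cmult[OF e]] S.B_cmult[OF e] S.B_Koebe S.B_A[OF \<chi> z\<chi> b])
    also have "S.U b - S.U (S.U b) = S.U (S.U ?a)" by (simp only: bU[symmetric] S.U_diff)
    finally have eq: "psi_op \<psi>0 m t b = Bt t ?\<chi> ?a + k *\<^sub>C S.U (S.U ?a) + m *\<^sub>C S.U ?a"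
      by (simp only: psi_op_def bU)
    have "norm (S.U (S.U ?a)) \<le> M * (M * norm ?a)"
      using S.norm_U[of "S.U ?a"] mult_left_mono[OF S.norm_U[of ?a], of M] M by linarith
    then have 1: "norm (k *\<^sub>C S.U (S.U ?a)) \<le> cmod k * (M * (M * norm ?a))"
      unfolding norm_scaleC by (rule mult_left_mono) simp
    have 2: "norm (m *\<^sub>C S.U ?a) \<le> cmod m * (M * norm ?a)"
      unfolding norm_scaleC using S.norm_U[of ?a] by (rule mult_left_mono) simp
    have "norm (psi_op \<psi>0 m t b) \<le> norm (Bt t ?\<chi> ?a) + norm (k *\<^sub>C S.U (S.U ?a)) + norm (m *\<^sub>C S.U ?a)"
      unfolding eq by (intro order_trans[OF norm_triangle_ineq] add_mono norm_triangle_ineq order_refl)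
    also have "\<dots> \<le> (C + cmod k * (M * M) + cmod m * M) * norm ?a"
      using C(2)[OF t, of ?a] 1 2 by (simp only: distrib_right mult.assoc)
    finally show "norm (psi_op \<psi>0 m t b) \<le> (C + cmod k * (M * M) + cmod m * M) * t * norm (A b)"
      using t by (simp add: mult.assoc)
  qed (use C M in simp)
qed

lemma U_funpow_linear: "(U ^^ n) (x + y) = (U ^^ n) x + (U ^^ n) y"
  "(U ^^ n) (x - y) = (U ^^ n) x - (U ^^ n) y"
  "(U ^^ n) (c *\<^sub>C x) = c *\<^sub>C (U ^^ n) x"
  by (induction n) (simp_all add: U_add U_diff U_scaleC)

lemma norm_U_funpow: "norm ((U ^^ n) x) \<le> M ^ n * norm x"
proof (induction n)
  case (Suc n)
  then have "M * norm ((U ^^ n) x) \<le> M * (M ^ n * norm x)" using M by (intro mult_left_mono) auto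
  then show ?case using norm_U[of "(U ^^ n) x"] by simp
qed simp

text \<open>Commutation across different scalings: \<open>U\<close> belongs to the unscaled
  operator. It allows the fixed operator \<open>U\<close> to be applied inside a limit in t.\<close>

lemma Rt_U_commute: "0 < t \<Longrightarrow> z \<in> cosector \<mu> \<Longrightarrow> Rt t z (U x) = U (Rt t z x)"
proof -
  assume t: "0 < t" and z: "z \<in> cosector \<mu>"
  then have z': "inverse t *\<^sub>R z \<in> cosector \<mu>" by (intro scaleR_mem_cosector) auto
  show ?thesis
  proof -
    let ?y = "inverse t *\<^sub>R x"
    have "inverse t *\<^sub>R U x = U ?y"
      by (rule linear_scale[OF bounded_linear.linear[OF bounded_linear_U], symmetric])
    moreover have "R (inverse t *\<^sub>R z) (U ?y) = U (R (inverse t *\<^sub>R z) ?y)"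
      using R_scaleC[OF z', of "-1" "R (-1) ?y"] R_commute[OF z' minus_one_mem_cosector, of ?y] by (simp add: U_eq)
    ultimately show ?thesis unfolding resolvent_scaleR[OF t] by (simp only:)
  qed
qed

lemma Bt_U_commute:
  assumes f: "f \<in> Hinf0 \<phi>" and t: "0 < t"
  shows "U (Bt t f x) = Bt t f (U x)"
proof -
  interpret S: sectorial_calculus D "\<lambda>y. t *\<^sub>R A y" \<mu> M \<nu> \<phi> by (rule scaled[OF t])
  have "sector_integral \<nu> (\<lambda>z. f z *\<^sub>C Rt t z (U x)) = sector_integral \<nu> (\<lambda>z. U (f z *\<^sub>C Rt t z x))"
    by (rule sector_integral_cong) (simp only: Rt_U_commute[OF t ray_mem(2)] U_scaleC)
  also have "\<dots> = U (sector_integral \<nu> (\<lambda>z. f z *\<^sub>C Rt t z x))"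
    by (rule sector_integral_linear(1)[OF bounded_linear_U U_scaleC S.B_integrable[OF f]])
  finally show ?thesis unfolding S.B_def by (simp only: U_scaleC)
qed

lemma Ut_U_commute: "0 < t \<Longrightarrow> U (Ut t x) = Ut t (U x)"
proof -
  assume t: "0 < t"
  interpret S: sectorial_calculus D "\<lambda>y. t *\<^sub>R A y" \<mu> M \<nu> \<phi> by (rule scaled[OF t])
  show ?thesis
    unfolding S.U_eq Rt_U_commute[OF t minus_one_mem_cosector]
    by (rule linear_neg[OF bounded_linear.linear[OF bounded_linear_U]])
qed

lemma Ut_tendsto:
  assumes b: "b \<in> D" shows "((\<lambda>t. Ut t b) \<longlongrightarrow> b) (at_right 0)"
proof -
  have "((\<lambda>t. Ut t b - b) \<longlongrightarrow> 0) (at_right 0)"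
  proof (rule Lim_null_comparison)
    have "norm (Ut t b - b) \<le> M * norm (A b) * t" if t: "0 < t" for t
    proof -
      interpret S: sectorial_calculus D "\<lambda>y. t *\<^sub>R A y" \<mu> M \<nu> \<phi> by (rule scaled[OF t])
      have "b - S.U b = S.U (t *\<^sub>R A b)" using S.A_U[of b] S.A_commutes_U[OF b] by simp
      then show ?thesis
        using S.norm_U[of "t *\<^sub>R A b"] t by (simp add: norm_minus_commute mult_ac)
    qed
    then show "\<forall>\<^sub>F t in at_right 0. norm (Ut t b - b) \<le> M * norm (A b) * t"
      by (auto simp: eventually_at_filter)
    have "((\<lambda>t. M * norm (A b) * t) \<longlongrightarrow> M * norm (A b) * 0) (at_right 0)" by (intro tendsto_intros)
    then show "((\<lambda>t. M * norm (A b) * t) \<longlongrightarrow> 0) (at_right 0)" by simp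
  qed
  then show ?thesis by (rule LIM_zero_cancel)
qed

text \<open>\<open>reproducing h c t\<close> is \<open>h(tA)\<close> for a function \<open>h\<close> with limit \<open>c\<close> at \<open>0\<close> and \<open>0\<close> at infinity.\<close>

definition reproducing :: "(complex \<Rightarrow> complex) \<Rightarrow> complex \<Rightarrow> real \<Rightarrow> 'a \<Rightarrow> 'a" where
  "reproducing h c t x = Bt t (\<lambda>z. h z - c * (1 / (1 + z))) x + c *\<^sub>C Ut t x"

context
  fixes \<psi>0 :: "complex \<Rightarrow> complex" and m :: complex
  assumes \<psi>0: "\<psi>0 \<in> Hinf0 \<phi>"
begin

abbreviation (input) "u \<equiv> \<lambda>z::complex. 1 / (1 + z)"
abbreviation (input) "e \<equiv> \<lambda>z::complex. z / (1 + z)\<^sup>2"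
abbreviation (input) "g \<equiv> \<lambda>k z. (\<psi>0 z + m * (z / (1 + z))) * (1 / (1 + z)) ^ k"

lemma e_Hinf0: "e \<in> Hinf0 \<phi>" by (rule Hinf0_Koebe[OF \<phi>_pos \<phi>])

text \<open>\<open>g k\<close> is \<psi>(z) (1+z)^-k. One of the k factors turns m z/(1+z), which
  need not vanish at infinity, into m z/(1+z)^2; hence the condition k \<ge> 1.\<close>

lemma g_split: "1 \<le> k \<Longrightarrow> z \<in> sector \<phi> \<Longrightarrow> \<psi>0 z * u z ^ k + m * (e z * u z ^ (k - 1)) = g k z"
proof -
  assume "1 \<le> k" "z \<in> sector \<phi>"
  then obtain j where k: "k = Suc j" by (cases k) auto
  have e: "e z = (z / (1 + z)) * u z" by (simp add: power2_eq_square)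
  have "\<psi>0 z * v ^ Suc j + m * ((a * v) * v ^ j) = (\<psi>0 z + m * a) * v ^ Suc j" for a v
    by (simp add: algebra_simps)
  then show ?thesis by (simp only: k e diff_Suc_1)
qed

lemma u_power_Hinf: "(\<lambda>z. u z ^ k) \<in> Hinf \<phi>"
  by (intro Hinf_power Hinf_one_plus \<phi>_pos \<phi>)

lemma g_Hinf0: "1 \<le> k \<Longrightarrow> g k \<in> Hinf0 \<phi>"
  by (rule Hinf0_cong[OF Hinf0_add[OF Hinf0_mult_Hinf[OF \<psi>0 u_power_Hinf[of k]]
        Hinf0_cmult[OF Hinf0_mult_Hinf[OF e_Hinf0 u_power_Hinf[of "k - 1"]], of m]] g_split])

text \<open>The part with m is evaluated by \<open>B_Koebe\<close>: U - U^2 followed by k - 1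
  further factors \<open>U\<close> is U^k applied to x - U x, so that the two parts recombine to
  \<open>psi_op\<close>.\<close>

lemma Bt_g:
  assumes k: "1 \<le> k" and t: "0 < t"
  shows "Bt t (g k) x = (Ut t ^^ k) (psi_op \<psi>0 m t x)"
proof -
  interpret S: sectorial_calculus D "\<lambda>y. t *\<^sub>R A y" \<mu> M \<nu> \<phi> by (rule scaled[OF t])
  have "Bt t (g k) x = Bt t (\<lambda>z. \<psi>0 z * u z ^ k + m * (e z * u z ^ (k - 1))) x"
    by (rule S.B_cong) (rule g_split[OF k, symmetric])
  also have "\<dots> = Bt t (\<lambda>z. \<psi>0 z * u z ^ k) x + m *\<^sub>C Bt t (\<lambda>z. e z * u z ^ (k - 1)) x"
    by (simp only: S.B_add[OF Hinf0_mult_Hinf[OF \<psi>0 u_power_Hinf] Hinf0_cmult[OF Hinf0_mult_Hinf[OF e_Hinf0 u_power_Hinf]]]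
        S.B_cmult[OF Hinf0_mult_Hinf[OF e_Hinf0 u_power_Hinf]])
  also have "\<dots> = (S.U ^^ k) (Bt t \<psi>0 x) + m *\<^sub>C (S.U ^^ (k - 1)) (S.U (x - S.U x))"
    by (simp only: S.B_mult_U_power[OF \<psi>0] S.B_mult_U_power[OF e_Hinf0] S.B_Koebe S.U_diff)
  also have "(S.U ^^ (k - 1)) (S.U (x - S.U x)) = (S.U ^^ k) (x - S.U x)"
    using k by (cases k) (auto simp: funpow_swap1)
  finally show ?thesis by (simp only: psi_op_def S.U_funpow_linear)
qed

text \<open>Multiplication by z lowers the exponent by one. \<open>g_Hinf0\<close> then needs n - 1
  \<ge> 1, which is where n \<ge> 2 enters.\<close>

lemma zg_eq: "2 \<le> n \<Longrightarrow> z \<in> sector \<phi> \<Longrightarrow> g (n - 1) z - g n z = z * g n z"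
proof -
  assume n: "2 \<le> n" and "z \<in> sector \<phi>"
  then have "1 + z \<noteq> 0" using one_plus_nonzero \<phi> by simp
  then have "u z ^ (n - 1) = (1 + z) * u z ^ n"
    using n by (cases n) auto
  then show ?thesis by (simp only:) (simp add: algebra_simps)
qed

lemma zg_Hinf0: "2 \<le> n \<Longrightarrow> (\<lambda>z. z * g n z) \<in> Hinf0 \<phi>"
  by (rule Hinf0_cong[OF Hinf0_diff[OF g_Hinf0 g_Hinf0] zg_eq]) auto

lemma Bt_zg:
  assumes n: "2 \<le> n" and t: "0 < t"
  shows "Bt t (\<lambda>z. z * g n z) x = (Ut t ^^ (n - 1)) (psi_op \<psi>0 m t x) - (Ut t ^^ n) (psi_op \<psi>0 m t x)"
proof -
  interpret S: sectorial_calculus D "\<lambda>y. t *\<^sub>R A y" \<mu> M \<nu> \<phi> by (rule scaled[OF t])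
  have n1: "1 \<le> n - 1" "1 \<le> n" using n by auto
  have "Bt t (\<lambda>z. z * g n z) x = Bt t (\<lambda>z. g (n - 1) z - g n z) x"
    by (rule S.B_cong) (rule zg_eq[OF n, symmetric])
  also have "\<dots> = Bt t (g (n - 1)) x - Bt t (g n) x"
    by (rule S.B_diff[OF g_Hinf0[OF n1(1)] g_Hinf0[OF n1(2)]])
  finally show ?thesis by (simp only: Bt_g[OF n1(1) t] Bt_g[OF n1(2) t])
qed

context
  fixes h :: "complex \<Rightarrow> complex" and c :: complex and n :: nat
  assumes n: "2 \<le> n"
    and h': "\<And>z. z \<in> sector \<phi> \<Longrightarrow>
      (h has_field_derivative (- ((\<psi>0 z + m * (z / (1 + z))) * (1 / (1 + z)) ^ n) / z)) (at z)"
    and zh: "(\<lambda>z. z * h z) \<in> Hinf0 \<phi>" and hc: "(\<lambda>z. h z - c * (1 / (1 + z))) \<in> Hinf0 \<phi>"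
begin

text \<open>For f = h - c/(1+z) one has z f'(z) = c z/(1+z)^2 - g(z), where g is \<open>g n\<close>.
  The first term is cancelled by the derivative of c times \<open>Ut t\<close>, and
  \<open>Bt_g\<close> evaluates the second.\<close>

lemma reproducing_derivative:
  assumes t: "0 < t"
  shows "((\<lambda>t. reproducing h c t x) has_vector_derivative - ((1 / t) *\<^sub>R (Ut t ^^ n) (psi_op \<psi>0 m t x))) (at t)"
proof -
  interpret S: sectorial_calculus D "\<lambda>y. t *\<^sub>R A y" \<mu> M \<nu> \<phi> by (rule scaled[OF t])
  have n1: "1 \<le> n" using n by auto
  let ?f = "\<lambda>z. h z - c * u z"
  let ?f' = "\<lambda>z. - g n z / z + c * (u z)\<^sup>2"
  have eq: "c * e z - g n z = z * ?f' z" if "z \<in> sector \<phi>" for z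
  proof -
    have "z \<noteq> 0" using that by (simp add: sector_def)
    then have "z * (- p / z + q) = z * q - p" for p q
      by (simp add: right_diff_distrib)
    then show ?thesis by (simp only:) (simp add: power_divide)
  qed
  have zf': "(\<lambda>z. z * ?f' z) \<in> Hinf0 \<phi>"
    by (rule Hinf0_cong[OF Hinf0_diff[OF Hinf0_cmult[OF e_Hinf0, of c] g_Hinf0[OF n1]] eq])
  have f': "(?f has_field_derivative ?f' z) (at z)" if z: "z \<in> sector \<phi>" for z
  proof -
    have "1 + z \<noteq> 0" using z one_plus_nonzero \<phi> by simp
    then have "((\<lambda>z. c * u z) has_field_derivative - (c * (u z)\<^sup>2)) (at z)"
      by (auto intro!: derivative_eq_intros simp: power2_eq_square divide_inverse)
    from DERIV_diff[OF h'[OF z] this] show ?thesis by simp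
  qed
  have "Bt t (\<lambda>z. z * ?f' z) x = Bt t (\<lambda>z. c * e z - g n z) x"
    by (rule S.B_cong) (rule eq[symmetric])
  also have "\<dots> = c *\<^sub>C (S.U x - S.U (S.U x)) - (S.U ^^ n) (psi_op \<psi>0 m t x)"
    by (simp only: S.B_diff[OF Hinf0_cmult[OF e_Hinf0] g_Hinf0[OF n1]] S.B_cmult[OF e_Hinf0] S.B_Koebe Bt_g[OF n1 t])
  finally have "((\<lambda>t. Bt t ?f x) has_vector_derivative (1 / t) *\<^sub>R
      (c *\<^sub>C (S.U x - S.U (S.U x)) - (S.U ^^ n) (psi_op \<psi>0 m t x))) (at t)"
    using Bt_has_vector_derivative[OF hc f' zf' t, of x] by (simp only:)
  moreover have "((\<lambda>t. c *\<^sub>C Ut t x) has_vector_derivative c *\<^sub>C ((1 / t) *\<^sub>R (S.U (S.U x) - S.U x))) (at t)"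
    by (rule bounded_linear.has_vector_derivative[OF scaleC.bounded_linear_right Ut_has_vector_derivative[OF t]])
  ultimately have "((\<lambda>t. reproducing h c t x) has_vector_derivative (1 / t) *\<^sub>R
      (c *\<^sub>C (S.U x - S.U (S.U x)) - (S.U ^^ n) (psi_op \<psi>0 m t x)) + c *\<^sub>C ((1 / t) *\<^sub>R (S.U (S.U x) - S.U x))) (at t)"
    unfolding reproducing_def by (rule has_vector_derivative_add)
  moreover have "(1 / t) *\<^sub>R (c *\<^sub>C (p - q) - r) + c *\<^sub>C ((1 / t) *\<^sub>R (q - p)) = - ((1 / t) *\<^sub>R r)" for p q r :: 'a
  proof -
    have "c *\<^sub>C ((1 / t) *\<^sub>R (q - p)) = - ((1 / t) *\<^sub>R (c *\<^sub>C (p - q)))"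
      by (simp only: scaleC.scaleR_right) (simp add: scaleC.diff_right scaleR_right_diff_distrib)
    then show ?thesis by (simp only: scaleR_right_diff_distrib) simp
  qed
  ultimately show ?thesis by (simp only:)
qed

text \<open>The remainder h - c/(1+z) decays too slowly at infinity to be multiplied by z when c is
  nonzero. Adding c z/(1+z)^2 replaces c/(1+z) by c/(1+z)^2, and z/(1+z)^2 does lie in
  \<open>Hinf0\<close>. The compensating term is c times the square of \<open>Ut t\<close>.\<close>

lemma reproducing_domain:
  assumes t: "0 < t"
  shows reproducing_mem: "reproducing h c t x \<in> D"
    and A_reproducing: "A (reproducing h c t x) = (1 / t) *\<^sub>R Bt t (\<lambda>z. z * h z) x"
proof -
  interpret S: sectorial_calculus D "\<lambda>y. t *\<^sub>R A y" \<mu> M \<nu> \<phi> by (rule scaled[OF t])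
  let ?f = "\<lambda>z. (h z - c * u z) + c * e z"
  have f: "?f \<in> Hinf0 \<phi>" by (rule Hinf0_add[OF hc Hinf0_cmult[OF e_Hinf0]])
  have eq: "z * h z - c * e z = z * ?f z" if "z \<in> sector \<phi>" for z
  proof -
    have "1 + z \<noteq> 0" using that one_plus_nonzero \<phi> by simp
    then have "z * u z = z * (1 + z) / (1 + z)\<^sup>2" by (simp add: power2_eq_square)
    then have "z * e z = z * u z - e z"
      by (simp only: diff_divide_distrib[symmetric]) (simp add: distrib_left)
    then have "z * (c * e z) = c * (z * u z - e z)" by (metis mult.left_commute)
    then show ?thesis by (simp add: algebra_simps)
  qed
  have zf: "(\<lambda>z. z * ?f z) \<in> Hinf0 \<phi>"
    by (rule Hinf0_cong[OF Hinf0_diff[OF zh Hinf0_cmult[OF e_Hinf0, of c]] eq])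
  have W: "reproducing h c t x = Bt t ?f x + c *\<^sub>C S.U (S.U x)"
    by (simp only: reproducing_def S.B_add[OF hc Hinf0_cmult[OF e_Hinf0]] S.B_cmult[OF e_Hinf0] S.B_Koebe)
      (simp add: scaleC.diff_right)
  have Bzf: "Bt t (\<lambda>z. z * ?f z) x = Bt t (\<lambda>z. z * h z) x - c *\<^sub>C (S.U x - S.U (S.U x))"
  proof -
    have "Bt t (\<lambda>z. z * ?f z) x = Bt t (\<lambda>z. z * h z - c * e z) x"
      by (rule S.B_cong) (rule eq[symmetric])
    then show ?thesis
      by (simp only: S.B_diff[OF zh Hinf0_cmult[OF e_Hinf0]] S.B_cmult[OF e_Hinf0] S.B_Koebe)
  qed
  note m = S.B_mem[OF f zf, of x] S.D_scaleC[OF S.U_mem, of c "S.U x"]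
  show "reproducing h c t x \<in> D" unfolding W by (rule S.D_add[OF m])
  have "t *\<^sub>R A (reproducing h c t x) = Bt t (\<lambda>z. z * h z) x"
    unfolding W S.A_add[OF m] S.A_B[OF f zf] S.A_scaleC[OF S.U_mem] S.A_U Bzf by simp
  then have "(1 / t) *\<^sub>R t *\<^sub>R A (reproducing h c t x) = (1 / t) *\<^sub>R Bt t (\<lambda>z. z * h z) x" by (simp only:)
  then show "A (reproducing h c t x) = (1 / t) *\<^sub>R Bt t (\<lambda>z. z * h z) x" using t by simp
qed

text \<open>With g for \<open>g n\<close>, the product rule gives z (z h)' = z h - z g.
  Differentiating the prefactor 1/t contributes -z h, so only z g survives.\<close>

lemma A_reproducing_derivative:
  assumes t: "0 < t"
  shows "((\<lambda>t. (1 / t) *\<^sub>R Bt t (\<lambda>z. z * h z) x) has_vector_derivative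
    - ((1 / t\<^sup>2) *\<^sub>R Bt t (\<lambda>z. z * g n z) x)) (at t)"
proof -
  interpret S: sectorial_calculus D "\<lambda>y. t *\<^sub>R A y" \<mu> M \<nu> \<phi> by (rule scaled[OF t])
  let ?k' = "\<lambda>z. h z - g n z"
  have k': "((\<lambda>z. z * h z) has_field_derivative ?k' z) (at z)" if z: "z \<in> sector \<phi>" for z
  proof -
    have "z \<noteq> 0" using z by (simp add: sector_def)
    then show ?thesis
      using DERIV_mult[OF DERIV_ident h'[OF z]] by simp
  qed
  have eq: "z * h z - z * g n z = z * ?k' z" for z by (simp only: right_diff_distrib)
  have zk': "(\<lambda>z. z * ?k' z) \<in> Hinf0 \<phi>"
    unfolding eq[symmetric] by (rule Hinf0_diff[OF zh zg_Hinf0[OF n]])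
  have "Bt t (\<lambda>z. z * ?k' z) x = Bt t (\<lambda>z. z * h z) x - Bt t (\<lambda>z. z * g n z) x"
    unfolding eq[symmetric] by (rule S.B_diff[OF zh zg_Hinf0[OF n]])
  then have d: "((\<lambda>t. Bt t (\<lambda>z. z * h z) x) has_vector_derivative
      (1 / t) *\<^sub>R (Bt t (\<lambda>z. z * h z) x - Bt t (\<lambda>z. z * g n z) x)) (at t)"
    using Bt_has_vector_derivative[OF zh k' zk' t, of x] by (simp only:)
  have i: "((\<lambda>t. 1 / t) has_real_derivative - (1 / t\<^sup>2)) (at t)"
    using t by (auto intro!: derivative_eq_intros simp: power2_eq_square divide_inverse)
  from has_vector_derivative_scaleR[OF i d]
  have "((\<lambda>t. (1 / t) *\<^sub>R Bt t (\<lambda>z. z * h z) x) has_vector_derivative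
    (1 / t) *\<^sub>R (1 / t) *\<^sub>R (Bt t (\<lambda>z. z * h z) x - Bt t (\<lambda>z. z * g n z) x)
      + (- (1 / t\<^sup>2)) *\<^sub>R Bt t (\<lambda>z. z * h z) x) (at t)" .
  moreover have "(1 / t) *\<^sub>R (1 / t) *\<^sub>R (p - q) + (- (1 / t\<^sup>2)) *\<^sub>R p = - ((1 / t\<^sup>2) *\<^sub>R q)" for p q :: 'a
    by (simp add: scaleR_right_diff_distrib power2_eq_square)
  ultimately show ?thesis by (simp only:)
qed

lemma reproducing_tendsto:
  assumes b: "b \<in> D"
  shows "((\<lambda>t. reproducing h c t b) \<longlongrightarrow> c *\<^sub>C b) (at_right 0)"
proof -
  have "((\<lambda>t. reproducing h c t b) \<longlongrightarrow> 0 + c *\<^sub>C b) (at_right 0)"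
    unfolding reproducing_def
    by (intro tendsto_add scaleC.tendsto tendsto_const Bt_tendsto_0[OF hc b] Ut_tendsto[OF b])
  then show ?thesis by simp
qed

lemma reproducing_U_commute: "0 < t \<Longrightarrow> U (reproducing h c t x) = reproducing h c t (U x)"
  unfolding reproducing_def by (simp only: U_add Bt_U_commute[OF hc] U_scaleC Ut_U_commute)

lemma reproducing_near:
  assumes t: "0 < t" and int: "(\<lambda>s. norm (psi_op \<psi>0 m s x) / s) integrable_on {0..t}"
  shows "norm (c *\<^sub>C x - reproducing h c t x) \<le> M ^ n * integral {0..t} (\<lambda>s. norm (psi_op \<psi>0 m s x) / s)"
proof -
  let ?F = "\<lambda>s. norm (psi_op \<psi>0 m s x) / s"
  let ?W = "\<lambda>s. reproducing h c s x"
  let ?I = "\<lambda>s. integral {0..s} ?F"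
  have Ic: "continuous_on {0..t} ?I" by (rule indefinite_integral_continuous_1[OF int])
  have Fc: "continuous_on {0<..} ?F"
    by (intro continuous_on_divide continuous_on_norm continuous_on_psi_op \<psi>0 continuous_on_id) auto
  have Id: "(?I has_vector_derivative ?F s) (at s)" if s: "0 < s" "s < t" for s
  proof -
    have "continuous (at s within {0..t}) ?F"
      using Fc s continuous_on_eq_continuous_at[of "{0<..}" ?F] by (auto intro: continuous_at_imp_continuous_at_within)
    then have "(?I has_vector_derivative ?F s) (at s within {0..t})"
      using integral_has_vector_derivative_continuous_at[OF int, of s "{}"] s by simp
    then show ?thesis using s by (simp add: at_within_Icc_at)
  qed
  \<comment> \<open>The mean value inequality against the scalar primitive \<open>?I\<close>; the
    factor M^n bounds the n powers of \<open>Ut s\<close>.\<close>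
  have est: "norm (?W b - ?W a) \<le> M ^ n * ?I b - M ^ n * ?I a" if ab: "0 < a" "a \<le> b" "b \<le> t" for a b
  proof (cases "a = b")
    case False
    then have "a < b" using ab by simp
    show ?thesis
    proof (rule differentiable_bound_general[OF \<open>a < b\<close>, where
          f' = "\<lambda>s. - ((1 / s) *\<^sub>R (Ut s ^^ n) (psi_op \<psi>0 m s x))" and \<phi>' = "\<lambda>s. M ^ n * ?F s"])
      show "continuous_on {a..b} ?W"
        using has_vector_derivative_continuous[OF reproducing_derivative] ab
        by (auto intro!: continuous_at_imp_continuous_on)
      show "continuous_on {a..b} (\<lambda>s. M ^ n * ?I s)"
        by (intro continuous_on_mult_left continuous_on_subset[OF Ic]) (use ab in auto)
      fix s assume s: "a < s" "s < b"
      then have s0: "0 < s" using ab by simp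
      show "(?W has_vector_derivative - ((1 / s) *\<^sub>R (Ut s ^^ n) (psi_op \<psi>0 m s x))) (at s)"
        by (rule reproducing_derivative[OF s0])
      show "((\<lambda>s. M ^ n * ?I s) has_vector_derivative M ^ n * ?F s) (at s)"
        using has_vector_derivative_mult_right[OF Id[OF s0]] s ab by simp
      interpret S: sectorial_calculus D "\<lambda>y. s *\<^sub>R A y" \<mu> M \<nu> \<phi> by (rule scaled[OF s0])
      show "norm (- ((1 / s) *\<^sub>R (Ut s ^^ n) (psi_op \<psi>0 m s x))) \<le> M ^ n * ?F s"
        using S.norm_U_funpow[of n "psi_op \<psi>0 m s x"] s0 by (simp add: divide_right_mono)
    qed
  qed simp
  have I0: "0 \<le> ?I s" if "s \<le> t" for s
    by (rule Henstock_Kurzweil_Integration.integral_nonneg[OF integrable_on_subinterval[OF int]]) (use that in auto)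
  \<comment> \<open>The limit s \<rightarrow> 0 becomes a \<rightarrow> \<infinity> for s = 1/a,
    capped at t so that every point stays in (0,t].\<close>
  let ?q = "\<lambda>a. min t (inverse a)"
  have q: "0 < ?q a" "?q a \<le> t" if "0 < a" for a using t that by auto
  have "\<exists>L. \<forall>a>0. norm (?W (?q a) - L) \<le> M ^ n * ?I (?q a)"
  proof (rule convergent_with_rate)
    fix a b :: real assume ab: "0 < a" "a \<le> b"
    have "norm (?W (?q a) - ?W (?q b)) \<le> M ^ n * ?I (?q a) - M ^ n * ?I (?q b)"
      using ab q by (intro est) (auto simp: min_le_iff_disj)
    moreover have "0 \<le> M ^ n * ?I (?q b)" using M I0 by (intro mult_nonneg_nonneg) auto
    ultimately show "norm (?W (?q b) - ?W (?q a)) \<le> M ^ n * ?I (?q a)"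
      using norm_minus_commute[of "?W (?q b)"] by simp
  next
    have "(?I \<longlongrightarrow> ?I 0) (at 0 within {0..t})" 
      by (rule bspec[OF Ic[unfolded continuous_on_def]]) (use t in simp)
    moreover have "filterlim ?q (at 0 within {0..t}) at_top"
      unfolding filterlim_at
    proof (intro conjI)
      have "((\<lambda>a. min t (inverse a)) \<longlongrightarrow> min t 0) at_top"
        by (intro tendsto_min tendsto_const tendsto_inverse_0_at_top filterlim_ident)
      then show "(?q \<longlongrightarrow> 0) at_top" using t by simp
      show "\<forall>\<^sub>F a in at_top. ?q a \<in> {0..t} \<and> ?q a \<noteq> 0"
        using eventually_gt_at_top[of 0]
      proof eventually_elim
        case (elim a)
        show ?case using q[OF elim] unfolding atLeastAtMost_iff by linarith
      qed
    qed
    ultimately have "((\<lambda>a. ?I (?q a)) \<longlongrightarrow> ?I 0) at_top" by (rule filterlim_compose)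
    from tendsto_mult[OF tendsto_const[of "M ^ n"] this]
    show "((\<lambda>a. M ^ n * ?I (?q a)) \<longlongrightarrow> 0) at_top" by simp
  qed
  then obtain L where L: "\<And>a. 0 < a \<Longrightarrow> norm (?W (?q a) - L) \<le> M ^ n * ?I (?q a)" by blast
  have L': "norm (?W s - L) \<le> M ^ n * ?I s" if "0 < s" "s \<le> t" for s
    using L[of "inverse s"] that by (simp add: min_absorb2)
  have "(?W \<longlongrightarrow> L) (at_right 0)"
  proof (rule LIM_zero_cancel, rule Lim_null_comparison)
    show "\<forall>\<^sub>F s in at_right 0. norm (?W s - L) \<le> M ^ n * ?I s"
      using eventually_at_right_less[of 0] eventually_at_right_real[OF t]
      by eventually_elim (auto intro: L')
    have "(?I \<longlongrightarrow> ?I 0) (at 0 within {0..t})" 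
      by (rule bspec[OF Ic[unfolded continuous_on_def]]) (use t in simp)
    then have "(?I \<longlongrightarrow> ?I 0) (at_right 0)"
      using t by (simp add: at_within_Icc_at_right)
    from tendsto_mult[OF tendsto_const[of "M ^ n"] this]
    show "((\<lambda>s. M ^ n * ?I s) \<longlongrightarrow> 0) (at_right 0)" by simp
  qed
  then have "((\<lambda>s. U (?W s)) \<longlongrightarrow> U L) (at_right 0)"
    by (rule bounded_linear.tendsto[OF bounded_linear_U])
  moreover have "\<forall>\<^sub>F s in at_right 0. U (?W s) = reproducing h c s (U x)"
    using eventually_at_right_less[of 0] by eventually_elim (rule reproducing_U_commute)
  ultimately have "((\<lambda>s. reproducing h c s (U x)) \<longlongrightarrow> U L) (at_right 0)"
    by (rule Lim_transform_eventually)
  then have "U L = c *\<^sub>C U x"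
    by (rule tendsto_unique[OF trivial_limit_at_right_real _ reproducing_tendsto[OF U_mem]])
  then have "U L = U (c *\<^sub>C x)" by (simp only: U_scaleC)
  then have "L = c *\<^sub>C x" by (rule U_inject)
  then show ?thesis using L'[OF t order_refl] by (simp add: norm_minus_commute)
qed

text \<open>The factor 2 comes from the two terms of \<open>Bt_zg\<close>, each at most M^n
  |\<psi>(sA)x|. At the far end T the quantity A h(TA)x is O(1/T), since z h(z) lies in
  \<open>Hinf0\<close>.\<close>

lemma A_reproducing_bound:
  assumes t: "0 < t" and int: "(\<lambda>s. norm (psi_op \<psi>0 m s x) / s\<^sup>2) integrable_on {t..}"
  shows "norm (A (reproducing h c t x)) \<le> 2 * M ^ n * integral {t..} (\<lambda>s. norm (psi_op \<psi>0 m s x) / s\<^sup>2)"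
proof -
  let ?F = "\<lambda>s. norm (psi_op \<psi>0 m s x) / s\<^sup>2"
  let ?Y = "\<lambda>t. (1 / t) *\<^sub>R Bt t (\<lambda>z. z * h z) x"
  obtain C where C: "0 \<le> C" "\<And>t x. 0 < t \<Longrightarrow> norm (Bt t (\<lambda>z. z * h z) x) \<le> C * norm x"
    using norm_Bt[OF zh] by blast
  have Fc: "continuous_on {0<..} ?F"
    by (intro continuous_on_divide continuous_on_norm continuous_on_psi_op \<psi>0 continuous_on_power continuous_on_id) auto
  have est: "norm (?Y T - ?Y t) \<le> 2 * M ^ n * integral {t..} ?F" if T: "t < T" for T
  proof -
    let ?I = "\<lambda>s. integral {t..s} ?F"
    have cF: "continuous_on {t..T} ?F" by (rule continuous_on_subset[OF Fc]) (use t in auto)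
    have "norm (?Y T - ?Y t) \<le> 2 * M ^ n * ?I T - 2 * M ^ n * ?I t"
    proof (rule differentiable_bound_general[OF T, where
          f' = "\<lambda>s. - ((1 / s\<^sup>2) *\<^sub>R Bt s (\<lambda>z. z * g n z) x)" and \<phi>' = "\<lambda>s. 2 * M ^ n * ?F s"])
      show "continuous_on {t..T} ?Y"
        using has_vector_derivative_continuous[OF A_reproducing_derivative] t
        by (auto intro!: continuous_at_imp_continuous_on)
      show "continuous_on {t..T} (\<lambda>s. 2 * M ^ n * ?I s)"
        by (intro continuous_on_mult_left indefinite_integral_continuous_1 integrable_continuous_real cF)
      fix s assume s: "t < s" "s < T"
      then have s0: "0 < s" using t by simp
      show "(?Y has_vector_derivative - ((1 / s\<^sup>2) *\<^sub>R Bt s (\<lambda>z. z * g n z) x)) (at s)"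
        by (rule A_reproducing_derivative[OF s0])
      have "(?I has_vector_derivative ?F s) (at s within {t..T})"
        by (rule integral_has_vector_derivative[OF cF]) (use s in auto)
      then have "(?I has_vector_derivative ?F s) (at s)" using s by (simp add: at_within_Icc_at)
      from has_vector_derivative_mult_right[OF this, of "2 * M ^ n"]
      show "((\<lambda>s. 2 * M ^ n * ?I s) has_vector_derivative 2 * M ^ n * ?F s) (at s)" .
      interpret S: sectorial_calculus D "\<lambda>y. s *\<^sub>R A y" \<mu> M \<nu> \<phi> by (rule scaled[OF s0])
      let ?p = "psi_op \<psi>0 m s x"
      have "M ^ (n - 1) \<le> M ^ n" using M by (intro power_increasing) auto
      then have "M ^ (n - 1) * norm ?p \<le> M ^ n * norm ?p" by (rule mult_right_mono) simp
      then have "norm (Bt s (\<lambda>z. z * g n z) x) \<le> 2 * M ^ n * norm ?p"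
        unfolding Bt_zg[OF n s0]
        using norm_triangle_ineq4[of "(S.U ^^ (n - 1)) ?p" "(S.U ^^ n) ?p"]
          S.norm_U_funpow[of "n - 1" ?p] S.norm_U_funpow[of n ?p] by linarith
      then have "norm (Bt s (\<lambda>z. z * g n z) x) / s\<^sup>2 \<le> 2 * M ^ n * norm ?p / s\<^sup>2"
        by (rule divide_right_mono) simp
      then show "norm (- ((1 / s\<^sup>2) *\<^sub>R Bt s (\<lambda>z. z * g n z) x)) \<le> 2 * M ^ n * ?F s" by simp
    qed
    also have "\<dots> = 2 * M ^ n * ?I T" by simp
    also have "\<dots> \<le> 2 * M ^ n * integral {t..} ?F"
      using M int cF by (intro mult_left_mono integral_subset_le) (auto intro: integrable_continuous_real)
    finally show ?thesis .
  qed
  have "norm (?Y t) \<le> 2 * M ^ n * integral {t..} ?F"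
  proof (rule tendsto_lowerbound)
    show "((\<lambda>T. 2 * M ^ n * integral {t..} ?F + C * norm x / T) \<longlongrightarrow> 2 * M ^ n * integral {t..} ?F) at_top"
    proof -
      have "((\<lambda>T. C * norm x / T) \<longlongrightarrow> 0) at_top"
        by (intro tendsto_divide_0[OF tendsto_const] filterlim_mono[OF filterlim_ident at_top_le_at_infinity order_refl])
      from tendsto_add[OF tendsto_const this] show ?thesis by simp
    qed
    show "\<forall>\<^sub>F T in at_top. norm (?Y t) \<le> 2 * M ^ n * integral {t..} ?F + C * norm x / T"
      using eventually_gt_at_top[of t]
    proof eventually_elim
      case (elim T)
      then have T: "0 < T" using t by simp
      have "norm (?Y T) \<le> C * norm x / T" using C(2)[OF T, of x] T by (simp add: divide_right_mono)
      then show ?case using est[OF elim] norm_triangle_ineq4[of "?Y T" "?Y T - ?Y t"] by simp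
    qed
  qed simp
  then show ?thesis by (simp only: A_reproducing[OF t])
qed

text \<open>Serves the summand t |b| of the K-functional, where b is a multiple of h(tA)x: in
  general |b| cannot be bounded by |A b|.\<close>

lemma norm_reproducing:
  obtains C where "0 \<le> C" "\<And>t x. 0 < t \<Longrightarrow> norm (reproducing h c t x) \<le> C * norm x"
proof -
  obtain C where C: "0 \<le> C" "\<And>t x. 0 < t \<Longrightarrow> norm (Bt t (\<lambda>z. h z - c * u z) x) \<le> C * norm x"
    using norm_Bt[OF hc] by blast
  show thesis
  proof (rule that[of "C + cmod c * M"])
    fix t :: real and x assume t: "0 < t"
    interpret S: sectorial_calculus D "\<lambda>y. t *\<^sub>R A y" \<mu> M \<nu> \<phi> by (rule scaled[OF t])
    have "norm (c *\<^sub>C S.U x) \<le> cmod c * (M * norm x)"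
      unfolding norm_scaleC using S.norm_U by (rule mult_left_mono) simp
    then show "norm (reproducing h c t x) \<le> (C + cmod c * M) * norm x"
      unfolding reproducing_def
      using norm_triangle_ineq[of "Bt t (\<lambda>z. h z - c * u z) x" "c *\<^sub>C S.U x"] C(2)[OF t, of x]
      by (simp add: distrib_right mult.assoc)
  qed (use C M in simp)
qed

end

end

end

section \<open>Sectorial operators and the extended calculus\<close>

lemma not_in_closure_sector:
  assumes \<theta>: "0 \<le> \<theta>" "\<theta> < \<phi>" "\<phi> \<le> pi" and z: "z \<noteq> 0" "z \<notin> sector \<phi>"
  shows "z \<notin> closure (sector \<theta>)"
proof
  assume "z \<in> closure (sector \<theta>)"
  moreover have "closure (sector \<theta>) \<subseteq> {z. cmod z * cos \<theta> \<le> Re z}"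
  proof (rule closure_minimal)
    show "sector \<theta> \<subseteq> {z. cmod z * cos \<theta> \<le> Re z}"
      using \<theta> by (auto simp: sector_iff)
    show "closed {z. cmod z * cos \<theta> \<le> Re z}"
      by (intro closed_Collect_le continuous_intros)
  qed
  ultimately have "cmod z * cos \<theta> \<le> Re z" by blast
  moreover have "Re z \<le> cmod z * cos \<phi>" using z \<theta> by (simp add: sector_iff not_less)
  moreover have "cmod z * cos \<phi> < cmod z * cos \<theta>"
    using z \<theta> by (intro mult_strict_left_mono cos_monotone_0_pi) auto
  ultimately show False by simp
qed

lemma sectorial_of_angle_resolvent:
  assumes A: "sectorial_of_angle D A \<theta>" and \<phi>: "\<theta> < \<phi>" "\<phi> \<le> pi" and z: "z \<noteq> 0" "z \<notin> sector \<phi>"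
  shows "z \<in> resolvent_set D A"
  using assms not_in_closure_sector[of \<theta> \<phi> z] by (auto simp: sectorial_of_angle_def spectrum_def)

lemma resolvent_set_scaleR:
  assumes t: "0 < t" and z: "inverse t *\<^sub>R z \<in> resolvent_set D A"
  shows "z \<in> resolvent_set D (\<lambda>y. t *\<^sub>R (A y :: 'a::complex_banach))"
proof -
  have "bounded_linear (\<lambda>x. resolvent D A (inverse t *\<^sub>R z) (inverse t *\<^sub>R x))"
    using z by (intro bounded_linear_compose[OF _ bounded_linear_scaleR_right]) (simp add: resolvent_set_def)
  then have "bounded_linear (resolvent D (\<lambda>y. t *\<^sub>R A y) z)"
    by (simp add: resolvent_scaleR[OF t, abs_def])
  then show ?thesis using z by (auto simp: resolvent_set_def intro!: bij_betw_scaleR[OF t])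
qed

lemma sectorial_of_angle_scaleR:
  assumes A: "sectorial_of_angle D (A :: 'a::complex_banach \<Rightarrow> 'a) \<theta>" and t: "0 < t"
  shows "sectorial_of_angle D (\<lambda>y. t *\<^sub>R A y) \<theta>"
  unfolding sectorial_of_angle_def
proof (intro conjI allI impI)
  show \<theta>: "0 < \<theta>" "\<theta> < pi" using A by (auto simp: sectorial_of_angle_def)
  show "linear_operator D (\<lambda>y. t *\<^sub>R A y)"
    using A by (auto simp: sectorial_of_angle_def linear_operator_def scaleR_right_distrib scaleC.scaleR_right)
  show "spectrum D (\<lambda>y. t *\<^sub>R A y) \<subseteq> closure (sector \<theta>)"
  proof
    fix z assume "z \<in> spectrum D (\<lambda>y. t *\<^sub>R A y)"
    then have "inverse t *\<^sub>R z \<in> spectrum D A"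
      using resolvent_set_scaleR[OF t, of z D A] by (auto simp: spectrum_def)
    then have "inverse t *\<^sub>R z \<in> closure (sector \<theta>)" using A by (auto simp: sectorial_of_angle_def)
    then have "t *\<^sub>R inverse t *\<^sub>R z \<in> closure ((*\<^sub>R) t ` sector \<theta>)"
      unfolding closure_scaleR[symmetric] by blast
    moreover have "closure ((*\<^sub>R) t ` sector \<theta>) \<subseteq> closure (sector \<theta>)"
      by (intro closure_mono image_subsetI scaleR_mem_sector t)
    ultimately show "z \<in> closure (sector \<theta>)" using t by auto
  qed
  fix \<phi> assume \<phi>: "\<theta> < \<phi> \<and> \<phi> < pi"
  have "(\<lambda>z. onorm (\<lambda>x. z *\<^sub>C resolvent D (\<lambda>y. t *\<^sub>R A y) z x)) ` (- sector \<phi>)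
      \<subseteq> (\<lambda>z. onorm (\<lambda>x. z *\<^sub>C resolvent D A z x)) ` (- sector \<phi>)"
  proof (rule image_subsetI)
    fix z assume z: "z \<in> - sector \<phi>"
    let ?w = "inverse t *\<^sub>R z"
    have w: "?w \<in> - sector \<phi>" using z scaleR_mem_sector[OF t, of ?w \<phi>] t by auto
    \<comment> \<open>At z = 0 the resolvent may be meaningless, but there the factor z makes both
      sides vanish.\<close>
    have "(\<lambda>x. z *\<^sub>C resolvent D (\<lambda>y. t *\<^sub>R A y) z x) = (\<lambda>x. ?w *\<^sub>C resolvent D A ?w x)"
    proof (cases "z = 0")
      case False
      then have "?w \<in> resolvent_set D A"
        using w \<phi> t by (intro sectorial_of_angle_resolvent[OF A, of \<phi>]) auto
      then have "resolvent D A ?w (inverse t *\<^sub>R x) = inverse t *\<^sub>R resolvent D A ?w x" for x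
        by (intro linear_scale bounded_linear.linear) (simp add: resolvent_set_def)
      then show ?thesis by (simp add: resolvent_scaleR[OF t] scaleC.scaleR_left scaleC.scaleR_right)
    qed (simp add: scaleC.zero_left)
    then show "onorm (\<lambda>x. z *\<^sub>C resolvent D (\<lambda>y. t *\<^sub>R A y) z x)
        \<in> (\<lambda>z. onorm (\<lambda>x. z *\<^sub>C resolvent D A z x)) ` (- sector \<phi>)"
      using w by simp
  qed
  moreover have "bdd_above ((\<lambda>z. onorm (\<lambda>x. z *\<^sub>C resolvent D A z x)) ` (- sector \<phi>))"
    using A \<phi> by (simp add: sectorial_of_angle_def)
  ultimately show "bdd_above ((\<lambda>z. onorm (\<lambda>x. z *\<^sub>C resolvent D (\<lambda>y. t *\<^sub>R A y) z x)) ` (- sector \<phi>))"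
    by (rule bdd_above_mono[rotated])
qed

lemma sectoriality_angle_scaleR:
  assumes t: "0 < t"
  shows "sectoriality_angle D (\<lambda>y. t *\<^sub>R (A y :: 'a::complex_banach)) = sectoriality_angle D A"
proof -
  have "sectorial_of_angle D (\<lambda>y. t *\<^sub>R A y) \<theta> = sectorial_of_angle D A \<theta>" for \<theta>
    using sectorial_of_angle_scaleR[of D A \<theta> t] sectorial_of_angle_scaleR[of D "\<lambda>y. t *\<^sub>R A y" \<theta> "inverse t"] t
    by auto
  then show ?thesis by (simp add: sectoriality_angle_def)
qed

text \<open>The contour angle is literally the \<open>SOME\<close> term of \<open>calculus0\<close>,
  so that \<open>calculus0\<close> unfolds to \<open>B\<close> of the resulting locale. The
  definition of the angle as an infimum provides a sectoriality angle \<theta> < \<nu>, and \<mu> is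
  the midpoint of the two.\<close>

lemma sectorial_calculusI:
  fixes A :: "'a::complex_banach \<Rightarrow> 'a"
  assumes A: "sectorial D A" and \<phi>: "sectoriality_angle D A < \<phi>" "\<phi> < pi"
  obtains \<mu> M where "sectorial_calculus D A \<mu> M (SOME \<nu>. sectoriality_angle D A < \<nu> \<and> \<nu> < \<phi>) \<phi>"
proof -
  define \<nu> where "\<nu> = (SOME \<nu>. sectoriality_angle D A < \<nu> \<and> \<nu> < \<phi>)"
  have \<nu>: "sectoriality_angle D A < \<nu>" "\<nu> < \<phi>"
    using someI_ex[OF dense[OF \<phi>(1)]] unfolding \<nu>_def by blast+
  have "\<exists>\<theta>\<in>{\<theta>. sectorial_of_angle D A \<theta>}. \<theta> < \<nu>"
    using \<nu>(1) A cInf_lessD[of "{\<theta>. sectorial_of_angle D A \<theta>}" \<nu>]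
    by (auto simp: sectoriality_angle_def sectorial_def)
  then obtain \<theta> where \<theta>: "sectorial_of_angle D A \<theta>" "\<theta> < \<nu>" by auto
  have \<theta>0: "0 < \<theta>" using \<theta>(1) by (simp add: sectorial_of_angle_def)
  define \<mu> where "\<mu> = (\<theta> + \<nu>) / 2"
  have \<mu>: "\<theta> < \<mu>" "\<mu> < \<nu>" "0 < \<mu>" "\<mu> < pi" using \<theta> \<theta>0 \<nu> \<phi> by (auto simp: \<mu>_def)
  have "bdd_above ((\<lambda>z. onorm (\<lambda>x. z *\<^sub>C resolvent D A z x)) ` (- sector \<mu>))"
    using \<theta>(1) \<mu> by (simp add: sectorial_of_angle_def)
  then obtain M0 where M0: "\<And>z. z \<notin> sector \<mu> \<Longrightarrow> onorm (\<lambda>x. z *\<^sub>C resolvent D A z x) \<le> M0"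
    by (auto simp: bdd_above_def)
  have "sectorial_calculus D A \<mu> (max 1 M0) \<nu> \<phi>"
  proof
    show "linear_operator D A" using \<theta>(1) by (simp add: sectorial_of_angle_def)
    fix z assume z: "z \<in> cosector \<mu>"
    then have zs: "z \<notin> sector \<mu>" using \<mu> by (auto simp: sector_iff cosector_def)
    have res: "z \<in> resolvent_set D A"
      using \<mu> zs cosector_nonzero[OF z] by (intro sectorial_of_angle_resolvent[OF \<theta>(1)]) auto
    then show "bij_betw (\<lambda>x. z *\<^sub>C x - A x) D UNIV" by (simp add: resolvent_set_def)
    fix x
    have "bounded_linear (\<lambda>x. z *\<^sub>C resolvent D A z x)"
      using res by (intro bounded_linear_compose[OF scaleC.bounded_linear_right]) (simp add: resolvent_set_def)
    then have "norm (z *\<^sub>C resolvent D A z x) \<le> onorm (\<lambda>x. z *\<^sub>C resolvent D A z x) * norm x"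
      by (rule onorm)
    also have "\<dots> \<le> max 1 M0 * norm x"
      using M0[OF zs] by (intro mult_right_mono) auto
    finally show "cmod z * norm (resolvent D A z x) \<le> max 1 M0 * norm x" by (simp add: norm_scaleC)
  qed (use \<mu> \<nu> \<phi> in auto)
  then show thesis unfolding \<nu>_def by (rule that)
qed

section \<open>Limits at 0 and infinity of functions in the extended class\<close>

lemma Hinf0_tendsto:
  assumes f: "f \<in> Hinf0 \<phi>" and \<phi>: "0 < \<phi>"
  shows Hinf0_tendsto_at_top: "((\<lambda>r. f (complex_of_real r)) \<longlongrightarrow> 0) at_top"
    and Hinf0_tendsto_at_right: "((\<lambda>r. f (complex_of_real r)) \<longlongrightarrow> 0) (at_right 0)"
proof -
  obtain C s where C: "0 < C" "0 < s"
    and le: "\<And>z. z \<in> sector \<phi> \<Longrightarrow> cmod (f z) \<le> C * min (cmod z powr s) (cmod z powr (- s))"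
    using f by (auto simp: Hinf0_def)
  have b: "cmod (f (of_real r)) \<le> C * r powr s" "cmod (f (of_real r)) \<le> C * r powr (- s)" if "0 < r" for r
  proof -
    have "cmod (f (of_real r)) \<le> C * min (r powr s) (r powr (- s))"
      using le[OF of_real_mem_sector[OF that \<phi>]] that by simp
    moreover have "C * min (r powr s) (r powr (- s)) \<le> C * r powr s" "C * min (r powr s) (r powr (- s)) \<le> C * r powr (- s)"
      using C by (intro mult_left_mono; simp)+
    ultimately show "cmod (f (of_real r)) \<le> C * r powr s" "cmod (f (of_real r)) \<le> C * r powr (- s)" by linarith+
  qed
  show "((\<lambda>r. f (complex_of_real r)) \<longlongrightarrow> 0) at_top"
  proof (rule Lim_null_comparison)
    show "\<forall>\<^sub>F r in at_top. norm (f (complex_of_real r)) \<le> C * r powr (- s)"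
      using eventually_gt_at_top[of 0] by eventually_elim (rule b)
    show "((\<lambda>r. C * r powr (- s)) \<longlongrightarrow> 0) at_top"
      using tendsto_mult[OF tendsto_const[of C] tendsto_neg_powr[OF _ filterlim_ident, of "- s"]] C by simp
  qed
  show "((\<lambda>r. f (complex_of_real r)) \<longlongrightarrow> 0) (at_right 0)"
  proof (rule Lim_null_comparison)
    show "\<forall>\<^sub>F r in at_right 0. norm (f (complex_of_real r)) \<le> C * r powr s"
      using eventually_at_right_less[of 0] by eventually_elim (rule b)
    have "((\<lambda>r. r powr s) \<longlongrightarrow> 0) (at_right (0::real))"
      by (rule tendsto_zero_powrI[OF tendsto_ident_at tendsto_const _ C(2)]) (simp add: eventually_at_filter)
    from tendsto_mult[OF tendsto_const[of C] this]
    show "((\<lambda>r. C * r powr s) \<longlongrightarrow> 0) (at_right 0)" by simp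
  qed
qed

lemma tendsto_one_plus_real:
  "((\<lambda>r. l / (1 + complex_of_real r)) \<longlongrightarrow> 0) at_top"
  "((\<lambda>r. l / (1 + complex_of_real r)) \<longlongrightarrow> l) (at_right 0)"
proof -
  have "((\<lambda>r. complex_of_real (1 / (1 + r))) \<longlongrightarrow> of_real 0) at_top"
    by (intro tendsto_of_real tendsto_divide_0[OF tendsto_const]
        filterlim_mono[OF filterlim_tendsto_add_at_top[OF tendsto_const filterlim_ident] at_top_le_at_infinity order_refl])
  from tendsto_mult[OF tendsto_const[of l] this]
  show "((\<lambda>r. l / (1 + complex_of_real r)) \<longlongrightarrow> 0) at_top" by simp
  have "((\<lambda>r. l / (1 + complex_of_real r)) \<longlongrightarrow> l / (1 + complex_of_real 0)) (at_right 0)"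
    by (intro tendsto_intros) auto
  then show "((\<lambda>r. l / (1 + complex_of_real r)) \<longlongrightarrow> l) (at_right 0)" by simp
qed

lemma Eclass_limits:
  assumes f: "(\<lambda>z. f z - l / (1 + z) - m) \<in> Hinf0 \<phi>" and \<phi>: "0 < \<phi>"
  shows "((\<lambda>r. f (complex_of_real r)) \<longlongrightarrow> m) at_top"
    and "((\<lambda>r. f (complex_of_real r)) \<longlongrightarrow> l + m) (at_right 0)"
  using tendsto_add[OF tendsto_add[OF Hinf0_tendsto_at_top[OF f \<phi>] tendsto_one_plus_real(1)[of l]] tendsto_const[of m]]
    tendsto_add[OF tendsto_add[OF Hinf0_tendsto_at_right[OF f \<phi>] tendsto_one_plus_real(2)[of l]] tendsto_const[of m]]
  by simp_all

lemma EclassE: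
  assumes "f \<in> Eclass \<phi>"
  obtains l m where "(\<lambda>z. f z - l / (1 + z) - m) \<in> Hinf0 \<phi>"
proof -
  from assms obtain f0 l m where f0: "f0 \<in> Hinf0 \<phi>" and "\<And>z. z \<in> sector \<phi> \<Longrightarrow> f z = f0 z + l / (1 + z) + m"
    by (auto simp: Eclass_def)
  then have "(\<lambda>z. f z - l / (1 + z) - m) \<in> Hinf0 \<phi>"
    by (intro Hinf0_cong[OF f0]) simp
  then show thesis by (rule that)
qed

text \<open>Comparing limits fixes the coefficients: \<psi>(z)/z tends to 0 at infinity because
  \<psi> has a limit there, so the constant part of \<psi>(z)/z is 0; and \<psi> tends to 0 at 0
  because \<psi>(z)/z has a limit there, so l = -m.\<close>

lemma Eclass_pairE:
  assumes \<phi>: "0 < \<phi>" "\<phi> < pi" and \<psi>: "\<psi> \<in> Eclass \<phi>" and z\<psi>: "(\<lambda>z. inverse z * \<psi> z) \<in> Eclass \<phi>"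
  obtains m k where
    "(THE (l, m). (\<lambda>z. \<psi> z - l / (1 + z) - m) \<in> Hinf0 \<phi>) = (- m, m)"
    "(\<lambda>z. \<psi> z - (- m) / (1 + z) - m) \<in> Hinf0 \<phi>"
    "(\<lambda>z. (\<psi> z - (- m) / (1 + z) - m) / z - k / (1 + z)\<^sup>2) \<in> Hinf0 \<phi>"
proof -
  obtain l m where lm: "(\<lambda>z. \<psi> z - l / (1 + z) - m) \<in> Hinf0 \<phi>" using EclassE[OF \<psi>] .
  obtain l' m' where lm': "(\<lambda>z. inverse z * \<psi> z - l' / (1 + z) - m') \<in> Hinf0 \<phi>" using EclassE[OF z\<psi>] .
  note L = Eclass_limits[OF lm \<phi>(1)] and L' = Eclass_limits[OF lm' \<phi>(1)]
  have "((\<lambda>r. inverse (complex_of_real r)) \<longlongrightarrow> 0) at_top"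
    by (intro tendsto_inverse_0_at_top[THEN tendsto_of_real, of "\<lambda>r. r" at_top, where 'a = complex, simplified] filterlim_ident)
  from tendsto_mult[OF this L(1)] have "((\<lambda>r. inverse (complex_of_real r) * \<psi> (complex_of_real r)) \<longlongrightarrow> 0) at_top"
    by simp
  then have m': "m' = 0" using tendsto_unique[OF _ L'(1)] by simp
  have "((\<lambda>r. complex_of_real r) \<longlongrightarrow> of_real 0) (at_right 0)" by (intro tendsto_intros)
  from tendsto_mult[OF this L'(2)]
  have "((\<lambda>r. complex_of_real r * (inverse (complex_of_real r) * \<psi> (complex_of_real r))) \<longlongrightarrow> 0) (at_right 0)" by simp
  moreover have "\<forall>\<^sub>F r in at_right 0. complex_of_real r * (inverse (complex_of_real r) * \<psi> (complex_of_real r)) = \<psi> (complex_of_real r)"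
    using eventually_at_right_less[of 0] by eventually_elim simp
  ultimately have "((\<lambda>r. \<psi> (complex_of_real r)) \<longlongrightarrow> 0) (at_right 0)" by (rule Lim_transform_eventually)
  then have "l + m = 0" using tendsto_unique[OF _ L(2)] by simp
  then have l: "l = - m" by (simp add: eq_neg_iff_add_eq_0)
  note h0 = lm[unfolded l]
  have the: "(THE (l, m). (\<lambda>z. \<psi> z - l / (1 + z) - m) \<in> Hinf0 \<phi>) = (- m, m)"
  proof (rule the_equality)
    show "case (- m, m) of (l, m) \<Rightarrow> (\<lambda>z. \<psi> z - l / (1 + z) - m) \<in> Hinf0 \<phi>" using h0 by simp
    fix p assume "case p of (l, m) \<Rightarrow> (\<lambda>z. \<psi> z - l / (1 + z) - m) \<in> Hinf0 \<phi>"
    then obtain l2 m2 where p: "p = (l2, m2)" and h2: "(\<lambda>z. \<psi> z - l2 / (1 + z) - m2) \<in> Hinf0 \<phi>" by (cases p) auto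
    note L2 = Eclass_limits[OF h2 \<phi>(1)]
    have "m2 = m" "l2 + m2 = l + m"
      using tendsto_unique[OF _ L2(1) L(1)] tendsto_unique[OF _ L2(2) L(2)] by simp_all
    then show "p = (- m, m)" using p l by (simp add: eq_neg_iff_add_eq_0)
  qed
  \<comment> \<open>With \<psi>0 = \<psi> - m z/(1+z), this is the limit of \<psi>0(z)/z =
    \<psi>(z)/z - m/(1+z) at 0.\<close>
  let ?k = "l' - m"
  have "(\<lambda>z. (inverse z * \<psi> z - l' / (1 + z) - m') + ?k * (z / (1 + z)\<^sup>2)) \<in> Hinf0 \<phi>"
    by (intro Hinf0_add Hinf0_cmult Hinf0_Koebe lm' \<phi>)
  then have k: "(\<lambda>z. (\<psi> z - (- m) / (1 + z) - m) / z - ?k / (1 + z)\<^sup>2) \<in> Hinf0 \<phi>"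
  proof (rule Hinf0_cong)
    fix z assume z: "z \<in> sector \<phi>"
    then have z0: "z \<noteq> 0" by (simp add: sector_def)
    have z1: "1 + z \<noteq> 0" using one_plus_nonzero[OF z] \<phi> by simp
    have a: "m / (1 + z) - m = - m * (z / (1 + z))" using z1 by (simp add: field_simps)
    have "1 / (1 + z) = (1 + z) / (1 + z)\<^sup>2" using z1 by (simp add: power2_eq_square)
    then have b: "z / (1 + z)\<^sup>2 = 1 / (1 + z) - 1 / (1 + z)\<^sup>2"
      by (simp only: diff_divide_distrib[symmetric]) simp
    have "(\<psi> z - (- m) / (1 + z) - m) / z = (\<psi> z + - m * (z / (1 + z))) / z"
      using a by (simp add: algebra_simps)
    also have "\<dots> = inverse z * \<psi> z - m / (1 + z)" using z0 by (simp add: divide_inverse algebra_simps)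
    finally show "(inverse z * \<psi> z - l' / (1 + z) - m') + ?k * (z / (1 + z)\<^sup>2) =
        (\<psi> z - (- m) / (1 + z) - m) / z - ?k / (1 + z)\<^sup>2"
      unfolding b by (simp add: m' algebra_simps diff_divide_distrib)
  qed
  show thesis by (rule that[OF the h0 k])
qed

section \<open>Nonvanishing of some limit c\<close>

lemma ray_extend_continuous:
  fixes p :: "real \<Rightarrow> 'b::real_normed_vector"
  assumes "\<And>v. 0 < v \<Longrightarrow> v < 1 \<Longrightarrow> isCont p v" "(p \<longlongrightarrow> 0) (at_right 0)" "(p \<longlongrightarrow> 0) (at_left 1)"
  shows "continuous_on {0..1} (\<lambda>v. if 0 < v \<and> v < 1 then p v else 0)" (is "continuous_on _ ?q")
proof (rule continuous_on_IccI)
  show "(?q \<longlongrightarrow> ?q 0) (at_right 0)"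
    using eventually_at_right_real[of 0 1]
    by (auto intro!: Lim_transform_eventually[OF assms(2)] elim!: eventually_mono)
  show "(?q \<longlongrightarrow> ?q 1) (at_left 1)"
    using eventually_at_left_real[of 0 1]
    by (auto intro!: Lim_transform_eventually[OF assms(3)] elim!: eventually_mono)
  fix v :: real assume v: "0 < v" "v < 1"
  have "\<forall>\<^sub>F w in at v. p w = ?q w"
    using v by (intro eventually_at_in_open'[of "{0<..<1}", THEN eventually_mono]) auto
  then show "(?q \<longlongrightarrow> ?q v) (at v)"
    using assms(1)[OF v] v by (auto simp: isCont_def intro: Lim_transform_eventually)
qed simp

lemma Cayley_limits:
  "filterlim (\<lambda>v::real. 1 / v - 1) at_top (at_right 0)"
  "filterlim (\<lambda>v::real. 1 / v - 1) (at_right 0) (at_left 1)"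
proof -
  have "filterlim (\<lambda>v::real. - 1 + inverse v) at_top (at_right 0)"
    by (rule filterlim_tendsto_add_at_top[OF tendsto_const filterlim_inverse_at_top_right])
  then show "filterlim (\<lambda>v::real. 1 / v - 1) at_top (at_right 0)" by (simp add: divide_inverse)
  show "filterlim (\<lambda>v::real. 1 / v - 1) (at_right 0) (at_left 1)"
    unfolding filterlim_at
  proof
    show "\<forall>\<^sub>F v::real in at_left 1. 1 / v - 1 \<in> {0<..} \<and> 1 / v - 1 \<noteq> 0"
      using eventually_at_left_real[of 0 "1::real"] by (auto elim!: eventually_mono)
    have "((\<lambda>v::real. 1 / v - 1) \<longlongrightarrow> 1 / 1 - 1) (at_left 1)" by (intro tendsto_intros) auto
    then show "((\<lambda>v::real. 1 / v - 1) \<longlongrightarrow> 0) (at_left 1)" by simp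
  qed
qed

text \<open>The substitution \<open>v = 1 / (1 + z)\<close> turns the vanishing of all limits \<open>c\<close> into the vanishing of
  all moments of \<open>v \<psi> (1 / v - 1)\<close>.\<close>

lemma vanishing_primitives_imp_zero:
  assumes \<phi>: "0 < \<phi>" "\<phi> < pi" and \<psi>: "\<psi> holomorphic_on sector \<phi>"
    and m: "((\<lambda>r. \<psi> (complex_of_real r)) \<longlongrightarrow> m) at_top"
    and zero: "((\<lambda>r. \<psi> (complex_of_real r)) \<longlongrightarrow> 0) (at_right 0)"
    and h: "\<And>n::nat. 2 \<le> n \<Longrightarrow> \<exists>h. h \<in> Hinf0 \<phi> \<and>
      (\<forall>z\<in>sector \<phi>. (h has_field_derivative (- (\<psi> z * (1 / (1 + z)) ^ n) / z)) (at z))"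
    and z: "z \<in> sector \<phi>"
  shows "\<psi> z = 0"
proof -
  let ?z = "\<lambda>v::real. complex_of_real (1 / v - 1)"
  \<comment> \<open>The factor v forces the value 0 at v = 0, that is z = \<infinity>, where \<psi>
    tends to m; at v = 1, that is z = 0, \<psi> itself tends to 0.\<close>
  let ?p = "\<lambda>v::real. complex_of_real v * \<psi> (?z v)"
  let ?f = "\<lambda>v. if 0 < v \<and> v < 1 then ?p v else 0"
  have op: "open (sector \<phi>)" using \<phi> by (intro open_sector) auto
  have mem: "?z v \<in> sector \<phi>" if "0 < v" "v < 1" for v
    using that \<phi> by (intro of_real_mem_sector) auto
  have z_cont: "isCont ?z v" if "0 < v" for v
    using that by (intro continuous_intros) auto
  have comp: "isCont (\<lambda>v. q (?z v)) v" if "q holomorphic_on sector \<phi>" "0 < v" "v < 1" for q :: "complex \<Rightarrow> complex" and v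
    using that holomorphic_on_imp_continuous_on[OF that(1)] mem[OF that(2,3)] op
    by (intro isCont_o2[OF z_cont]) (auto simp: continuous_on_eq_continuous_at)
  have fc: "continuous_on {0..1} ?f"
  proof (rule ray_extend_continuous)
    show "isCont ?p v" if "0 < v" "v < 1" for v
      by (intro continuous_intros comp[OF \<psi>] that)
    have "((\<lambda>v. complex_of_real v) \<longlongrightarrow> of_real 0) (at_right 0)" by (intro tendsto_intros)
    from tendsto_mult[OF this filterlim_compose[OF m Cayley_limits(1)]]
    show "(?p \<longlongrightarrow> 0) (at_right 0)" by simp
    have "((\<lambda>v. complex_of_real v) \<longlongrightarrow> of_real 1) (at_left 1)" by (intro tendsto_intros)
    from tendsto_mult[OF this filterlim_compose[OF zero Cayley_limits(2)]]
    show "(?p \<longlongrightarrow> 0) (at_left 1)" by simp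
  qed
  have mom: "((\<lambda>v. of_real (v ^ j) * ?f v) has_integral 0) {0..1}" for j :: nat
  proof -
    obtain h1 where h1: "h1 \<in> Hinf0 \<phi>"
      "\<And>z. z \<in> sector \<phi> \<Longrightarrow> (h1 has_field_derivative (- (\<psi> z * (1 / (1 + z)) ^ (j + 2)) / z)) (at z)"
      using h[of "j + 2"] by auto
    obtain h2 where h2: "h2 \<in> Hinf0 \<phi>"
      "\<And>z. z \<in> sector \<phi> \<Longrightarrow> (h2 has_field_derivative (- (\<psi> z * (1 / (1 + z)) ^ (j + 3)) / z)) (at z)"
      using h[of "j + 3"] by auto
    \<comment> \<open>A single primitive contributes \<psi>/z, with a denominator that vanishes at v
      = 1. In the difference for the exponents j+2 and j+3 the factor 1 - v = v z cancels it, and dz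
      = -v^-2 dv leaves v^j times v \<psi>.\<close>
    let ?d = "\<lambda>z. h1 z - h2 z"
    have d: "?d \<in> Hinf0 \<phi>" by (rule Hinf0_diff[OF h1(1) h2(1)])
    have dh: "?d holomorphic_on sector \<phi>" using Hinf0E[OF d] by metis
    let ?G = "\<lambda>v. if 0 < v \<and> v < 1 then ?d (?z v) else 0"
    have Gc: "continuous_on {0..1} ?G"
      by (intro ray_extend_continuous comp[OF dh] filterlim_compose[OF Hinf0_tendsto_at_top[OF d \<phi>(1)] Cayley_limits(1)]
          filterlim_compose[OF Hinf0_tendsto_at_right[OF d \<phi>(1)] Cayley_limits(2)])
    have "(?G has_vector_derivative (of_real (v ^ j) * ?f v)) (at v)" if v: "v \<in> {0<..<1}" for v
    proof -
      have v0: "0 < v" "v < 1" using v by auto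
      note mz = mem[OF v0]
      have u: "1 / (1 + ?z v) = of_real v" using v0 by simp
      have z0: "?z v \<noteq> 0" using mz by (simp add: sector_def)
      have zv: "of_real v * ?z v = 1 - of_real v" using v0 by (simp add: algebra_simps)
      let ?w = "\<psi> (?z v) * of_real v ^ (j + 2)"
      have "(?d has_field_derivative (- ?w / ?z v - - (?w * of_real v) / ?z v)) (at (?z v))"
        using DERIV_diff[OF h1(2)[OF mz] h2(2)[OF mz]] unfolding u by (simp add: numeral_eq_Suc mult_ac)
      also have "- ?w / ?z v - - (?w * of_real v) / ?z v = - (?w * (1 - of_real v)) / ?z v"
        by (simp add: diff_divide_distrib algebra_simps)
      also have "\<dots> = - (?w * of_real v)"
      proof -
        have "- (a * (b * x)) / x = - (a * b)" if "x \<noteq> 0" for a b x :: complex using that by simp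
        from this[OF z0] show ?thesis unfolding zv[symmetric] .
      qed
      finally have D: "(?d has_field_derivative - (?w * of_real v)) (at (?z v))" .
      have "((\<lambda>v. 1 / v - 1) has_real_derivative - (1 / v\<^sup>2)) (at v)"
        using v0 by (auto intro!: derivative_eq_intros simp: power2_eq_square divide_inverse)
      then have "(?z has_vector_derivative of_real (- (1 / v\<^sup>2))) (at v)" by (rule has_vector_derivative_of_real)
      from field_vector_diff_chain_at[OF this D]
      have "((\<lambda>v. ?d (?z v)) has_vector_derivative of_real (- (1 / v\<^sup>2)) * - (?w * of_real v)) (at v)"
        by (simp add: o_def)
      moreover have "of_real (- (1 / v\<^sup>2)) * - (?w * of_real v) = of_real (v ^ j) * ?f v"
        using v0 by (simp add: power_add power2_eq_square)
      ultimately have "((\<lambda>v. ?d (?z v)) has_vector_derivative of_real (v ^ j) * ?f v) (at v)" by (simp only:)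
      then show ?thesis
        by (rule has_vector_derivative_transform_within_open[where S = "{0<..<1}"]) (use v in auto)
    qed
    then have "((\<lambda>v. of_real (v ^ j) * ?f v) has_integral (?G 1 - ?G 0)) {0..1}"
      using Gc by (intro fundamental_theorem_of_calculus_interior) auto
    then show ?thesis by simp
  qed
  have ReIm: "Re (?f v) = 0" "Im (?f v) = 0" if "v \<in> {0..1}" for v
  proof -
    have re: "((\<lambda>v. v ^ j * Re (?f v)) has_integral 0) {0..1}" and im: "((\<lambda>v. v ^ j * Im (?f v)) has_integral 0) {0..1}" for j :: nat
      using has_integral_linear[OF mom[of j] bounded_linear_Re] has_integral_linear[OF mom[of j] bounded_linear_Im]
      unfolding o_def Re_complex_of_real Im_complex_of_real times_complex.sel by simp_all
    show "Re (?f v) = 0"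
      using vanishing_moments[OF continuous_on_Re[OF fc] re that] .
    show "Im (?f v) = 0"
      using vanishing_moments[OF continuous_on_Im[OF fc] im that] .
  qed
  have f0: "?f v = 0" if "v \<in> {0..1}" for v
    by (rule complex_eqI) (simp_all only: ReIm[OF that] zero_complex.sel)
  have ray0: "\<psi> (of_real r) = 0" if r: "0 < r" for r
  proof -
    define v where "v = 1 / (1 + r)"
    have v: "0 < v" "v < 1" "1 / v - 1 = r" using r by (auto simp: v_def)
    then have "complex_of_real v * \<psi> (of_real (1 / v - 1)) = 0" using f0[of v] by simp
    then show ?thesis using v by (simp only: v(3)) simp
  qed
  \<comment> \<open>The zeros on the positive axis accumulate at 1, inside the sector, so the
    identity theorem applies.\<close>
  have con: "connected (sector \<phi>)" by (intro starlike_imp_connected starlike_sector \<phi>)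
  have lim: "(1::complex) islimpt complex_of_real ` {0<..}"
    unfolding islimpt_approachable
  proof (intro allI impI)
    fix e :: real assume e: "0 < e"
    have "dist (complex_of_real (1 + e / 2)) 1 < e"
      using e by (simp add: dist_norm)
    then show "\<exists>x'\<in>complex_of_real ` {0<..}. x' \<noteq> 1 \<and> dist x' 1 < e"
      using e by (intro bexI[of _ "complex_of_real (1 + e / 2)"] conjI imageI) auto
  qed
  show ?thesis
    by (rule analytic_continuation[OF \<psi> op con _ _ lim _ z])
      (use ray0 of_real_mem_sector[of _ \<phi>] of_real_mem_sector[of 1 \<phi>] \<phi> in auto)
qed

section \<open>Norm equivalence\<close>

text \<open>Collects all that the function space argument has to know about \<open>A\<close>. The
  element b is h(tA)x/c; its three bounds serve the summands |a|, t |A b| and t |b| of the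
  K-functional.\<close>

lemma calculus_estimates:
  fixes A :: "'a::complex_banach \<Rightarrow> 'a"
  assumes A: "sectorial D A" and \<phi>: "sectoriality_angle D A < \<phi>" "\<phi> < pi"
    and hol: "\<psi> holomorphic_on sector \<phi>" and nz: "\<exists>z\<in>sector \<phi>. \<psi> z \<noteq> 0"
    and \<psi>: "\<psi> \<in> Eclass \<phi>" and z\<psi>: "(\<lambda>z. inverse z * \<psi> z) \<in> Eclass \<phi>"
  obtains P :: "real \<Rightarrow> 'a \<Rightarrow> 'a" and C :: real where "1 \<le> C"
    "\<And>t x. 0 < t \<Longrightarrow> calculus D (\<lambda>y. t *\<^sub>R A y) \<phi> \<psi> x = P t x"
    "\<And>x. continuous_on {0<..} (\<lambda>t. P t x)"
    "\<And>t a b. 0 < t \<Longrightarrow> b \<in> D \<Longrightarrow> norm (P t (a + b)) \<le> C * (norm a + t * norm (A b))"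
    "\<And>t x. 0 < t \<Longrightarrow> (\<lambda>s. norm (P s x) / s) integrable_on {0..t} \<Longrightarrow>
      (\<lambda>s. norm (P s x) / s\<^sup>2) integrable_on {t..} \<Longrightarrow>
      \<exists>b\<in>D. norm (x - b) \<le> C * integral {0..t} (\<lambda>s. norm (P s x) / s) \<and>
        norm (A b) \<le> C * integral {t..} (\<lambda>s. norm (P s x) / s\<^sup>2) \<and> norm b \<le> C * norm x"
proof -
  define \<nu> where "\<nu> = (SOME \<nu>. sectoriality_angle D A < \<nu> \<and> \<nu> < \<phi>)"
  obtain \<mu> M where "sectorial_calculus D A \<mu> M \<nu> \<phi>"
    using sectorial_calculusI[OF A \<phi>] unfolding \<nu>_def by blast
  then interpret S: sectorial_calculus D A \<mu> M \<nu> \<phi> .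
  obtain m k where the: "(THE (l, m). (\<lambda>z. \<psi> z - l / (1 + z) - m) \<in> Hinf0 \<phi>) = (- m, m)"
    and \<psi>0: "(\<lambda>z. \<psi> z - (- m) / (1 + z) - m) \<in> Hinf0 \<phi>"
    and k: "(\<lambda>z. (\<psi> z - (- m) / (1 + z) - m) / z - k / (1 + z)\<^sup>2) \<in> Hinf0 \<phi>"
    using Eclass_pairE[OF S.\<phi>_pos S.\<phi> \<psi> z\<psi>] by blast
  define \<psi>0 where "\<psi>0 = (\<lambda>z. \<psi> z - (- m) / (1 + z) - m)"
  note \<psi>0 = \<psi>0[folded \<psi>0_def]
  have k: "(\<lambda>z. \<psi>0 z / z - k / (1 + z)\<^sup>2) \<in> Hinf0 \<phi>" using k by (simp only: \<psi>0_def)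
  have \<psi>_eq: "\<psi> z = \<psi>0 z + m * (z / (1 + z))" if "z \<in> sector \<phi>" for z
  proof -
    have "1 + z \<noteq> 0" using one_plus_nonzero[OF that] S.\<phi> by simp
    then have "z / (1 + z) = 1 - 1 / (1 + z)" by (simp add: field_simps)
    then show ?thesis by (simp add: \<psi>0_def right_diff_distrib)
  qed
  let ?P = "S.psi_op \<psi>0 m"
  have calc: "calculus D (\<lambda>y. t *\<^sub>R A y) \<phi> \<psi> x = ?P t x" if t: "0 < t" for t x
  proof -
    interpret T: sectorial_calculus D "\<lambda>y. t *\<^sub>R A y" \<mu> M \<nu> \<phi> by (rule S.scaled[OF t])
    have "calculus0 D (\<lambda>y. t *\<^sub>R A y) \<phi> \<psi>0 x = T.B \<psi>0 x"
      unfolding calculus0_def T.B_def Let_def sectoriality_angle_scaleR[OF t] \<nu>_def[symmetric] ..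
    then show ?thesis
      unfolding calculus_def the Let_def prod.case S.psi_op_def \<psi>0_def[symmetric] T.U_def[symmetric]
      by (simp add: scaleC.diff_right scaleC.minus_left)
  qed
  obtain C1 where C1: "0 \<le> C1" "\<And>t x. 0 < t \<Longrightarrow> norm (?P t x) \<le> C1 * norm x"
    using S.norm_psi_op[OF \<psi>0] by blast
  obtain C2 where C2: "0 \<le> C2" "\<And>t b. 0 < t \<Longrightarrow> b \<in> D \<Longrightarrow> norm (?P t b) \<le> C2 * t * norm (A b)"
    using S.norm_psi_op_domain[OF \<psi>0 k] by blast
  \<comment> \<open>If c were 0 for every n, each primitive would itself lie in
    \<open>Hinf0\<close>, and \<open>vanishing_primitives_imp_zero\<close> would force \<psi> = 0 on
    the sector.\<close>
  have "\<exists>n h c. 2 \<le> n \<and> c \<noteq> 0 \<and>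
      (\<forall>z\<in>sector \<phi>. (h has_field_derivative (- ((\<psi>0 z + m * (z / (1 + z))) * (1 / (1 + z)) ^ n) / z)) (at z)) \<and>
      (\<lambda>z. z * h z) \<in> Hinf0 \<phi> \<and> (\<lambda>z. h z - c * (1 / (1 + z))) \<in> Hinf0 \<phi>"
  proof (rule ccontr)
    assume no: "\<not> ?thesis"
    have ex: "\<exists>h. h \<in> Hinf0 \<phi> \<and>
      (\<forall>z\<in>sector \<phi>. (h has_field_derivative (- (\<psi> z * (1 / (1 + z)) ^ n) / z)) (at z))" if n: "2 \<le> n" for n :: nat
    proof -
      have n1: "1 \<le> n" using n by simp
      obtain h c where h: "\<And>z. z \<in> sector \<phi> \<Longrightarrow>
          (h has_field_derivative (- ((\<psi>0 z + m * (z / (1 + z))) * (1 / (1 + z)) ^ n) / z)) (at z)"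
        "(\<lambda>z. z * h z) \<in> Hinf0 \<phi>" "(\<lambda>z. h z - c * (1 / (1 + z))) \<in> Hinf0 \<phi>"
        using Hinf0_primitive[OF S.\<phi>_pos S.\<phi> S.g_Hinf0[OF \<psi>0 n1] S.zg_Hinf0[OF \<psi>0 n]] by blast
      then have "c = 0" using no n by blast
      then have "h \<in> Hinf0 \<phi>" using h(3) by simp
      then show ?thesis using h(1) \<psi>_eq by (intro exI[of _ h]) simp
    qed
    have lim: "((\<lambda>r. \<psi> (complex_of_real r)) \<longlongrightarrow> m) at_top" "((\<lambda>r. \<psi> (complex_of_real r)) \<longlongrightarrow> - m + m) (at_right 0)"
      using Eclass_limits[of \<psi> "- m" m, OF \<psi>0[unfolded \<psi>0_def] S.\<phi>_pos] .
    have "\<psi> z = 0" if "z \<in> sector \<phi>" for z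
      using vanishing_primitives_imp_zero[OF S.\<phi>_pos S.\<phi> hol lim(1) _ ex that] lim(2) by simp
    then show False using nz by blast
  qed
  then obtain n h c where n: "2 \<le> n" and c: "c \<noteq> 0" and
    h: "\<And>z. z \<in> sector \<phi> \<Longrightarrow> (h has_field_derivative (- ((\<psi>0 z + m * (z / (1 + z))) * (1 / (1 + z)) ^ n) / z)) (at z)"
      "(\<lambda>z. z * h z) \<in> Hinf0 \<phi>" "(\<lambda>z. h z - c * (1 / (1 + z))) \<in> Hinf0 \<phi>" by blast
  obtain C3 where C3: "0 \<le> C3" "\<And>t x. 0 < t \<Longrightarrow> norm (S.reproducing h c t x) \<le> C3 * norm x"
    using S.norm_reproducing[OF \<psi>0 n h] by blast
  define q where "q = 1 / cmod c"
  have q: "0 < q" using c by (simp add: q_def)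
  define C where "C = 1 + C1 + C2 + q * (2 * M ^ n) + q * C3"
  have M: "0 \<le> M ^ n" using S.M by simp
  have "0 \<le> q * C3" "0 \<le> q * (2 * M ^ n)" using q C3 M by simp_all
  then have C: "1 \<le> C" "C1 \<le> C" "C2 \<le> C" "q * M ^ n \<le> C" "q * (2 * M ^ n) \<le> C" "q * C3 \<le> C"
    using C1(1) C2(1) mult_left_mono[of "M ^ n" "2 * M ^ n" q] q M unfolding C_def by linarith+
  show thesis
  proof (rule that[OF C(1) calc S.continuous_on_psi_op[OF \<psi>0]])
    fix t :: real and a b assume t: "0 < t" and b: "b \<in> D"
    have "norm (?P t (a + b)) \<le> C1 * norm a + C2 * t * norm (A b)"
      unfolding S.psi_op_add[OF \<psi>0 t]
      using norm_triangle_ineq[of "?P t a" "?P t b"] C1(2)[OF t, of a] C2(2)[OF t b] by linarith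
    also have "\<dots> \<le> C * norm a + C * (t * norm (A b))"
      using C t unfolding mult.assoc by (intro add_mono mult_right_mono) auto
    finally show "norm (?P t (a + b)) \<le> C * (norm a + t * norm (A b))" by (simp only: distrib_left)
  next
    fix t :: real and x assume t: "0 < t" and i1: "(\<lambda>s. norm (?P s x) / s) integrable_on {0..t}"
      and i2: "(\<lambda>s. norm (?P s x) / s\<^sup>2) integrable_on {t..}"
    let ?I = "integral {0..t} (\<lambda>s. norm (?P s x) / s)" and ?J = "integral {t..} (\<lambda>s. norm (?P s x) / s\<^sup>2)"
    have I: "0 \<le> ?I" by (rule Henstock_Kurzweil_Integration.integral_nonneg[OF i1]) simp
    have J: "0 \<le> ?J" by (rule Henstock_Kurzweil_Integration.integral_nonneg[OF i2]) simp
    let ?W = "S.reproducing h c t x"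
    let ?b = "inverse c *\<^sub>C ?W"
    have Wm: "?W \<in> D" by (rule S.reproducing_mem[OF \<psi>0 n h t])
    have "c *\<^sub>C x - ?W = c *\<^sub>C (x - ?b)" using c by (simp add: scaleC.diff_right scaleC_scaleC)
    then have "norm (x - ?b) = q * norm (c *\<^sub>C x - ?W)" using c by (simp add: q_def norm_scaleC)
    also have "\<dots> \<le> q * (M ^ n * ?I)"
      using S.reproducing_near[OF \<psi>0 n h t i1] q by (intro mult_left_mono) auto
    also have "\<dots> \<le> C * ?I" unfolding mult.assoc[symmetric] using C I by (intro mult_right_mono)
    finally have 1: "norm (x - ?b) \<le> C * ?I" .
    have "norm (A ?b) = q * norm (A ?W)"
      unfolding S.A_scaleC[OF Wm] by (simp add: q_def norm_scaleC norm_inverse divide_inverse)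
    also have "\<dots> \<le> q * (2 * M ^ n * ?J)"
      using S.A_reproducing_bound[OF \<psi>0 n h t i2] q by (intro mult_left_mono) auto
    also have "\<dots> \<le> C * ?J" unfolding mult.assoc[symmetric]
      using C J by (intro mult_right_mono) (simp_all add: mult.assoc)
    finally have 2: "norm (A ?b) \<le> C * ?J" .
    have "norm ?b = q * norm ?W" by (simp add: q_def norm_scaleC norm_inverse divide_inverse)
    also have "\<dots> \<le> q * (C3 * norm x)" using C3(2)[OF t] q by (intro mult_left_mono) auto
    also have "\<dots> \<le> C * norm x" unfolding mult.assoc[symmetric] using C by (intro mult_right_mono) auto
    finally have 3: "norm ?b \<le> C * norm x" .
    show "\<exists>b\<in>D. norm (x - b) \<le> C * ?I \<and> norm (A b) \<le> C * ?J \<and> norm b \<le> C * norm x"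
      using 1 2 3 S.D_scaleC[OF Wm] by blast
  qed
qed

section \<open>Elementary bounds for the K-functional\<close>

context
  fixes D :: "'a::complex_banach set" and A :: "'a \<Rightarrow> 'a"
  assumes lin: "linear_operator D A"
begin

lemma K_functional_greatest:
  assumes "\<And>a b. b \<in> D \<Longrightarrow> a + b = x \<Longrightarrow> y \<le> norm a + t * graph_norm A b"
  shows "y \<le> K_functional D A t x"
  unfolding K_functional_def
proof (rule cInf_greatest)
  have "0 \<in> D" "x + 0 = x" using lin by (auto simp: linear_operator_def)
  then show "{norm a + t * graph_norm A b | a b. b \<in> D \<and> a + b = x} \<noteq> {}" by blast
qed (use assms in blast)

lemma K_functional_le:
  assumes "0 \<le> t" "b \<in> D"
  shows "K_functional D A t x \<le> norm (x - b) + t * (norm b + norm (A b))"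
  unfolding K_functional_def
proof (rule cInf_lower)
  show "norm (x - b) + t * (norm b + norm (A b)) \<in> {norm a + t * graph_norm A b | a b. b \<in> D \<and> a + b = x}"
    using assms(2) by (force simp: graph_norm_def)
  show "bdd_below {norm a + t * graph_norm A b | a b. b \<in> D \<and> a + b = x}"
    using assms(1) by (intro bdd_belowI[of _ 0]) (auto simp: graph_norm_def)
qed

lemma K_functional_le_norm: "0 \<le> t \<Longrightarrow> K_functional D A t x \<le> norm x"
proof -
  assume t: "0 \<le> t"
  have "0 \<in> D" using lin by (simp add: linear_operator_def)
  moreover have "A 0 = 0" using lin \<open>0 \<in> D\<close> unfolding linear_operator_def by (metis add_cancel_right_right)
  ultimately show ?thesis using K_functional_le[OF t, of 0 x] by simp
qed

lemma K_functional_mono: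
  assumes "0 \<le> s" "s \<le> t" shows "K_functional D A s x \<le> K_functional D A t x"
proof (rule K_functional_greatest)
  fix a b assume b: "b \<in> D" and x: "a + b = x"
  have "K_functional D A s x \<le> norm (x - b) + s * (norm b + norm (A b))"
    by (rule K_functional_le[OF assms(1) b])
  also have "\<dots> \<le> norm a + t * graph_norm A b"
    using x assms by (auto simp: graph_norm_def intro!: mult_right_mono)
  finally show "K_functional D A s x \<le> norm a + t * graph_norm A b" .
qed

text \<open>From |x| \<le> |a| + |b|. Divided by t it bounds |x| min(1, 1/t) pointwise, which is how
  |x| is recovered from the norm of the interpolation space.\<close>

lemma K_functional_ge_min:
  assumes "0 < t" shows "min 1 t * norm x \<le> K_functional D A t x"
proof (rule K_functional_greatest)
  fix a b assume x: "a + b = x"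
  have "min 1 t * norm x \<le> min 1 t * (norm a + norm b)"
    unfolding x[symmetric] using assms by (intro mult_left_mono norm_triangle_ineq) auto
  also have "\<dots> \<le> 1 * norm a + t * norm b"
    unfolding distrib_left by (intro add_mono mult_right_mono) auto
  also have "\<dots> \<le> norm a + t * graph_norm A b"
    using assms by (simp add: graph_norm_def distrib_left)
  finally show "min 1 t * norm x \<le> norm a + t * graph_norm A b" .
qed

lemma K_functional_nonneg: "0 \<le> t \<Longrightarrow> 0 \<le> K_functional D A t x"
  by (rule K_functional_greatest) (simp add: graph_norm_def)

lemma K_functional_measurable:
  "(\<lambda>t. complex_of_real (K_functional D A t x / t)) \<in> borel_measurable (lebesgue_on {0..})"
proof -
  \<comment> \<open>Monotone functions are Borel. The cut max t 0 avoids t < 0, where the infimum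
    may be taken over a set unbounded below.\<close>
  have "mono (\<lambda>t. K_functional D A (max t 0) x)"
    by (intro monoI K_functional_mono) auto
  then have "(\<lambda>t. K_functional D A (max t 0) x) \<in> borel_measurable borel" by (rule borel_measurable_mono)
  then have "(\<lambda>t. complex_of_real (K_functional D A (max t 0) x / t)) \<in> borel_measurable borel" by measurable
  then have "(\<lambda>t. complex_of_real (K_functional D A (max t 0) x / t)) \<in> borel_measurable lebesgue"
    by (intro measurable_completion) simp
  then have "(\<lambda>t. complex_of_real (K_functional D A (max t 0) x / t)) \<in> borel_measurable (lebesgue_on {0..})"
    by (rule measurable_restrict_space1)
  then show ?thesis
    by (rule measurable_cong[THEN iffD1, rotated]) (auto simp: max_def)
qed

end

lemma continuous_on_pos_measurable:
  fixes f g :: "real \<Rightarrow> complex"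
  assumes f: "continuous_on {0<..} f" and eq: "\<And>t. 0 < t \<Longrightarrow> g t = f t" "g 0 = 0"
  shows "g \<in> borel_measurable (lebesgue_on {0..})"
proof -
  have "f \<in> borel_measurable (lebesgue_on {0<..})"
    by (rule continuous_imp_measurable_on_sets_lebesgue[OF f]) simp
  then have "(\<lambda>t. if t \<in> {0<..} then f t else 0) \<in> borel_measurable lebesgue"
    by (intro borel_measurable_if_I) auto
  then have "(\<lambda>t. if t \<in> {0<..} then f t else 0) \<in> borel_measurable (lebesgue_on {0..})"
    by (rule measurable_restrict_space1)
  then show ?thesis
    by (rule measurable_cong[THEN iffD1, rotated]) (use eq in \<open>auto simp: less_le\<close>)
qed

lemma set_integrable_complex_of_real:
  assumes "set_integrable lebesgue S (\<lambda>t. complex_of_real (f t))"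
  shows "f integrable_on S" "(LINT t:S|lebesgue. complex_of_real (f t)) = of_real (integral S f)"
proof -
  have "set_integrable lebesgue S f"
    using integrable_Re[OF assms[unfolded set_integrable_def]] by (simp add: set_integrable_def)
  from set_lebesgue_integral_eq_integral[OF this]
  show "f integrable_on S" "(LINT t:S|lebesgue. complex_of_real (f t)) = of_real (integral S f)"
    by (simp_all add: set_integral_complex_of_real)
qed

text \<open>A consequence of the ideal property, as the zero function is dominated by every
  f.\<close>

lemma (in banach_function_space) norm_nonneg: "f \<in> \<Phi> \<Longrightarrow> 0 \<le> N f"
  using ideal[of f "\<lambda>t. 0"] norm_eq_0[OF zero] by simp

lemma (in banach_function_space) norm_min_pos:
  assumes w: "(\<lambda>t. complex_of_real (min 1 (1 / t))) \<in> \<Phi>"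
  shows "0 < N (\<lambda>t. complex_of_real (min 1 (1 / t)))"
proof (rule ccontr)
  assume "\<not> ?thesis"
  then have "N (\<lambda>t. complex_of_real (min 1 (1 / t))) = 0" using norm_nonneg[OF w] by simp
  then have "AE t in lebesgue_on {0..}. complex_of_real (min 1 (1 / t)) = 0" using norm_eq_0[OF w] by blast
  then have "AE t::real in lebesgue. t \<in> {0..} \<longrightarrow> complex_of_real (min 1 (1 / t)) = 0"
    by (subst (asm) AE_restrict_space_iff) auto
  then have "AE t::real in lebesgue. t \<notin> {0<..<1}"
    by eventually_elim auto
  then have "{0<..<1::real} \<in> null_sets lebesgue"
    by (subst AE_iff_null_sets) auto
  then have "negligible {0<..<1::real}" by (simp add: negligible_iff_null_sets)
  then show False using open_not_negligible[of "{0<..<1::real}"] by simp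
qed

theorem theorem3p4:
  fixes D :: "'a::complex_banach set" and A :: "'a \<Rightarrow> 'a"
    and \<phi> :: real and \<psi> :: "complex \<Rightarrow> complex"
    and \<Phi> :: "(real \<Rightarrow> complex) set" and N :: "(real \<Rightarrow> complex) \<Rightarrow> real"
  assumes "sectorial D A"
    and "sectoriality_angle D A < \<phi>" and "\<phi> < pi"
    and "\<psi> holomorphic_on sector \<phi>" and "\<exists>z\<in>sector \<phi>. \<psi> z \<noteq> 0"
    and "\<psi> \<in> Eclass \<phi>" and "(\<lambda>z. inverse z * \<psi> z) \<in> Eclass \<phi>"
    and "banach_function_space \<Phi> N"
    and "(\<lambda>t. of_real (min 1 (1 / t))) \<in> \<Phi>"
    and "calderon_bounded \<Phi> N"
  shows "interp_space D A \<Phi> = {x. psi_orbit D A \<phi> \<psi> x \<in> \<Phi>}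
    \<and> equivalent_on (interp_space D A \<Phi>) (interp_norm D A N)
         (\<lambda>x. norm x + N (psi_orbit D A \<phi> \<psi> x))
    \<and> (0 \<in> resolvent_set D A \<longrightarrow>
         equivalent_on (interp_space D A \<Phi>) (interp_norm D A N)
           (\<lambda>x. N (psi_orbit D A \<phi> \<psi> x)))"
proof -
  interpret F: banach_function_space \<Phi> N by fact
  have lin: "linear_operator D A"
    using assms(1) by (auto simp: sectorial_def sectorial_of_angle_def)
  obtain P :: "real \<Rightarrow> 'a \<Rightarrow> 'a" and C where C: "1 \<le> C"
    and calc: "\<And>t x. 0 < t \<Longrightarrow> calculus D (\<lambda>y. t *\<^sub>R A y) \<phi> \<psi> x = P t x"
    and contP: "\<And>x. continuous_on {0<..} (\<lambda>t. P t x)"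
    and P: "\<And>t a b. 0 < t \<Longrightarrow> b \<in> D \<Longrightarrow> norm (P t (a + b)) \<le> C * (norm a + t * norm (A b))"
    and dec: "\<And>t x. 0 < t \<Longrightarrow> (\<lambda>s. norm (P s x) / s) integrable_on {0..t} \<Longrightarrow>
      (\<lambda>s. norm (P s x) / s\<^sup>2) integrable_on {t..} \<Longrightarrow>
      \<exists>b\<in>D. norm (x - b) \<le> C * integral {0..t} (\<lambda>s. norm (P s x) / s) \<and>
        norm (A b) \<le> C * integral {t..} (\<lambda>s. norm (P s x) / s\<^sup>2) \<and> norm b \<le> C * norm x"
    by (rule calculus_estimates[OF assms(1-7)]) (rule that; assumption)
  let ?K = "K_functional D A"
  let ?kf = "\<lambda>x t. complex_of_real (?K t x / t)"
  let ?ob = "psi_orbit D A \<phi> \<psi>"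
  let ?w = "\<lambda>t::real. complex_of_real (min 1 (1 / t))"
  have w: "?w \<in> \<Phi>" by fact
  define W where "W = N ?w"
  have W: "0 < W" unfolding W_def by (rule F.norm_min_pos[OF w])
  have ob_pos: "?ob x t = of_real (norm (P t x) / t)" if "0 < t" for x t
    using that by (simp add: psi_orbit_def calc)
  have ob_0: "?ob x 0 = 0" for x by (simp add: psi_orbit_def)
  have ob_meas: "?ob x \<in> borel_measurable (lebesgue_on {0..})" for x
  proof (rule continuous_on_pos_measurable[where f = "\<lambda>t. complex_of_real (norm (P t x) / t)"])
    show "continuous_on {0<..} (\<lambda>t. complex_of_real (norm (P t x) / t))"
      by (intro continuous_intros contP) auto
  qed (use ob_pos ob_0 in auto)
  have PK: "norm (P t x) \<le> C * ?K t x" if t: "0 < t" for t x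
  proof -
    have "norm (P t x) / C \<le> ?K t x"
    proof (rule K_functional_greatest[OF lin])
      fix a b assume b: "b \<in> D" and x: "a + b = x"
      have "norm (P t x) \<le> C * (norm a + t * norm (A b))" using P[OF t b, of a] by (simp only: x)
      also have "\<dots> \<le> C * (norm a + t * graph_norm A b)"
        using C t by (intro mult_left_mono add_left_mono) (auto simp: graph_norm_def)
      finally show "norm (P t x) / C \<le> norm a + t * graph_norm A b"
        using C by (simp add: divide_le_eq mult.commute)
    qed
    then show ?thesis using C by (simp add: divide_le_eq mult.commute)
  qed
  \<comment> \<open>By the convention x/0 = 0 the orbit and the quotient K(t,x)/t vanish at t = 0,
    so the pointwise inequalities can be checked there as well.\<close>
  have AEI: "AE t in lebesgue_on {0..}. Q t" if "Q 0" "\<And>t. 0 < t \<Longrightarrow> Q t" for Q :: "real \<Rightarrow> bool"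
    by (rule AE_I2) (use that in \<open>auto simp: le_less\<close>)
  have dir1: "?ob x \<in> \<Phi> \<and> N (?ob x) \<le> C * N (?kf x)" "norm x * W \<le> N (?kf x)" if x: "?kf x \<in> \<Phi>" for x
  proof -
    let ?g = "\<lambda>t. complex_of_real C * ?kf x t"
    have "?ob x \<in> \<Phi> \<and> N (?ob x) \<le> N ?g"
    proof (rule F.ideal[OF F.scale[OF x] ob_meas], rule AEI)
      show "cmod (?ob x 0) \<le> cmod (?g 0)" by (simp add: ob_0)
      fix t :: real assume t: "0 < t"
      have "norm (P t x) / t \<le> C * ?K t x / t" using PK[OF t] t by (intro divide_right_mono) auto
      moreover have "0 \<le> ?K t x" using t by (intro K_functional_nonneg[OF lin]) auto
      ultimately show "cmod (?ob x t) \<le> cmod (?g t)"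
        using t C by (simp add: ob_pos norm_mult norm_divide)
    qed
    then show "?ob x \<in> \<Phi> \<and> N (?ob x) \<le> C * N (?kf x)" using F.norm_scale[OF x, of "of_real C"] C by simp
    let ?f = "\<lambda>t. complex_of_real (norm x) * ?w t"
    have f: "?f \<in> \<Phi>" by (rule F.scale[OF w])
    have "?f \<in> \<Phi> \<and> N ?f \<le> N (?kf x)"
    proof (rule F.ideal[OF x F.measurable[OF f]], rule AEI)
      show "cmod (?f 0) \<le> cmod (?kf x 0)" by simp
      fix t :: real assume t: "0 < t"
      have "min 1 t * norm x / t \<le> ?K t x / t"
        using K_functional_ge_min[OF lin t] t by (intro divide_right_mono) auto
      moreover have "norm x * min 1 (1 / t) = min 1 t * norm x / t" using t by (simp add: min_def field_simps)
      moreover have "0 \<le> ?K t x" using t by (intro K_functional_nonneg[OF lin]) auto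
      ultimately have "norm x * min 1 (1 / t) \<le> \<bar>?K t x / t\<bar>" by linarith
      moreover have "0 \<le> norm x * min 1 (1 / t)" using t by simp
      ultimately show "cmod (?f t) \<le> cmod (?kf x t)"
        unfolding of_real_mult[symmetric] norm_of_real by linarith
    qed
    then show "norm x * W \<le> N (?kf x)" using F.norm_scale[OF w, of "of_real (norm x)"] by (simp add: W_def)
  qed
  obtain C0 where cal: "\<Phi> \<subseteq> P_domain \<inter> Q_domain"
    "\<And>f. f \<in> \<Phi> \<Longrightarrow> (\<lambda>t. P_op f t + Q_op f t) \<in> \<Phi>"
    "\<And>f. f \<in> \<Phi> \<Longrightarrow> N (\<lambda>t. P_op f t + Q_op f t) \<le> C0 * N f"
    using assms(10) by (auto simp: calderon_bounded_def)
  let ?I = "\<lambda>x t. integral {0..t} (\<lambda>s. norm (P s x) / s)" and ?J = "\<lambda>x t. integral {t..} (\<lambda>s. norm (P s x) / s\<^sup>2)"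
  \<comment> \<open>Membership in the domains of the Hardy operator and its adjoint is exactly the
    integrability that \<open>dec\<close> asks for; the measure ds/s of the adjoint turns
    |\<psi>(sA)x|/s into |\<psi>(sA)x|/s^2.\<close>
  have PQ: "(\<lambda>s. norm (P s x) / s) integrable_on {0..t} \<and> (\<lambda>s. norm (P s x) / s\<^sup>2) integrable_on {t..} \<and>
      P_op (?ob x) t + Q_op (?ob x) t = of_real (?I x t / t + ?J x t)"
    if x: "?ob x \<in> \<Phi>" and t: "0 < t" for x t
  proof -
    let ?o = "\<lambda>s. norm ((1 / s) *\<^sub>R calculus D (\<lambda>y. s *\<^sub>R A y) \<phi> \<psi> x)"
    have ob: "?ob x = (\<lambda>s. complex_of_real (?o s))" by (simp add: psi_orbit_def fun_eq_iff)
    have o1: "?o s = norm (P s x) / s" if "s \<in> {0..t}" for s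
      using that calc[of s x] by (cases "s = 0") auto
    have o2: "?o s / s = norm (P s x) / s\<^sup>2" if "s \<in> {t<..}" for s
      using that t calc[of s x] by (auto simp: power2_eq_square)
    have s1: "set_integrable lebesgue {0..t} (\<lambda>s. complex_of_real (?o s))"
      using cal(1) x t unfolding ob P_domain_def by blast
    note i1 = set_integrable_complex_of_real[OF s1]
    have "set_integrable lebesgue {t<..} (\<lambda>s. complex_of_real (?o s) / of_real s)"
      using cal(1) x t unfolding ob Q_domain_def by blast
    then have s2: "set_integrable lebesgue {t<..} (\<lambda>s. complex_of_real (?o s / s))"
      by (simp only: of_real_divide)
    note i2 = set_integrable_complex_of_real[OF s2]
    have "(\<lambda>s. norm (P s x) / s) integrable_on {0..t}" using i1(1) o1 by (rule integrable_eq)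
    moreover have j: "(\<lambda>s. norm (P s x) / s\<^sup>2) integrable_on {t<..}" using i2(1) o2 by (rule integrable_eq)
    have "(\<lambda>s. norm (P s x) / s\<^sup>2) integrable_on {t..}"
      by (rule integrable_spike_set[OF j]) (auto intro: negligible_subset[of "{t}"])
    moreover have "integral {t<..} (\<lambda>s. ?o s / s) = ?J x t"
    proof -
      have "integral {t<..} (\<lambda>s. ?o s / s) = integral {t<..} (\<lambda>s. norm (P s x) / s\<^sup>2)"
        by (rule Henstock_Kurzweil_Integration.integral_cong) (rule o2)
      also have "\<dots> = ?J x t"
        by (rule integral_subset_negligible) (auto intro: negligible_subset[of "{t}"])
      finally show ?thesis .
    qed
    moreover have "integral {0..t} ?o = ?I x t"
      by (rule Henstock_Kurzweil_Integration.integral_cong) (rule o1)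
    moreover have "P_op (?ob x) t = of_real (1 / t) * of_real (integral {0..t} ?o)"
      unfolding P_op_def ob i1(2) ..
    moreover have "Q_op (?ob x) t = of_real (integral {t<..} (\<lambda>s. ?o s / s))"
      unfolding Q_op_def ob of_real_divide[symmetric] i2(2) ..
    ultimately show ?thesis by simp
  qed
  have IJ: "0 \<le> ?I x t / t" "0 \<le> ?J x t" if "?ob x \<in> \<Phi>" "0 < t" for x t
    using PQ[OF that] that
    by (auto intro!: divide_nonneg_nonneg Henstock_Kurzweil_Integration.integral_nonneg)
  \<comment> \<open>The constant \<open>C0\<close> comes without a sign, hence its absolute
    value.\<close>
  have dir2: "?kf x \<in> \<Phi> \<and> N (?kf x) \<le> C * \<bar>C0\<bar> * N (?ob x) + C * W * norm x" if x: "?ob x \<in> \<Phi>" for x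
  proof -
    let ?pq = "\<lambda>t. P_op (?ob x) t + Q_op (?ob x) t"
    let ?g1 = "\<lambda>t. complex_of_real C * ?pq t" and ?g2 = "\<lambda>t. complex_of_real (C * norm x) * ?w t"
    have g: "?g1 \<in> \<Phi>" "?g2 \<in> \<Phi>" using F.scale[OF cal(2)[OF x]] F.scale[OF w] by blast+
    have "?kf x \<in> \<Phi> \<and> N (?kf x) \<le> N (\<lambda>t. ?g1 t + ?g2 t)"
    proof (rule F.ideal[OF F.add[OF g] K_functional_measurable[OF lin]], rule AEI)
      show "cmod (?kf x 0) \<le> cmod (?g1 0 + ?g2 0)" by simp
      fix t :: real assume t: "0 < t"
      note pq = PQ[OF x t]
      obtain b where b: "b \<in> D" "norm (x - b) \<le> C * ?I x t" "norm (A b) \<le> C * ?J x t" "norm b \<le> C * norm x"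
        using dec[OF t] pq by blast
      have K0: "0 \<le> ?K t x" using t by (intro K_functional_nonneg[OF lin]) auto
      have "?K t x \<le> norm (x - b) + t * (norm b + norm (A b))"
        using t b(1) by (intro K_functional_le[OF lin]) auto
      also have "\<dots> \<le> C * ?I x t + t * (C * norm x + C * ?J x t)"
        using b t by (intro add_mono mult_left_mono) auto
      finally have "?K t x / t \<le> (C * ?I x t + t * (C * norm x + C * ?J x t)) / t"
        using t by (intro divide_right_mono) auto
      also have "\<dots> = C * (?I x t / t + ?J x t) + C * norm x" using t by (simp add: field_simps)
      finally have k1: "?K t x / t \<le> C * (?I x t / t + ?J x t) + C * norm x" .
      \<comment> \<open>For large t the summand t |b| is too big; the decomposition x = x + 0 then
        gives K(t,x) \<le> |x|. The bounds \<open>k1\<close> and \<open>k2\<close> together produce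
        min(1, 1/t).\<close>
      have "?K t x \<le> 1 * norm x" using K_functional_le_norm[OF lin, of t x] t by simp
      also have "\<dots> \<le> C * norm x" using C by (intro mult_right_mono) auto
      finally have "?K t x / t \<le> C * norm x / t" using t by (intro divide_right_mono) auto
      moreover have pos: "0 \<le> C * (?I x t / t + ?J x t)" using IJ[OF x t] C by simp
      ultimately have k2: "?K t x / t \<le> C * (?I x t / t + ?J x t) + C * norm x / t" by linarith
      have "?K t x / t \<le> C * (?I x t / t + ?J x t) + C * norm x * min 1 (1 / t)"
        using k1 k2 by (cases "1 \<le> 1 / t") (simp_all add: min_def)
      moreover have "0 \<le> C * norm x * min 1 (1 / t)" using C t by simp
      moreover have "?g1 t + ?g2 t = of_real (C * (?I x t / t + ?J x t) + C * norm x * min 1 (1 / t))"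
        using pq by simp
      ultimately show "cmod (?kf x t) \<le> cmod (?g1 t + ?g2 t)"
        using K0 t pos by (simp only: norm_of_real) (simp add: abs_of_nonneg)
    qed
    moreover have "N (\<lambda>t. ?g1 t + ?g2 t) \<le> N ?g1 + N ?g2" by (rule F.norm_triangle[OF g])
    moreover have "N ?g1 = C * N ?pq" using F.norm_scale[OF cal(2)[OF x], of "of_real C"] C by simp
    moreover have "N ?g2 = C * norm x * W"
      using F.norm_scale[OF w, of "of_real (C * norm x)"] C by (simp add: W_def norm_mult)
    moreover have "C * N ?pq \<le> C * (\<bar>C0\<bar> * N (?ob x))"
    proof (rule mult_left_mono)
      have "C0 * N (?ob x) \<le> \<bar>C0\<bar> * N (?ob x)" by (intro mult_right_mono F.norm_nonneg x) simp
      then show "N ?pq \<le> \<bar>C0\<bar> * N (?ob x)" using cal(3)[OF x] by linarith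
    qed (use C in simp)
    ultimately show ?thesis by (simp add: mult_ac)
  qed
  have space: "interp_space D A \<Phi> = {x. ?ob x \<in> \<Phi>}"
    using dir1(1) dir2 by (auto simp: interp_space_def)
  have mem: "?kf x \<in> \<Phi>" "?ob x \<in> \<Phi>" if "x \<in> interp_space D A \<Phi>" for x
    using that space by (auto simp: interp_space_def)
  have norm_eq: "interp_norm D A N x = N (?kf x)" for x by (simp add: interp_norm_def)
  have eq1: "equivalent_on (interp_space D A \<Phi>) (interp_norm D A N) (\<lambda>x. norm x + N (?ob x))"
    unfolding equivalent_on_def norm_eq
  proof (intro exI conjI ballI)
    \<comment> \<open>The bounds of |x| by 1/W and of the orbit norm by \<open>C\<close>, both
      relative to the interpolation norm, add up to 1/W + C.\<close>
    let ?c = "1 / (1 / W + C)" and ?C = "C * \<bar>C0\<bar> + C * W"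
    have p: "0 < 1 / W + C" using W C by (intro add_pos_pos) auto
    show "0 < ?c" using p by simp
    show "0 < ?C" using C W by (intro add_nonneg_pos) auto
    fix x assume x: "x \<in> interp_space D A \<Phi>"
    have "norm x \<le> N (?kf x) / W" using dir1(2)[OF mem(1)[OF x]] W by (simp add: pos_le_divide_eq)
    then have "norm x + N (?ob x) \<le> (1 / W + C) * N (?kf x)"
      using dir1(1)[OF mem(1)[OF x]] by (simp add: distrib_right)
    then show "?c * (norm x + N (?ob x)) \<le> N (?kf x)" using p by (simp add: pos_divide_le_eq mult.commute)
    have "N (?kf x) \<le> C * \<bar>C0\<bar> * N (?ob x) + C * W * norm x" using dir2[OF mem(2)[OF x]] by blast
    also have "\<dots> \<le> ?C * N (?ob x) + ?C * norm x"
      using C W F.norm_nonneg[OF mem(2)[OF x]] by (intro add_mono mult_right_mono) auto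
    finally show "N (?kf x) \<le> ?C * (norm x + N (?ob x))" by (simp add: distrib_left)
  qed
  have eq2: "equivalent_on (interp_space D A \<Phi>) (interp_norm D A N) (\<lambda>x. N (?ob x))" if 0: "0 \<in> resolvent_set D A"
  proof -
    have "bounded_linear (resolvent D A 0)" using 0 by (simp add: resolvent_set_def)
    then obtain L where L: "0 < L" "\<And>y. norm (resolvent D A 0 y) \<le> norm y * L"
      using bounded_linear.pos_bounded by blast
    have inj: "inj_on (\<lambda>x. 0 *\<^sub>C x - A x) D" using 0 by (simp add: resolvent_set_def bij_betw_def)
    \<comment> \<open>Bounding |b| by |A b| lets t |b| be absorbed into the term of the adjoint
      Hardy operator, so that no multiple of min(1, 1/t), and hence no |x|, remains.\<close>
    have bA: "norm b \<le> L * norm (A b)" if b: "b \<in> D" for b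
    proof -
      have "resolvent D A 0 (0 *\<^sub>C b - A b) = b" unfolding resolvent_def by (rule inv_into_f_f[OF inj b])
      then show ?thesis using L(2)[of "0 *\<^sub>C b - A b"] by (simp add: scaleC.zero_left mult.commute)
    qed
    have dir3: "N (?kf x) \<le> (L + 1) * C * \<bar>C0\<bar> * N (?ob x)" if x: "?ob x \<in> \<Phi>" for x
    proof -
      let ?pq = "\<lambda>t. P_op (?ob x) t + Q_op (?ob x) t"
      let ?g = "\<lambda>t. complex_of_real ((L + 1) * C) * ?pq t"
      have LC: "0 \<le> (L + 1) * C" using L C by simp
      have "?kf x \<in> \<Phi> \<and> N (?kf x) \<le> N ?g"
      proof (rule F.ideal[OF F.scale[OF cal(2)[OF x]] K_functional_measurable[OF lin]], rule AEI)
        show "cmod (?kf x 0) \<le> cmod (?g 0)" by simp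
        fix t :: real assume t: "0 < t"
        note pq = PQ[OF x t]
        obtain b where b: "b \<in> D" "norm (x - b) \<le> C * ?I x t" "norm (A b) \<le> C * ?J x t"
          using dec[OF t] pq by blast
        have K0: "0 \<le> ?K t x" using t by (intro K_functional_nonneg[OF lin]) auto
        have I0: "0 \<le> ?I x t" using IJ(1)[OF x t] t by (simp add: zero_le_divide_iff)
        have "norm b + norm (A b) \<le> (L + 1) * norm (A b)" using bA[OF b(1)] by (simp add: distrib_right)
        also have "\<dots> \<le> (L + 1) * (C * ?J x t)" using b(3) L by (intro mult_left_mono) auto
        finally have nb: "norm b + norm (A b) \<le> (L + 1) * (C * ?J x t)" .
        have "1 * (C * ?I x t) \<le> (L + 1) * (C * ?I x t)" using L C I0 by (intro mult_right_mono) auto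
        then have nx: "norm (x - b) \<le> (L + 1) * (C * ?I x t)" using b(2) by linarith
        have "?K t x \<le> norm (x - b) + t * (norm b + norm (A b))"
          using t b(1) by (intro K_functional_le[OF lin]) auto
        also have "\<dots> \<le> (L + 1) * (C * ?I x t) + t * ((L + 1) * (C * ?J x t))"
          using t by (intro add_mono nx mult_left_mono nb) auto
        finally have "?K t x / t \<le> ((L + 1) * (C * ?I x t) + t * ((L + 1) * (C * ?J x t))) / t"
          using t by (intro divide_right_mono) auto
        also have "\<dots> = (L + 1) * C * (?I x t / t + ?J x t)" using t by (simp add: field_simps)
        finally have "?K t x / t \<le> (L + 1) * C * (?I x t / t + ?J x t)" .
        moreover have "?g t = of_real ((L + 1) * C * (?I x t / t + ?J x t))" using pq by simp
        ultimately show "cmod (?kf x t) \<le> cmod (?g t)"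
          using K0 t by (simp only: norm_of_real) (simp add: abs_of_nonneg)
      qed
      moreover have "N ?g = (L + 1) * C * N ?pq"
        using F.norm_scale[OF cal(2)[OF x], of "of_real ((L + 1) * C)"] LC
        by (simp only: norm_of_real abs_of_nonneg)
      moreover have "(L + 1) * C * N ?pq \<le> (L + 1) * C * (\<bar>C0\<bar> * N (?ob x))"
      proof (rule mult_left_mono[OF _ LC])
        have "C0 * N (?ob x) \<le> \<bar>C0\<bar> * N (?ob x)" by (intro mult_right_mono F.norm_nonneg x) simp
        then show "N ?pq \<le> \<bar>C0\<bar> * N (?ob x)" using cal(3)[OF x] by linarith
      qed
      ultimately show ?thesis by (simp add: mult_ac)
    qed
    show ?thesis
      unfolding equivalent_on_def norm_eq
    proof (intro exI conjI ballI)
      \<comment> \<open>The summand 1 keeps the constant positive when \<open>C0\<close> is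
        0.\<close>
      let ?C = "(L + 1) * C * \<bar>C0\<bar> + 1"
      show "0 < 1 / C" using C by simp
      show "0 < ?C" using C L by (intro add_nonneg_pos) auto
      fix x assume x: "x \<in> interp_space D A \<Phi>"
      show "1 / C * N (?ob x) \<le> N (?kf x)"
        using dir1(1)[OF mem(1)[OF x]] C by (simp add: pos_divide_le_eq mult.commute)
      show "N (?kf x) \<le> ?C * N (?ob x)"
        using dir3[OF mem(2)[OF x]] F.norm_nonneg[OF mem(2)[OF x]] by (simp add: distrib_right)
    qed
  qed
  show ?thesis using space eq1 eq2 by blast
qed

end
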